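(* Let $A=\operatorname{Re}m_\infty(i)$, $B=-\operatorname{Im}m_\infty(i)$, $m=m_\infty(-0)$. Among all Schrödinger L-systems $\Theta_{\mu,h}$ ($\operatorname{Im}h>0$, $\mu\in\mathbb R\cup\{\infty\}$) with accretive main operator $T_h$ and accretive state-space operator $\mathbb A_{\mu,h}$, the maximum finite c-entropy $$\mathcal S_{max}=-\frac12\ln\left(\frac{\sqrt{A^2+B^2-2mA+m^2}-B}{\sqrt{A^2+B^2-2mA+m^2}+B}\right)$$ is achieved when $T_h$ is extremal accretive. In this case $$h=-m+i\sqrt{(A-m)^2+B^2},\qquad\mu=\infty,$$ and the quasi-kernel of $\operatorname{Re}\mathbb A_{\mu,h}$ is the Kreĭn-von Neumann extension $A_K$ of $\dot A$, defined by $A_Ky=-y''+q(x)y$ with the boundary condition $y'(\ell)+m_\infty(-0)y(\ell)=0$.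
   Context: Setting. Let $\ell\in\mathbb R$, let $q$ be a (fixed) real locally summable function on $[\ell,+\infty)$, $l(y)=-y''+q(x)y$, $\mathcal H=L_2(\ell,+\infty)$. Let $D^*$ be the set of $y\in\mathcal H$ that are locally absolutely continuous together with $y'$ and satisfy $l(y)\in\mathcal H$. The minimal symmetric operator $\dot A y=l(y)$ with boundary conditions $y(\ell)=y'(\ell)=0$ is assumed to have deficiency indices $(1,1)$; $\operatorname{Dom}(\dot A^* )=D^*$, $\dot A^*y=l(y)$. For $h\in\mathbb C$ with $\operatorname{Im}h>0$, $T_h y=l(y)$ with domain $\{y\in D^*: y'(\ell)=hy(\ell)\}$. Weyl function. Let $\varphi_1,\varphi_2$ solve $l(\varphi_k)=\lambda\varphi_k$ with $\varphi_1(\ell,\lambda)=0,\varphi_1'(\ell,\lambda)=1$, $\varphi_2(\ell,\lambda)=-1,\varphi_2'(\ell,\lambda)=0$. The Weyl function $m_\infty(\lambda)$ is such that $\varphi_2(\cdot,\lambda)+m_\infty(\lambda)\varphi_1(\cdot,\lambda)\in L_2(\ell,+\infty)$. One has $\operatorname{Im}m_\infty(i)<0$. Standing assumptions: $\dot A$ is nonnegative, $(\dot Af,f)\ge0$ for $f\in\operatorname{Dom}(\dot A)$, and $m_\infty(-0):=\lim_{\lambda\to0,\lambda<0}m_\infty(\lambda)<\infty$. Schrödinger L-systems. $\mathcal H_+=D^*$ with $(y,z)_+=\int_\ell^\infty (y\bar z+l(y)\overline{l(z)})dx$, and $\mathcal H_+\subset\mathcal H\subset\mathcal H_-$ is the corresponding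 rigged triplet; $\delta(x-\ell),\delta'(x-\ell)\in\mathcal H_-$ act by $(y,\delta)=y(\ell)$, $(y,\delta')=-y'(\ell)$. For $\mu\in\mathbb R\cup\{\infty\}$ the state-space operator $\mathbb A_{\mu,h}:\mathcal H_+\to\mathcal H_-$ is $\mathbb A_{\mu,h}y=-y''+q y-\frac1{\mu-h}[y'(\ell)-hy(\ell)][\mu\delta(x-\ell)+\delta'(x-\ell)]$, and $g=\frac{(\operatorname{Im}h)^{1/2}}{|\mu-h|}[\mu\delta(x-\ell)+\delta'(x-\ell)]$ (limits as $\mu\to\infty$ if $\mu=\infty$, so $\mathbb A_{\infty,h}y=-y''+qy-[y'(\ell)-hy(\ell)]\delta(x-\ell)$), $Kc=cg$ for $c\in\mathbb C$; then $\operatorname{Im}\mathbb A_{\mu,h}=KK^*$. The array $\Theta_{\mu,h}=(\mathbb A_{\mu,h},K,1;\ \mathcal H_+\subset\mathcal H\subset\mathcal H_-,\mathbb C)$ is the Schrödinger L-system with main operator $T_h$ and state-space operator $\mathbb A_{\mu,h}$. Its transfer function is $W_{\Theta_{\mu,h}}(z)=I-2iK^*(\mathbb A_{\mu,h}-zI)^{-1}K=\frac{\mu-h}{\mu-\bar h}\cdot\frac{m_\infty(z)+\bar h}{m_\infty(z)+h}$ (limit as $\mu\to\infty$ if $\mu=\infty$). $\operatorname{Re}\mathbb A=\frac12(\mathbb A+\mathbb A^* )$. The quasi-kernel of $\operatorname{Re}\mathbb A_{\mu,h}$ is the operator $\hat A$ in $\mathcal H$ with $\operatorname{Dom}(\hat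 A)=\{f\in\mathcal H_+:(\operatorname{Re}\mathbb A_{\mu,h})f\in\mathcal H\}$, $\hat A=\operatorname{Re}\mathbb A_{\mu,h}\restriction\operatorname{Dom}(\hat A)$. The c-entropy of $\Theta_{\mu,h}$ is $\mathcal S=-\ln|W_{\Theta_{\mu,h}}(-i)|$; it equals $-\ln|\kappa|$ where $|\kappa|=\left|\frac{m_\infty(i)+h}{m_\infty(i)+\bar h}\right|<1$ is the modulus of von Neumann's parameter of $T_h$. Accretivity. A linear operator $T$ in $\mathcal H$ is accretive if $\operatorname{Re}(Tf,f)\ge0$ for all $f\in\operatorname{Dom}(T)$; it is $\alpha$-sectorial, $\alpha\in(0,\pi/2)$, if $(\cot\alpha)|\operatorname{Im}(Tf,f)|\le\operatorname{Re}(Tf,f)$ for all $f\in\operatorname{Dom}(T)$; an accretive operator is extremal (extremal accretive) if it is not $\alpha$-sectorial for any $\alpha\in(0,\pi/2)$. $\mathbb A_{\mu,h}$ is accretive if $\operatorname{Re}(\mathbb A_{\mu,h}f,f)\ge0$ for all $f\in\mathcal H_+$. *)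

theory Defs
  imports "HOL-Analysis.Analysis" "HOL-Library.Function_Algebras"
begin

section \<open>The Hilbert space and the differential expression\<close>

definition locally_summable :: "real \<Rightarrow> (real \<Rightarrow> 'a::euclidean_space) \<Rightarrow> bool" where
  "locally_summable l f \<longleftrightarrow> (\<forall>b\<ge>l. f absolutely_integrable_on {l..b})"

text \<open>Elements of \<open>L\<^sub>2(l, \<infinity>)\<close> are represented by functions on the line, of which only the
  values on \<open>[l, \<infinity>)\<close>, up to null sets, matter.\<close>

definition L2 :: "real \<Rightarrow> (real \<Rightarrow> complex) set" where
  "L2 l = {f. f \<in> borel_measurable (lebesgue_on {l..}) \<and>
              integrable (lebesgue_on {l..}) (\<lambda>x. (cmod (f x))\<^sup>2)}"

definition L2_inner :: "real \<Rightarrow> (real \<Rightarrow> complex) \<Rightarrow> (real \<Rightarrow> complex) \<Rightarrow> complex" where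
  "L2_inner l f g = (LINT x|lebesgue_on {l..}. f x * cnj (g x))"

text \<open>Local absolute continuity on \<open>[l, \<infinity>)\<close>: being the indefinite Lebesgue integral of a locally
  summable function.\<close>

definition locally_AC :: "real \<Rightarrow> (real \<Rightarrow> complex) \<Rightarrow> bool" where
  "locally_AC l f \<longleftrightarrow>
     (\<exists>g. locally_summable l g \<and> (\<forall>x\<ge>l. f x = f l + integral {l..x} g))"

text \<open>Derivatives on \<open>[l, \<infinity>)\<close>, one-sided at \<open>l\<close>.\<close>

definition der :: "real \<Rightarrow> (real \<Rightarrow> complex) \<Rightarrow> real \<Rightarrow> complex" where
  "der l y x = vector_derivative y (at x within {l..})"

definition AC_with_derivative :: "real \<Rightarrow> (real \<Rightarrow> complex) \<Rightarrow> bool" where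
  "AC_with_derivative l y \<longleftrightarrow>
     locally_AC l y \<and> (\<forall>x\<ge>l. y differentiable (at x within {l..})) \<and> locally_AC l (der l y)"

text \<open>For \<open>y\<close> with \<open>AC_with_derivative l y\<close> the second derivative exists only almost everywhere, so
  \<open>sl_expr q l y\<close> is meaningful only up to null sets.\<close>

definition sl_expr :: "(real \<Rightarrow> real) \<Rightarrow> real \<Rightarrow> (real \<Rightarrow> complex) \<Rightarrow> real \<Rightarrow> complex" where
  "sl_expr q l y x = - der l (der l y) x + complex_of_real (q x) * y x"

text \<open>The set \<open>D\<^sup>*\<close>. Its members are normalised to vanish to the left of \<open>l\<close>; being continuous on
  \<open>[l, \<infinity>)\<close>, they are then unique representatives of their classes in \<open>L\<^sub>2(l, \<infinity>)\<close>.\<close>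

definition Dstar :: "(real \<Rightarrow> real) \<Rightarrow> real \<Rightarrow> (real \<Rightarrow> complex) set" where
  "Dstar q l = {y. (\<forall>x<l. y x = 0) \<and> y \<in> L2 l \<and> AC_with_derivative l y \<and> sl_expr q l y \<in> L2 l}"

section \<open>Operators in the Hilbert space\<close>

text \<open>An operator is given by its graph; the second component of a pair ranges over all
  representatives of the image.\<close>

type_synonym op_graph = "((real \<Rightarrow> complex) \<times> (real \<Rightarrow> complex)) set"

definition sl_op :: "(real \<Rightarrow> real) \<Rightarrow> real \<Rightarrow> (real \<Rightarrow> complex) set \<Rightarrow> op_graph" where
  "sl_op q l D = {(y, u). y \<in> D \<and> u \<in> L2 l \<and> (AE x in lebesgue_on {l..}. u x = sl_expr q l y x)}"

definition minimal_op :: "(real \<Rightarrow> real) \<Rightarrow> real \<Rightarrow> op_graph" where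
  "minimal_op q l = sl_op q l {y \<in> Dstar q l. y l = 0 \<and> der l y l = 0}"

definition T_op :: "(real \<Rightarrow> real) \<Rightarrow> real \<Rightarrow> complex \<Rightarrow> op_graph" where
  "T_op q l h = sl_op q l {y \<in> Dstar q l. der l y l = h * y l}"

text \<open>The Krein-von Neumann extension of the minimal operator; \<open>m\<close> is the limit \<open>m\<^sub>\<infinity>(-0)\<close>.\<close>

definition krein_von_neumann_op :: "(real \<Rightarrow> real) \<Rightarrow> real \<Rightarrow> real \<Rightarrow> op_graph" where
  "krein_von_neumann_op q l m =
     sl_op q l {y \<in> Dstar q l. der l y l + complex_of_real m * y l = 0}"

text \<open>The dimension over the complex numbers of the kernel of \<open>A\<^sup>* - z\<close>, where \<open>A\<close> is the minimal
  operator and \<open>A\<^sup>*\<close> acts as the differential expression on \<open>D\<^sup>*\<close>.\<close>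

definition deficiency_index :: "(real \<Rightarrow> real) \<Rightarrow> real \<Rightarrow> complex \<Rightarrow> nat" where
  "deficiency_index q l z =
     vector_space.dim (\<lambda>(c::complex) (f :: real \<Rightarrow> complex) x. c * f x)
       {y \<in> Dstar q l. AE x in lebesgue_on {l..}. sl_expr q l y x = z * y x}"

definition nonnegative_op :: "real \<Rightarrow> op_graph \<Rightarrow> bool" where
  "nonnegative_op l T \<longleftrightarrow> (\<forall>(f, u)\<in>T. L2_inner l u f \<in> \<real>\<^sub>\<ge>\<^sub>0)"

definition accretive_op :: "real \<Rightarrow> op_graph \<Rightarrow> bool" where
  "accretive_op l T \<longleftrightarrow> (\<forall>(f, u)\<in>T. Re (L2_inner l u f) \<ge> 0)"

definition sectorial_op :: "real \<Rightarrow> real \<Rightarrow> op_graph \<Rightarrow> bool" where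
  "sectorial_op l \<alpha> T \<longleftrightarrow>
     (\<forall>(f, u)\<in>T. cot \<alpha> * \<bar>Im (L2_inner l u f)\<bar> \<le> Re (L2_inner l u f))"

definition extremal_accretive_op :: "real \<Rightarrow> op_graph \<Rightarrow> bool" where
  "extremal_accretive_op l T \<longleftrightarrow>
     accretive_op l T \<and> (\<forall>\<alpha>\<in>{0<..<pi/2}. \<not> sectorial_op l \<alpha> T)"

section \<open>Weyl function\<close>

definition sl_solution ::
  "(real \<Rightarrow> real) \<Rightarrow> real \<Rightarrow> complex \<Rightarrow> (real \<Rightarrow> complex) \<Rightarrow> bool" where
  "sl_solution q l z y \<longleftrightarrow>
     AC_with_derivative l y \<and> (AE x in lebesgue_on {l..}. sl_expr q l y x = z * y x)"

definition fundamental_solutions ::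
  "(real \<Rightarrow> real) \<Rightarrow> real \<Rightarrow> (complex \<Rightarrow> real \<Rightarrow> complex) \<Rightarrow> (complex \<Rightarrow> real \<Rightarrow> complex) \<Rightarrow> bool" where
  "fundamental_solutions q l \<phi>1 \<phi>2 \<longleftrightarrow>
     (\<forall>z. sl_solution q l z (\<phi>1 z) \<and> \<phi>1 z l = 0 \<and> der l (\<phi>1 z) l = 1 \<and>
          sl_solution q l z (\<phi>2 z) \<and> \<phi>2 z l = -1 \<and> der l (\<phi>2 z) l = 0)"

text \<open>As the minimal operator is nonnegative, the Weyl function lives on the complement of
  \<open>[0, \<infinity>)\<close>.\<close>

definition weyl_function ::
  "real \<Rightarrow> (complex \<Rightarrow> real \<Rightarrow> complex) \<Rightarrow> (complex \<Rightarrow> real \<Rightarrow> complex) \<Rightarrow> (complex \<Rightarrow> complex) \<Rightarrow> bool" where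
  "weyl_function l \<phi>1 \<phi>2 minf \<longleftrightarrow>
     (\<forall>z. z \<notin> \<real>\<^sub>\<ge>\<^sub>0 \<longrightarrow> (\<lambda>x. \<phi>2 z x + minf z * \<phi>1 z x) \<in> L2 l)"

section \<open>Schroedinger L-systems\<close>

datatype boundary_param = Finite real | Infinite

text \<open>An element \<open>F\<close> of \<open>H\<^sub>-\<close> is represented by the antilinear functional \<open>v \<mapsto> (F, v)\<close> on
  \<open>H\<^sub>+ = D\<^sup>*\<close>; two such functionals are equal when they agree on \<open>D\<^sup>*\<close>. An element \<open>f\<close> of the Hilbert
  space is the functional \<open>L2_inner l f\<close>. The pairings in the other order are the conjugates, so
  \<open>(y, \<delta>) = y(l)\<close> and \<open>(y, \<delta>') = -y'(l)\<close> become the following.\<close>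

type_synonym functional = "(real \<Rightarrow> complex) \<Rightarrow> complex"

definition delta :: "real \<Rightarrow> functional" where
  "delta l v = cnj (v l)"

definition delta' :: "real \<Rightarrow> functional" where
  "delta' l v = - cnj (der l v l)"

fun state_op ::
  "(real \<Rightarrow> real) \<Rightarrow> real \<Rightarrow> boundary_param \<Rightarrow> complex \<Rightarrow> (real \<Rightarrow> complex) \<Rightarrow> functional" where
  "state_op q l (Finite \<mu>) h y v =
     L2_inner l (sl_expr q l y) v -
     1 / (complex_of_real \<mu> - h) * (der l y l - h * y l) *
       (complex_of_real \<mu> * delta l v + delta' l v)"
| "state_op q l Infinite h y v =
     L2_inner l (sl_expr q l y) v - (der l y l - h * y l) * delta l v"

fun channel_vec :: "real \<Rightarrow> boundary_param \<Rightarrow> complex \<Rightarrow> functional" where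
  "channel_vec l (Finite \<mu>) h v =
     complex_of_real (sqrt (Im h) / cmod (complex_of_real \<mu> - h)) *
       (complex_of_real \<mu> * delta l v + delta' l v)"
| "channel_vec l Infinite h v = complex_of_real (sqrt (Im h)) * delta l v"

definition channel_op :: "real \<Rightarrow> boundary_param \<Rightarrow> complex \<Rightarrow> complex \<Rightarrow> functional" where
  "channel_op l \<mu> h c = (\<lambda>v. c * channel_vec l \<mu> h v)"

text \<open>The adjoint of \<open>K\<close>, determined by \<open>(K c, f) = c * cnj (K\<^sup>* f)\<close>.\<close>

definition channel_adj :: "real \<Rightarrow> boundary_param \<Rightarrow> complex \<Rightarrow> (real \<Rightarrow> complex) \<Rightarrow> complex" where
  "channel_adj l \<mu> h f = cnj (channel_op l \<mu> h 1 f)"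

definition state_resolvent ::
  "(real \<Rightarrow> real) \<Rightarrow> real \<Rightarrow> boundary_param \<Rightarrow> complex \<Rightarrow> complex \<Rightarrow> functional \<Rightarrow> real \<Rightarrow> complex" where
  "state_resolvent q l \<mu> h z F =
     (THE f. f \<in> Dstar q l \<and>
             (\<forall>v\<in>Dstar q l. state_op q l \<mu> h f v - z * L2_inner l f v = F v))"

definition transfer_function ::
  "(real \<Rightarrow> real) \<Rightarrow> real \<Rightarrow> boundary_param \<Rightarrow> complex \<Rightarrow> complex \<Rightarrow> complex" where
  "transfer_function q l \<mu> h z =
     1 - 2 * \<i> * channel_adj l \<mu> h (state_resolvent q l \<mu> h z (channel_op l \<mu> h 1))"

text \<open>The c-entropy is infinite if the transfer function vanishes at \<open>-\<i>\<close>; the case distinction is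
  needed because \<open>ln 0 = 0\<close>.\<close>

definition c_entropy :: "(real \<Rightarrow> real) \<Rightarrow> real \<Rightarrow> boundary_param \<Rightarrow> complex \<Rightarrow> ereal" where
  "c_entropy q l \<mu> h =
     (if transfer_function q l \<mu> h (-\<i>) = 0 then \<infinity>
      else ereal (- ln (cmod (transfer_function q l \<mu> h (-\<i>)))))"

definition accretive_state_op ::
  "(real \<Rightarrow> real) \<Rightarrow> real \<Rightarrow> boundary_param \<Rightarrow> complex \<Rightarrow> bool" where
  "accretive_state_op q l \<mu> h \<longleftrightarrow> (\<forall>f\<in>Dstar q l. Re (state_op q l \<mu> h f f) \<ge> 0)"

definition state_op_adj ::
  "(real \<Rightarrow> real) \<Rightarrow> real \<Rightarrow> boundary_param \<Rightarrow> complex \<Rightarrow> (real \<Rightarrow> complex) \<Rightarrow> functional" where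
  "state_op_adj q l \<mu> h y v = cnj (state_op q l \<mu> h v y)"

definition state_op_Re ::
  "(real \<Rightarrow> real) \<Rightarrow> real \<Rightarrow> boundary_param \<Rightarrow> complex \<Rightarrow> (real \<Rightarrow> complex) \<Rightarrow> functional" where
  "state_op_Re q l \<mu> h y v = (state_op q l \<mu> h y v + state_op_adj q l \<mu> h y v) / 2"

definition quasi_kernel ::
  "(real \<Rightarrow> real) \<Rightarrow> real \<Rightarrow> boundary_param \<Rightarrow> complex \<Rightarrow> op_graph" where
  "quasi_kernel q l \<mu> h =
     {(f, u). f \<in> Dstar q l \<and> u \<in> L2 l \<and>
              (\<forall>v\<in>Dstar q l. state_op_Re q l \<mu> h f v = L2_inner l u v)}"

definition accretive_L_system ::
  "(real \<Rightarrow> real) \<Rightarrow> real \<Rightarrow> boundary_param \<Rightarrow> complex \<Rightarrow> bool" where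
  "accretive_L_system q l \<mu> h \<longleftrightarrow>
     Im h > 0 \<and> accretive_op l (T_op q l h) \<and> accretive_state_op q l \<mu> h"

end

theory Submission
  imports Defs
begin

text \<open>Write \<open>y\<^sub>0\<close> and \<open>y\<^sub>1\<close> for the values of \<open>y\<close> and of its derivative at \<open>l\<close>. Everything rests on the
  Hermitian form \<open>t(f, g) = (l(f), g) - f\<^sub>1 cnj g\<^sub>0\<close> on \<open>D\<^sup>*\<close>, formally the integral of
  \<open>f' cnj g' + q f cnj g\<close>. For \<open>f\<close> in the domain of \<open>T\<^sub>h\<close> one has
  \<open>(T\<^sub>h f, f) = t(f, f) + h |f\<^sub>0|\<^sup>2\<close>, and the quadratic forms of the state space operators are \<open>t(f, f)\<close>
  plus an explicit expression in \<open>f\<^sub>0\<close> and \<open>f\<^sub>1\<close>.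

  \<^bold>\<open>The form is Hermitian.\<close> This is Green's formula without a boundary term at infinity. Deficiency index
  one says that some solution \<open>\<phi>\<close> for \<open>\<i>\<close> is not square integrable, while the Weyl solution \<open>\<psi>\<close> is.
  Expanding \<open>f \<in> D\<^sup>*\<close> in these two solutions shows that the Wronskian of \<open>f\<close> and \<open>\<psi>\<close> vanishes at infinity,
  and the bound \<open>4 \<integral>\<^sub>l\<^sup>x |\<phi>|\<^sup>2 \<integral>\<^sub>x\<^sup>\<infinity> |\<psi>|\<^sup>2 \<le> 1\<close> extends this to all pairs in \<open>D\<^sup>*\<close>
  (\<open>wronskian_tendsto_0\<close>, \<open>green_formula\<close>).

  \<^bold>\<open>Its sharp lower bound is \<open>m |f\<^sub>0|\<^sup>2\<close>.\<close> There are elements of \<open>D\<^sup>*\<close> with \<open>y\<^sub>0 = 0\<close>, \<open>y\<^sub>1 = 1\<close> and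
  arbitrarily small norm and form (\<open>small_bumps\<close>). So nonnegativity of the minimal operator passes to all
  \<open>f\<close> with \<open>f\<^sub>0 = 0\<close>. For real \<open>\<lambda> < 0\<close> the Weyl solution \<open>\<psi>\<^sub>\<lambda>\<close> is orthogonal to these \<open>f\<close> with respect to
  \<open>t - \<lambda>\<close>, and \<open>t(\<psi>\<^sub>\<lambda>, \<psi>\<^sub>\<lambda>) - \<lambda> \<parallel>\<psi>\<^sub>\<lambda>\<parallel>\<^sup>2 = m\<^sub>\<infinity>(\<lambda>)\<close>. Splitting off a multiple of \<open>\<psi>\<^sub>\<lambda>\<close> and letting \<open>\<lambda>\<close> tend to
  \<open>-0\<close> gives \<open>t(f, f) \<ge> m |f\<^sub>0|\<^sup>2\<close>; the constant is optimal even when \<open>f\<^sub>1\<close> is prescribed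
  (\<open>qform_lower_bound\<close>, \<open>qform_lower_bound_sharp\<close>).

  \<^bold>\<open>Consequences.\<close> \<open>T\<^sub>h\<close> is accretive iff \<open>Re h \<ge> -m\<close>, and extremal if \<open>Re h = -m\<close>. On that line no finite
  \<open>\<mu>\<close> gives an accretive state space operator, whereas \<open>\<mu> = \<infinity>\<close> does. The bound at \<open>\<psi>\<close> reads \<open>m \<le> A\<close>, and
  equality would make \<open>\<psi>\<close> a null vector and force the Weyl solutions for \<open>\<i>\<close> and \<open>-\<i>\<close> to agree, so \<open>m < A\<close>.

  \<^bold>\<open>Optimisation.\<close> Solving the resolvent equation by a multiple of the Weyl solution for \<open>-\<i>\<close> gives the
  transfer function there, and
  \<open>|W(-\<i>)|\<^sup>2 = ((A + x)\<^sup>2 + (B - y)\<^sup>2) / ((A + x)\<^sup>2 + (B + y)\<^sup>2)\<close> for \<open>h = x + \<i> y\<close>, independently of \<open>\<mu>\<close>. Over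
  \<open>x \<ge> -m\<close> and \<open>y > 0\<close> this has its unique minimum at \<open>x = -m\<close>, \<open>y = s\<close>, since \<open>A + x \<ge> A - m > 0\<close>; hence
  \<open>h = h0\<close> and then \<open>\<mu> = \<infinity>\<close>. For \<open>\<mu> = \<infinity>\<close> the real part of the state space operator is
  \<open>(l(f), v) - (f\<^sub>1 + m f\<^sub>0) cnj v\<^sub>0\<close>, and its quasi-kernel is \<open>A\<^sub>K\<close> because only zero is orthogonal to a
  suitable family of test functions in \<open>D\<^sup>*\<close> (\<open>orthogonal_imp_zero\<close>).\<close>

section \<open>Indefinite Lebesgue integrals\<close>

lemma absolutely_integrable_on_iff_integrable_lebesgue_on:
  fixes f :: "'a::euclidean_space \<Rightarrow> 'b::euclidean_space"
  assumes "S \<in> sets lebesgue"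
  shows "f absolutely_integrable_on S \<longleftrightarrow> integrable (lebesgue_on S) f"
  using assms by (simp add: set_integrable_def integrable_restrict_space)

lemma integrable_mult_prod:
  fixes F G :: "_ \<Rightarrow> complex"
  assumes "sigma_finite_measure M" "sigma_finite_measure N"
    and F: "integrable M F" and G: "integrable N G"
  shows "integrable (M \<Otimes>\<^sub>M N) (\<lambda>(x, y). F x * G y)"
proof -
  interpret pair_sigma_finite M N using assms by (simp add: pair_sigma_finite_def)
  have [measurable]: "F \<in> borel_measurable M" "G \<in> borel_measurable N"
    using F G by auto
  show ?thesis
  proof (rule Fubini_integrable)
    show "(\<lambda>(x, y). F x * G y) \<in> borel_measurable (M \<Otimes>\<^sub>M N)" by measurable
    show "integrable M (\<lambda>x. LINT y|N. norm (case (x, y) of (x, y) \<Rightarrow> F x * G y))"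
      using F by (simp add: norm_mult)
    show "AE x in M. integrable N (\<lambda>y. case (x, y) of (x, y) \<Rightarrow> F x * G y)"
      using G by simp
  qed
qed

lemma integral_lebesgue_on_subset:
  fixes f :: "real \<Rightarrow> complex"
  assumes "S \<subseteq> T" "S \<in> sets lebesgue" "T \<in> sets lebesgue"
  shows "(LINT x|lebesgue_on S. f x) = (LINT x|lebesgue_on T. indicator S x * f x)"
proof -
  have "(LINT x|lebesgue_on T. indicator S x * f x) = (LINT x|lebesgue. indicator T x *\<^sub>R (indicator S x * f x))"
    using assms by (simp add: integral_restrict_space)
  also have "\<dots> = (LINT x|lebesgue. indicator S x *\<^sub>R f x)"
    using assms(1) by (intro Bochner_Integration.integral_cong) (auto simp: indicator_def)
  finally show ?thesis
    using assms by (simp add: integral_restrict_space)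
qed

lemma integrable_lebesgue_on_subset:
  fixes f :: "real \<Rightarrow> 'b::euclidean_space"
  assumes "S \<subseteq> T" "S \<in> sets lebesgue" "T \<in> sets lebesgue" "integrable (lebesgue_on T) f"
  shows "integrable (lebesgue_on S) f"
  using set_integrable_subset[of lebesgue T f S] assms
  by (simp add: set_integrable_def integrable_restrict_space)


text \<open>Local absolute continuity with the density as an argument. Identities such as the product rule and
  Lagrange's identity become statements about densities, which are determined up to null sets only.\<close>

definition primitive :: "real \<Rightarrow> (real \<Rightarrow> complex) \<Rightarrow> (real \<Rightarrow> complex) \<Rightarrow> bool" where
  "primitive l F f \<longleftrightarrow>
     (\<forall>b\<ge>l. integrable (lebesgue_on {l..b}) F \<and> f b = f l + (LINT t|lebesgue_on {l..b}. F t))"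

lemma primitive_eq: "primitive l F f \<Longrightarrow> l \<le> x \<Longrightarrow> f x = f l + (LINT t|lebesgue_on {l..x}. F t)"
  unfolding primitive_def by blast

lemma locally_AC_iff_primitive: "locally_AC l f \<longleftrightarrow> (\<exists>F. primitive l F f)"
proof -
  have "integral {l..x} F = (LINT t|lebesgue_on {l..x}. F t)" if "integrable (lebesgue_on {l..x}) F" for F :: "real \<Rightarrow> complex" and x
    using that by (simp add: lebesgue_integral_eq_integral)
  then have "locally_summable l F \<and> (\<forall>x\<ge>l. f x = f l + integral {l..x} F) \<longleftrightarrow> primitive l F f" for F
    unfolding locally_summable_def primitive_def
    by (subst absolutely_integrable_on_iff_integrable_lebesgue_on) (simp, metis)
  then show ?thesis unfolding locally_AC_def by blast
qed

text \<open>By Fubini the product of the two integrals is an integral over a square. Its diagonal cuts the square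
  into two triangles, and integrating over each of them along the appropriate variable first gives the
  two terms.\<close>

lemma integral_prod_triangle:
  fixes F G :: "real \<Rightarrow> complex"
  assumes F: "integrable (lebesgue_on {l..b}) F" and G: "integrable (lebesgue_on {l..b}) G"
  shows "integrable (lebesgue_on {l..b}) (\<lambda>x. F x * (LINT t|lebesgue_on {l..x}. G t))"
    and "(LINT x|lebesgue_on {l..b}. F x) * (LINT t|lebesgue_on {l..b}. G t) =
      (LINT x|lebesgue_on {l..b}. F x * (LINT t|lebesgue_on {l..x}. G t)) +
      (LINT t|lebesgue_on {l..b}. (LINT x|lebesgue_on {l..t}. F x) * G t)"
proof -
  let ?M = "lebesgue_on {l..b}"
  interpret finite_measure ?M by (simp add: finite_measure_lebesgue_on)
  interpret pair_sigma_finite ?M ?M by unfold_locales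
  define L where "L = (\<lambda>(x, t). indicator {z. snd z \<le> fst z} (x, t) * (F x * G t))"
  define U where "U = (\<lambda>(x, t). indicator {z. fst z < snd z} (x, t) * (F x * G t))"
  have FG: "integrable (?M \<Otimes>\<^sub>M ?M) (\<lambda>(x, t). F x * G t)"
    by (intro integrable_mult_prod F G) unfold_locales
  have m [measurable]: "(\<lambda>x. x) \<in> borel_measurable ?M"
    using id_borel_measurable_lebesgue_on[of "{l..b}"] unfolding id_def .
  have "(\<lambda>z. fst z) \<in> borel_measurable (?M \<Otimes>\<^sub>M ?M)" "(\<lambda>z. snd z) \<in> borel_measurable (?M \<Otimes>\<^sub>M ?M)"
    using measurable_compose[OF measurable_fst m] measurable_compose[OF measurable_snd m] by auto
  then have s: "{z \<in> space (?M \<Otimes>\<^sub>M ?M). snd z \<le> fst z} \<in> sets (?M \<Otimes>\<^sub>M ?M)"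
    "{z \<in> space (?M \<Otimes>\<^sub>M ?M). fst z < snd z} \<in> sets (?M \<Otimes>\<^sub>M ?M)"
    by measurable
  have L: "integrable (?M \<Otimes>\<^sub>M ?M) (case_prod (\<lambda>x t. L (x, t)))"
    using integrable_mult_indicator[OF s(1) FG]
    by (rule Bochner_Integration.integrable_cong[THEN iffD1, rotated -1])
      (auto simp: L_def indicator_def)
  have U: "integrable (?M \<Otimes>\<^sub>M ?M) (case_prod (\<lambda>x t. U (x, t)))"
    using integrable_mult_indicator[OF s(2) FG]
    by (rule Bochner_Integration.integrable_cong[THEN iffD1, rotated -1])
      (auto simp: U_def indicator_def)
  have inner_L: "(LINT t|?M. L (x, t)) = F x * (LINT t|lebesgue_on {l..x}. G t)" if "x \<in> {l..b}" for x
  proof -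
    have "(LINT t|?M. L (x, t)) = (LINT t|?M. F x * (indicator {l..x} t * G t))"
      by (intro Bochner_Integration.integral_cong) (auto simp: L_def indicator_def)
    then show ?thesis
      using that by (simp add: integral_lebesgue_on_subset[of "{l..x}" "{l..b}"])
  qed
  have inner_U: "(LINT x|?M. U (x, t)) = (LINT x|lebesgue_on {l..t}. F x) * G t" if "t \<in> {l..b}" for t
  proof -
    have "(LINT x|?M. U (x, t)) = (LINT x|?M. (indicator {l..<t} x * F x) * G t)"
      by (intro Bochner_Integration.integral_cong) (auto simp: U_def indicator_def)
    also have "\<dots> = (LINT x|?M. (indicator {l..t} x * F x) * G t)"
    proof (rule integral_cong_AE)
      have "AE x in ?M. x \<noteq> t"
        using AE_completion[OF AE_lborel_singleton[of t]]
        by (auto simp: AE_restrict_space_iff elim: eventually_mono)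
      then show "AE x in ?M. indicator {l..<t} x * F x * G t = indicator {l..t} x * F x * G t"
        by eventually_elim (auto simp: indicator_def)
    qed (use F in \<open>auto intro!: borel_measurable_times borel_measurable_indicator'\<close>)
    finally show ?thesis
      using that by (simp add: integral_lebesgue_on_subset[of "{l..t}" "{l..b}"])
  qed
  show "integrable ?M (\<lambda>x. F x * (LINT t|lebesgue_on {l..x}. G t))"
    using integrable_fst[OF L]
    by (rule Bochner_Integration.integrable_cong[THEN iffD1, rotated -1]) (auto simp: inner_L)
  have "(LINT x|?M. F x) * (LINT t|?M. G t) = (LINT x|?M. LINT t|?M. F x * G t)"
    by simp
  also have "\<dots> = integral\<^sup>L (?M \<Otimes>\<^sub>M ?M) (\<lambda>(x, t). F x * G t)"
    using integral_fst[OF FG] by simp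
  also have "\<dots> = integral\<^sup>L (?M \<Otimes>\<^sub>M ?M) (\<lambda>z. L z + U z)"
    by (intro Bochner_Integration.integral_cong) (auto simp: L_def U_def indicator_def)
  also have "\<dots> = integral\<^sup>L (?M \<Otimes>\<^sub>M ?M) L + integral\<^sup>L (?M \<Otimes>\<^sub>M ?M) U"
    using L U by (intro Bochner_Integration.integral_add) auto
  also have "integral\<^sup>L (?M \<Otimes>\<^sub>M ?M) L = (LINT x|?M. LINT t|?M. L (x, t))"
    using integral_fst[OF L] by simp
  also have "\<dots> = (LINT x|?M. F x * (LINT t|lebesgue_on {l..x}. G t))"
    by (intro Bochner_Integration.integral_cong) (auto simp: inner_L)
  also have "integral\<^sup>L (?M \<Otimes>\<^sub>M ?M) U = (LINT t|?M. LINT x|?M. U (x, t))"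
    using integral_snd[OF U] by simp
  also have "\<dots> = (LINT t|?M. (LINT x|lebesgue_on {l..t}. F x) * G t)"
    by (intro Bochner_Integration.integral_cong) (auto simp: inner_U)
  finally show "(LINT x|?M. F x) * (LINT t|?M. G t) =
      (LINT x|?M. F x * (LINT t|lebesgue_on {l..x}. G t)) +
      (LINT t|?M. (LINT x|lebesgue_on {l..t}. F x) * G t)" .
qed

text \<open>The product rule for absolutely continuous functions. Each factor is a constant plus an indefinite
  integral, and only the product of the two integrals needs an argument.\<close>

lemma primitive_mult:
  assumes f: "primitive l F f" and g: "primitive l G g"
  shows "primitive l (\<lambda>x. F x * g x + f x * G x) (\<lambda>x. f x * g x)"
  unfolding primitive_def
proof (intro allI impI conjI)
  fix b assume b: "l \<le> b"
  let ?M = "lebesgue_on {l..b}"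
  have F: "integrable ?M F" and G: "integrable ?M G"
    using f g b unfolding primitive_def by blast+
  have fx: "f x = f l + (LINT t|lebesgue_on {l..x}. F t)" and gx: "g x = g l + (LINT t|lebesgue_on {l..x}. G t)"
    if "l \<le> x" for x using f g that unfolding primitive_def by blast+
  have Fg: "integrable ?M (\<lambda>x. F x * (LINT t|lebesgue_on {l..x}. G t))"
    by (rule integral_prod_triangle(1)[OF F G])
  have fG: "integrable ?M (\<lambda>x. (LINT t|lebesgue_on {l..x}. F t) * G x)"
    using integral_prod_triangle(1)[OF G F] by (simp add: mult.commute)
  have eq: "F x * g x + f x * G x = (F x * g l + f l * G x) +
      (F x * (LINT t|lebesgue_on {l..x}. G t) + (LINT t|lebesgue_on {l..x}. F t) * G x)"
    if "x \<in> {l..b}" for x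
  proof -
    have "l \<le> x" using that by simp
    from fx[OF this] gx[OF this] show ?thesis by (simp add: algebra_simps)
  qed
  have i1: "integrable ?M (\<lambda>x. F x * g l + f l * G x)"
    using F G by simp
  have i2: "integrable ?M (\<lambda>x. F x * (LINT t|lebesgue_on {l..x}. G t) + (LINT t|lebesgue_on {l..x}. F t) * G x)"
    using Fg fG by simp
  show "integrable ?M (\<lambda>x. F x * g x + f x * G x)"
    using Bochner_Integration.integrable_add[OF i1 i2]
    by (rule Bochner_Integration.integrable_cong[THEN iffD1, rotated -1]) (simp_all add: eq)
  have "(LINT x|?M. F x * g x + f x * G x) = (LINT x|?M. (F x * g l + f l * G x) +
      (F x * (LINT t|lebesgue_on {l..x}. G t) + (LINT t|lebesgue_on {l..x}. F t) * G x))"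
    by (intro Bochner_Integration.integral_cong) (simp_all add: eq)
  also have "\<dots> = (LINT x|?M. F x) * g l + f l * (LINT x|?M. G x) + (LINT x|?M. F x) * (LINT x|?M. G x)"
    using F G Fg fG by (simp add: integral_prod_triangle(2)[OF F G])
  finally have i: "(LINT x|?M. F x * g x + f x * G x) = (LINT x|?M. F x) * g l + f l * (LINT x|?M. G x)
      + (LINT x|?M. F x) * (LINT x|?M. G x)" .
  show "f b * g b = f l * g l + (LINT x|?M. F x * g x + f x * G x)"
  proof -
    have "(p + X) * (r + Y) = p * r + (X * r + p * Y + X * Y)" for p r X Y :: complex
      by (simp add: algebra_simps)
    then show ?thesis
      unfolding i by (subst fx[OF b], subst gx[OF b])
  qed
qed

lemma primitive_diff:
  assumes f: "primitive l F f" and "l \<le> x" "x \<le> y"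
  shows "integrable (lebesgue_on {x..y}) F" and "f y - f x = (LINT t|lebesgue_on {x..y}. F t)"
proof -
  have i: "integrable (lebesgue_on {l..y}) F" and y: "f y = f l + (LINT t|lebesgue_on {l..y}. F t)"
    and x: "f x = f l + (LINT t|lebesgue_on {l..x}. F t)"
    using assms unfolding primitive_def by (blast intro: order_trans)+
  show "integrable (lebesgue_on {x..y}) F"
    using i assms by (auto intro: integrable_lebesgue_on_subset[of "{x..y}" "{l..y}"])
  show "f y - f x = (LINT t|lebesgue_on {x..y}. F t)"
    unfolding x y using integral_combine[OF i \<open>l \<le> x\<close> \<open>x \<le> y\<close>] by simp
qed

text \<open>Lebesgue measure is complete, so measurability is insensitive to null sets; this matters because
  second derivatives are known almost everywhere only.\<close>

lemma borel_measurable_lebesgue_on_cong_AE: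
  fixes f g :: "real \<Rightarrow> complex"
  assumes S: "S \<in> sets lebesgue" and f: "f \<in> borel_measurable (lebesgue_on S)"
    and ae: "AE x in lebesgue_on S. f x = g x"
  shows "g \<in> borel_measurable (lebesgue_on S)"
proof -
  have "(\<lambda>x. indicator S x *\<^sub>R f x) \<in> borel_measurable lebesgue"
    using f S by (simp add: borel_measurable_restrict_space_iff)
  moreover have "AE x in lebesgue. indicator S x *\<^sub>R f x = indicator S x *\<^sub>R g x"
    using ae S by (auto simp: AE_restrict_space_iff elim!: eventually_mono)
  ultimately have "(\<lambda>x. indicator S x *\<^sub>R g x) \<in> borel_measurable lebesgue"
    by (rule borel_measurable_AE)
  then show ?thesis
    using S by (simp add: borel_measurable_restrict_space_iff)
qed

lemma AE_lebesgue_on_subset: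
  assumes "S \<subseteq> T" "S \<in> sets lebesgue" "T \<in> sets lebesgue" "AE x in lebesgue_on T. P x"
  shows "AE x in lebesgue_on S. P x"
  using assms by (auto simp: AE_restrict_space_iff elim!: eventually_mono)

lemma primitive_cong_AE:
  assumes f: "primitive l F f" and ae: "AE x in lebesgue_on {l..}. F x = G x"
  shows "primitive l G f"
  unfolding primitive_def
proof (intro allI impI)
  fix b assume b: "l \<le> b"
  have F: "integrable (lebesgue_on {l..b}) F" and fb: "f b = f l + (LINT t|lebesgue_on {l..b}. F t)"
    using f b unfolding primitive_def by blast+
  have ae': "AE x in lebesgue_on {l..b}. F x = G x"
    using AE_lebesgue_on_subset[OF _ _ _ ae, of "{l..b}"] by auto
  have G: "G \<in> borel_measurable (lebesgue_on {l..b})"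
    using F ae' by (intro borel_measurable_lebesgue_on_cong_AE[OF _ _ ae']) auto
  show "integrable (lebesgue_on {l..b}) G \<and> f b = f l + (LINT t|lebesgue_on {l..b}. G t)"
    using integrable_cong_AE_imp[OF F G ae'] integral_cong_AE[OF _ G ae'] F fb by auto
qed

lemma primitive_cong:
  assumes f: "primitive l F f" and eq: "\<And>x. l \<le> x \<Longrightarrow> f x = g x"
  shows "primitive l F g"
  unfolding primitive_def
proof (intro allI impI)
  fix b assume b: "l \<le> b"
  then have "integrable (lebesgue_on {l..b}) F \<and> f b = f l + (LINT t|lebesgue_on {l..b}. F t)"
    using f unfolding primitive_def by blast
  then show "integrable (lebesgue_on {l..b}) F \<and> g b = g l + (LINT t|lebesgue_on {l..b}. F t)"
    unfolding eq[OF b] eq[OF order_refl] .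
qed

lemma primitive_of_continuous_derivative:
  assumes d: "\<And>x. l \<le> x \<Longrightarrow> (f has_vector_derivative F x) (at x within {l..})"
    and c: "continuous_on {l..} F"
  shows "primitive l F f"
  unfolding primitive_def
proof (intro allI impI conjI)
  fix b assume b: "l \<le> b"
  show i: "integrable (lebesgue_on {l..b}) F"
    by (intro continuous_imp_integrable_real continuous_on_subset[OF c]) auto
  have "(F has_integral (f b - f l)) {l..b}"
    by (intro fundamental_theorem_of_calculus b has_vector_derivative_within_subset[OF d]) auto
  then have "f b - f l = integral {l..b} F" by (simp add: integral_unique)
  then show "f b = f l + (LINT t|lebesgue_on {l..b}. F t)"
    using i by (simp add: lebesgue_integral_eq_integral algebra_simps)
qed

lemma primitive_continuous_on:
  assumes f: "primitive l F f"
  shows "continuous_on {l..} f"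
proof -
  have "continuous_on {l..b} f" if b: "l \<le> b" for b
  proof -
    have i: "integrable (lebesgue_on {l..b}) F" using f b unfolding primitive_def by blast
    then have "continuous_on {l..b} (\<lambda>x. f l + integral {l..x} F)"
      by (intro continuous_intros indefinite_integral_continuous_1 integrable_on_lebesgue_on) auto
    moreover have "f l + integral {l..x} F = f x" if "x \<in> {l..b}" for x
      using primitive_diff[OF f, of l x] that by (simp add: lebesgue_integral_eq_integral algebra_simps)
    ultimately show ?thesis
      by (rule continuous_on_eq)
  qed
  note cont = this
  show ?thesis
    unfolding continuous_on_eq_continuous_within
  proof
    fix x assume x: "x \<in> {l..}"
    have "continuous (at x within {l..x+1}) f"
      using cont[of "x+1"] x by (simp add: continuous_on_eq_continuous_within)
    moreover have "at x within {l..x+1} = at x within {l..}"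
      using x by (intro at_within_nhd[of x "{..<x+1}"]) auto
    ultimately show "continuous (at x within {l..}) f" by simp
  qed
qed

text \<open>Lebesgue's differentiation theorem on a half-line. The right difference quotients converge almost
  everywhere; the left ones are right difference quotients of the reflected function.\<close>

lemma primitive_has_vector_derivative_AE:
  assumes f: "primitive l F f"
  shows "AE x in lebesgue_on {l..}. (f has_vector_derivative F x) (at x within {l..})"
proof -
  \<comment> \<open>\<open>F\<close> is arbitrary to the left of \<open>l\<close>, whereas the differentiation theorem asks for a function on the line.\<close>
  define E where "E x = (if l \<le> x then F x else 0)" for x
  have E: "E integrable_on {a..b}" for a b
  proof -
    have "integrable (lebesgue_on {l..max l b}) F"
      using f unfolding primitive_def by (meson max.cobounded1)
    then have "F integrable_on {l..max l b}" by (simp add: integrable_on_lebesgue_on)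
    then have "(\<lambda>x. if x \<in> {l..max l b} then F x else 0) integrable_on {min a l..max l b}"
      unfolding integrable_restrict_Int by (simp add: max_absorb2)
    then have "E integrable_on {min a l..max l b}"
      by (rule integrable_eq) (auto simp: E_def)
    then show ?thesis
      by (rule integrable_on_subinterval) auto
  qed
  have seg: "integral {x..y} E = f y - f x" if "l \<le> x" "x \<le> y" for x y
  proof -
    have "integral {x..y} E = integral {x..y} F"
      by (rule Henstock_Kurzweil_Integration.integral_cong) (use that in \<open>auto simp: E_def\<close>)
    also have "\<dots> = f y - f x"
      using primitive_diff[OF f that] by (simp add: lebesgue_integral_eq_integral)
    finally show ?thesis .
  qed
  obtain N where N: "negligible N"
    "\<And>x e. \<lbrakk>x \<notin> N; 0 < e\<rbrakk> \<Longrightarrow> \<exists>d>0. \<forall>h. 0 < h \<and> h < d \<longrightarrow> norm (integral {x..x+h} E /\<^sub>R h - E x) < e"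
    using integrable_ccontinuous_explicit[of E] E by auto
  have "(\<lambda>x. E (- x)) integrable_on {a..b}" for a b
    using E[of "-b" "-a"] Henstock_Kurzweil_Integration.integrable_reflect_real[of E "-a" "-b"] by simp
  then obtain N' where N': "negligible N'"
    "\<And>x e. \<lbrakk>x \<notin> N'; 0 < e\<rbrakk> \<Longrightarrow> \<exists>d>0. \<forall>h. 0 < h \<and> h < d \<longrightarrow>
        norm (integral {x..x+h} (\<lambda>x. E (-x)) /\<^sub>R h - E (-x)) < e"
    using integrable_ccontinuous_explicit[of "\<lambda>x. E (- x)"] by auto
  have left: "integral {- x.. - x + h} (\<lambda>x. E (- x)) = integral {x - h..x} E" for x h
    using Henstock_Kurzweil_Integration.integral_reflect_real[of x "x - h" E] by simp
  have "negligible (uminus ` N')"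
    by (rule negligible_differentiable_image_negligible[OF _ N'(1)]) (auto simp: differentiable_on_def)
  then have neg: "negligible (N \<union> uminus ` N' \<union> {l})" using N(1) by auto
  have der: "(f has_vector_derivative F x) (at x within {l..})"
    if x: "l \<le> x" "x \<notin> N \<union> uminus ` N' \<union> {l}" for x
    unfolding has_vector_derivative_def has_derivative_within_alt
  proof (intro conjI allI impI)
    show "bounded_linear (\<lambda>h. h *\<^sub>R F x)" by (rule bounded_linear_scaleR_left)
    fix e :: real assume e: "0 < e"
    have lx: "l < x" and Ex: "E x = F x" and nx: "x \<notin> N" "- x \<notin> N'"
      using x by (force simp: E_def)+
    obtain d where d: "d > 0" "\<And>h. 0 < h \<Longrightarrow> h < d \<Longrightarrow> norm (integral {x..x+h} E /\<^sub>R h - F x) < e"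
      using N(2)[OF nx(1) e] Ex by auto
    obtain d' where d': "d' > 0" "\<And>h. 0 < h \<Longrightarrow> h < d' \<Longrightarrow> norm (integral {x-h..x} E /\<^sub>R h - F x) < e"
      using N'(2)[OF nx(2) e] unfolding left minus_minus Ex by blast
    show "\<exists>d>0. \<forall>y\<in>{l..}. norm (y - x) < d \<longrightarrow> norm (f y - f x - (y - x) *\<^sub>R F x) \<le> e * norm (y - x)"
    proof (intro exI[of _ "min d d'"] conjI ballI impI)
      show "0 < min d d'" using d d' by simp
      fix y assume y: "y \<in> {l..}" "norm (y - x) < min d d'"
      consider "y = x" | "y > x" | "y < x" by linarith
      then show "norm (f y - f x - (y - x) *\<^sub>R F x) \<le> e * norm (y - x)"
      proof cases
        case 2
        then have "f y - f x - (y - x) *\<^sub>R F x = (y - x) *\<^sub>R (integral {x..x+(y-x)} E /\<^sub>R (y - x) - F x)"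
          using seg[of x y] lx by (simp add: scaleR_diff_right)
        then show ?thesis using d(2)[of "y - x"] 2 y
          by (simp add: mult.commute[of e])
      next
        case 3
        then have "f y - f x - (y - x) *\<^sub>R F x = (y - x) *\<^sub>R (integral {x-(x-y)..x} E /\<^sub>R (x - y) - F x)"
        proof -
          have "(y - x) * inverse (x - y) = - 1" using 3 by (simp add: field_simps)
          then show ?thesis
            using seg[of y x] y 3 by (simp add: scaleR_diff_right)
        qed
        then show ?thesis using d'(2)[of "x - y"] 3 y
          by (simp add: mult.commute[of e])
      qed simp
    qed
  qed
  show ?thesis
    using neg by (auto simp: AE_restrict_space_iff negligible_iff_null_sets der
        intro!: AE_I'[of "N \<union> uminus ` N' \<union> {l}"])
qed


section \<open>Functions with absolutely continuous derivative\<close>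

lemma at_within_Ici_nontrivial:
  fixes x l :: real
  assumes "l \<le> x"
  shows "at x within {l..} \<noteq> bot"
proof -
  have "at_right x \<le> at x within {l..}" by (rule at_le) (use assms in auto)
  then show ?thesis using trivial_limit_at_right_real[of x] by (auto simp: bot_unique)
qed

lemma der_eqI:
  assumes "(f has_vector_derivative d) (at x within {l..})" "l \<le> x"
  shows "der l f x = d"
  unfolding der_def by (rule vector_derivative_within[OF at_within_Ici_nontrivial]) (use assms in auto)

lemma der_eq_AE:
  assumes "primitive l F f"
  shows "AE x in lebesgue_on {l..}. der l f x = F x"
proof -
  have "AE x in lebesgue_on {l..}. x \<in> {l..}"
    by (rule AE_I2) simp
  with primitive_has_vector_derivative_AE[OF assms] show ?thesis
    by eventually_elim (auto intro: der_eqI)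
qed

lemma AC_with_derivative_has_vector_derivative:
  assumes "AC_with_derivative l y" "l \<le> x"
  shows "(y has_vector_derivative der l y x) (at x within {l..})"
  using assms vector_derivative_works unfolding AC_with_derivative_def der_def by blast

lemma primitive_der_der:
  assumes "AC_with_derivative l y"
  shows "primitive l (der l (der l y)) (der l y)"
proof -
  obtain F where F: "primitive l F (der l y)"
    using assms by (auto simp: AC_with_derivative_def locally_AC_iff_primitive)
  have "AE x in lebesgue_on {l..}. F x = der l (der l y) x"
    using der_eq_AE[OF F] by eventually_elim simp
  then show ?thesis by (rule primitive_cong_AE[OF F])
qed

lemma primitive_der_sl_expr:
  assumes "AC_with_derivative l y"
  shows "primitive l (\<lambda>x. q x * y x - sl_expr q l y x) (der l y)"
  using primitive_der_der[OF assms] by (simp add: sl_expr_def)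

lemma primitive_der:
  assumes "AC_with_derivative l y"
  shows "primitive l (der l y) y"
  using AC_with_derivative_has_vector_derivative[OF assms]
    primitive_continuous_on[OF primitive_der_der[OF assms]]
  by (rule primitive_of_continuous_derivative)

text \<open>The derivative is given pointwise but the second derivative only through a density, so its
  Sturm-Liouville expression is identified almost everywhere.\<close>

lemma AC_with_derivativeI:
  assumes y: "\<forall>x\<ge>l. (y has_vector_derivative d x) (at x within {l..})"
    and d: "primitive l D d"
  shows "AC_with_derivative l y" and "\<And>x. l \<le> x \<Longrightarrow> der l y x = d x"
    and "AE x in lebesgue_on {l..}. sl_expr q l y x = - D x + q x * y x"
proof -
  show eq: "der l y x = d x" if "l \<le> x" for x
    using der_eqI y that by blast
  have "primitive l d y"
    using y primitive_continuous_on[OF d] by (blast intro: primitive_of_continuous_derivative)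
  moreover have d': "primitive l D (der l y)"
    by (rule primitive_cong[OF d]) (simp add: eq)
  moreover have "y differentiable (at x within {l..})" if "l \<le> x" for x
    using y that by (blast intro: differentiableI_vector)
  ultimately show "AC_with_derivative l y"
    unfolding AC_with_derivative_def locally_AC_iff_primitive by blast
  show "AE x in lebesgue_on {l..}. sl_expr q l y x = - D x + q x * y x"
    using der_eq_AE[OF d'] by eventually_elim (simp add: sl_expr_def)
qed



lemma primitive_add:
  assumes "primitive l F f" "primitive l G g"
  shows "primitive l (\<lambda>x. F x + G x) (\<lambda>x. f x + g x)"
  unfolding primitive_def
proof (intro allI impI conjI)
  fix b assume b: "l \<le> b"
  have F: "integrable (lebesgue_on {l..b}) F" "f b = f l + (LINT t|lebesgue_on {l..b}. F t)"
   and G: "integrable (lebesgue_on {l..b}) G" "g b = g l + (LINT t|lebesgue_on {l..b}. G t)"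
    using assms b unfolding primitive_def by blast+
  show "integrable (lebesgue_on {l..b}) (\<lambda>x. F x + G x)" using F G by simp
  show "f b + g b = f l + g l + (LINT t|lebesgue_on {l..b}. F t + G t)"
    unfolding Bochner_Integration.integral_add[OF F(1) G(1)]
    by (subst F(2), subst G(2)) (simp only: ac_simps)
qed

lemma primitive_const: "primitive l (\<lambda>x. 0) (\<lambda>x. c)"
  unfolding primitive_def by simp

lemma primitive_cmult: "primitive l F f \<Longrightarrow> primitive l (\<lambda>x. c * F x) (\<lambda>x. c * f x)"
  using primitive_mult[OF primitive_const, of l F f c] by simp

lemma primitive_minus: "primitive l F f \<Longrightarrow> primitive l (\<lambda>x. - F x) (\<lambda>x. - f x)"
  using primitive_cmult[of l F f "-1"] by simp

lemma primitive_cnj: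
  assumes "primitive l F f"
  shows "primitive l (\<lambda>x. cnj (F x)) (\<lambda>x. cnj (f x))"
  unfolding primitive_def
proof (intro allI impI conjI)
  fix b assume b: "l \<le> b"
  have F: "integrable (lebesgue_on {l..b}) F" "f b = f l + (LINT t|lebesgue_on {l..b}. F t)"
    using assms b unfolding primitive_def by blast+
  show "integrable (lebesgue_on {l..b}) (\<lambda>x. cnj (F x))" using F by simp
  show "cnj (f b) = cnj (f l) + (LINT t|lebesgue_on {l..b}. cnj (F t))"
    using arg_cong[OF F(2), of cnj] unfolding Bochner_Integration.integral_cnj complex_cnj_add .
qed

definition wronskian :: "real \<Rightarrow> (real \<Rightarrow> complex) \<Rightarrow> (real \<Rightarrow> complex) \<Rightarrow> real \<Rightarrow> complex" where
  "wronskian l f g x = f x * der l g x - der l f x * g x"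

text \<open>In the product rule for \<open>f g' - f' g\<close> the terms \<open>f' g'\<close> and \<open>q f g\<close> cancel.\<close>

lemma lagrange_identity:
  assumes f: "AC_with_derivative l f" and g: "AC_with_derivative l g"
  shows "primitive l (\<lambda>x. sl_expr q l f x * g x - f x * sl_expr q l g x) (wronskian l f g)"
proof -
  have 1: "primitive l (\<lambda>x. der l f x * der l g x + f x * (q x * g x - sl_expr q l g x)) (\<lambda>x. f x * der l g x)"
    by (intro primitive_mult primitive_der primitive_der_sl_expr f g)
  have 2: "primitive l (\<lambda>x. (q x * f x - sl_expr q l f x) * g x + der l f x * der l g x) (\<lambda>x. der l f x * g x)"
    by (intro primitive_mult primitive_der primitive_der_sl_expr f g)
  show ?thesis
    using primitive_add[OF 1 primitive_minus[OF 2]] by (simp add: wronskian_def[abs_def] algebra_simps)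
qed

section \<open>Square integrable functions\<close>

lemma integrable_mult_of_square_integrable:
  fixes f g :: "'a \<Rightarrow> complex"
  assumes [measurable]: "f \<in> borel_measurable M" "g \<in> borel_measurable M"
    and f: "integrable M (\<lambda>x. (cmod (f x))\<^sup>2)" and g: "integrable M (\<lambda>x. (cmod (g x))\<^sup>2)"
  shows "integrable M (\<lambda>x. f x * g x)"
proof (rule Bochner_Integration.integrable_bound)
  show "integrable M (\<lambda>x. (cmod (f x))\<^sup>2 + (cmod (g x))\<^sup>2)" using f g by simp
  have "cmod (f x) * cmod (g x) \<le> (cmod (f x))\<^sup>2 + (cmod (g x))\<^sup>2" for x
  proof -
    have "0 \<le> cmod (f x) * cmod (g x)" by simp
    then show ?thesis
      using sum_squares_bound[of "cmod (f x)" "cmod (g x)"] unfolding mult.assoc by linarith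
  qed
  then show "AE x in M. norm (f x * g x) \<le> norm ((cmod (f x))\<^sup>2 + (cmod (g x))\<^sup>2)"
    by (simp add: norm_mult)
qed simp

text \<open>The quadratic polynomial \<open>t \<mapsto> \<integral> (|f| - t |g|)\<^sup>2\<close> is nonnegative; the inequality comes from its value at
  its minimum.\<close>

lemma Cauchy_Schwarz_lebesgue_integral:
  fixes f g :: "'a \<Rightarrow> complex"
  assumes [measurable]: "f \<in> borel_measurable M" "g \<in> borel_measurable M"
    and f: "integrable M (\<lambda>x. (cmod (f x))\<^sup>2)" and g: "integrable M (\<lambda>x. (cmod (g x))\<^sup>2)"
  shows "(cmod (LINT x|M. f x * g x))\<^sup>2 \<le> (LINT x|M. (cmod (f x))\<^sup>2) * (LINT x|M. (cmod (g x))\<^sup>2)"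
proof -
  define a b c where "a = (LINT x|M. (cmod (f x))\<^sup>2)" and "b = (LINT x|M. (cmod (g x))\<^sup>2)"
    and "c = (LINT x|M. cmod (f x) * cmod (g x))"
  have fg: "integrable M (\<lambda>x. cmod (f x) * cmod (g x))"
    using integrable_norm[OF integrable_mult_of_square_integrable[OF assms]] by (simp add: norm_mult)
  have pos: "0 \<le> a - 2 * t * c + t\<^sup>2 * b" for t
  proof -
    have "0 \<le> (LINT x|M. (cmod (f x) - t * cmod (g x))\<^sup>2)" by simp
    also have "\<dots> = (LINT x|M. (cmod (f x))\<^sup>2 - 2 * t * (cmod (f x) * cmod (g x)) + t\<^sup>2 * (cmod (g x))\<^sup>2)"
      by (simp add: power2_diff power_mult_distrib algebra_simps)
    also have "\<dots> = a - 2 * t * c + t\<^sup>2 * b"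
      using f g fg by (simp add: a_def b_def c_def)
    finally show ?thesis .
  qed
  have "c\<^sup>2 \<le> a * b"
  proof (cases "b = 0")
    case True
    have "c = 0"
    proof (rule ccontr)
      assume "c \<noteq> 0"
      then show False using pos[of "(a + 1) / (2 * c)"] True by simp
    qed
    then show ?thesis using True by simp
  next
    case False
    moreover have "0 \<le> b" by (simp add: b_def)
    ultimately have "b > 0" by simp
    then have "0 \<le> (a - 2 * (c / b) * c + (c / b)\<^sup>2 * b) * b"
      using pos[of "c / b"] by simp
    also have "\<dots> = a * b - c\<^sup>2" using \<open>b > 0\<close> by (simp add: field_simps power2_eq_square)
    finally show ?thesis by simp
  qed
  moreover have "cmod (LINT x|M. f x * g x) \<le> c"
    using integral_norm_bound[of M "\<lambda>x. f x * g x"] by (simp add: c_def norm_mult)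
  then have "(cmod (LINT x|M. f x * g x))\<^sup>2 \<le> c\<^sup>2" by (intro power_mono) auto
  ultimately show ?thesis by (simp add: a_def b_def)
qed

definition L2_sq :: "real \<Rightarrow> (real \<Rightarrow> complex) \<Rightarrow> real" where
  "L2_sq l f = (LINT x|lebesgue_on {l..}. (cmod (f x))\<^sup>2)"

lemma L2_integrable_mult:
  assumes "f \<in> L2 l" "g \<in> L2 l"
  shows "integrable (lebesgue_on {l..}) (\<lambda>x. f x * g x)"
  using assms by (intro integrable_mult_of_square_integrable) (auto simp: L2_def)

lemma L2_cnj: "f \<in> L2 l \<Longrightarrow> (\<lambda>x. cnj (f x)) \<in> L2 l"
  by (auto simp: L2_def intro!: borel_measurable_continuous_on[of cnj] continuous_intros)

lemma L2_integrable_mult_cnj: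
  assumes "f \<in> L2 l" "g \<in> L2 l"
  shows "integrable (lebesgue_on {l..}) (\<lambda>x. f x * cnj (g x))"
  using L2_integrable_mult[OF assms(1) L2_cnj[OF assms(2)]] .

lemma L2_lincomb:
  assumes f: "f \<in> L2 l" and g: "g \<in> L2 l"
  shows "(\<lambda>x. a * f x + b * g x) \<in> L2 l"
proof -
  let ?M = "lebesgue_on {l..}"
  have m [measurable]: "f \<in> borel_measurable ?M" "g \<in> borel_measurable ?M"
    using f g by (auto simp: L2_def)
  have "integrable ?M (\<lambda>x. (cmod (a * f x + b * g x))\<^sup>2)"
  proof (rule Bochner_Integration.integrable_bound)
    show "integrable ?M (\<lambda>x. 2 * (cmod a)\<^sup>2 * (cmod (f x))\<^sup>2 + 2 * (cmod b)\<^sup>2 * (cmod (g x))\<^sup>2)"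
      using f g by (auto simp: L2_def)
    have "(cmod (a * f x + b * g x))\<^sup>2 \<le> 2 * (cmod a)\<^sup>2 * (cmod (f x))\<^sup>2 + 2 * (cmod b)\<^sup>2 * (cmod (g x))\<^sup>2" for x
    proof -
      have "(cmod (a * f x + b * g x))\<^sup>2 \<le> (cmod a * cmod (f x) + cmod b * cmod (g x))\<^sup>2"
        by (intro power_mono) (metis norm_triangle_ineq norm_mult, simp)
      also have "\<dots> \<le> 2 * (cmod a * cmod (f x))\<^sup>2 + 2 * (cmod b * cmod (g x))\<^sup>2"
        using sum_squares_bound[of "cmod a * cmod (f x)" "cmod b * cmod (g x)"] by (simp add: power2_sum)
      finally show ?thesis by (simp add: power_mult_distrib)
    qed
    then show "AE x in ?M. norm ((cmod (a * f x + b * g x))\<^sup>2)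
        \<le> norm (2 * (cmod a)\<^sup>2 * (cmod (f x))\<^sup>2 + 2 * (cmod b)\<^sup>2 * (cmod (g x))\<^sup>2)"
      by simp
  qed simp
  then show ?thesis by (simp add: L2_def)
qed

lemma L2_cmult: "f \<in> L2 l \<Longrightarrow> (\<lambda>x. a * f x) \<in> L2 l"
  using L2_lincomb[of f l f a 0] by simp

lemma L2_diff: "f \<in> L2 l \<Longrightarrow> g \<in> L2 l \<Longrightarrow> (\<lambda>x. f x - g x) \<in> L2 l"
  using L2_lincomb[of f l g 1 "-1"] by simp

lemma L2_cong_AE:
  assumes f: "f \<in> L2 l" and ae: "AE x in lebesgue_on {l..}. f x = g x"
  shows "g \<in> L2 l"
proof -
  have g: "g \<in> borel_measurable (lebesgue_on {l..})"
    using f ae by (intro borel_measurable_lebesgue_on_cong_AE[OF _ _ ae]) (auto simp: L2_def)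
  have ae': "AE x in lebesgue_on {l..}. (cmod (f x))\<^sup>2 = (cmod (g x))\<^sup>2"
    using ae by eventually_elim simp
  show ?thesis
    using f g integrable_cong_AE_imp[OF _ _ ae'] by (auto simp: L2_def)
qed

lemma L2_inner_self: "f \<in> L2 l \<Longrightarrow> L2_inner l f f = of_real (L2_sq l f)"
  unfolding L2_inner_def L2_sq_def complex_norm_square[symmetric] by (simp flip: of_real_power)

lemma L2_sq_nonneg: "0 \<le> L2_sq l f"
  by (simp add: L2_sq_def)

lemma L2_inner_commute: "L2_inner l g f = cnj (L2_inner l f g)"
  unfolding L2_inner_def by (simp add: mult.commute flip: Bochner_Integration.integral_cnj)

lemma L2_inner_lincomb_left:
  assumes "f \<in> L2 l" "g \<in> L2 l" "h \<in> L2 l"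
  shows "L2_inner l (\<lambda>x. a * f x + b * g x) h = a * L2_inner l f h + b * L2_inner l g h"
proof -
  have "L2_inner l (\<lambda>x. a * f x + b * g x) h = (LINT x|lebesgue_on {l..}. a * (f x * cnj (h x)) + b * (g x * cnj (h x)))"
    by (simp add: L2_inner_def algebra_simps)
  then show ?thesis
    using L2_integrable_mult_cnj[OF assms(1,3)] L2_integrable_mult_cnj[OF assms(2,3)]
    by (simp add: L2_inner_def)
qed

lemma L2_inner_lincomb_right:
  assumes "f \<in> L2 l" "g \<in> L2 l" "h \<in> L2 l"
  shows "L2_inner l h (\<lambda>x. a * f x + b * g x) = cnj a * L2_inner l h f + cnj b * L2_inner l h g"
  by (subst (1 2 3) L2_inner_commute) (simp add: L2_inner_lincomb_left[OF assms])

lemma L2_inner_cong_AE: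
  assumes "f \<in> L2 l" "g \<in> L2 l" and ae: "AE x in lebesgue_on {l..}. f x = f' x"
  shows "L2_inner l f' g = L2_inner l f g"
  unfolding L2_inner_def
proof (rule integral_cong_AE)
  note f' = L2_cong_AE[OF assms(1) ae]
  show "(\<lambda>x. f' x * cnj (g x)) \<in> borel_measurable (lebesgue_on {l..})"
    using L2_integrable_mult_cnj[OF f' assms(2)] by auto
  show "(\<lambda>x. f x * cnj (g x)) \<in> borel_measurable (lebesgue_on {l..})"
    using L2_integrable_mult_cnj[OF assms(1,2)] by auto
  show "AE x in lebesgue_on {l..}. f' x * cnj (g x) = f x * cnj (g x)"
    using ae by eventually_elim simp
qed

lemma L2_inner_Cauchy_Schwarz:
  assumes "f \<in> L2 l" "g \<in> L2 l"
  shows "(cmod (L2_inner l f g))\<^sup>2 \<le> L2_sq l f * L2_sq l g"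
  using Cauchy_Schwarz_lebesgue_integral[of f "lebesgue_on {l..}" "\<lambda>x. cnj (g x)"] assms L2_cnj[OF assms(2)]
  by (simp add: L2_inner_def L2_sq_def L2_def)

lemma L2_sq_diff:
  assumes "f \<in> L2 l" "g \<in> L2 l"
  shows "L2_sq l (\<lambda>x. f x - g x) = L2_sq l f + L2_sq l g - 2 * Re (L2_inner l f g)"
proof -
  have d: "(\<lambda>x. f x - g x) = (\<lambda>x. 1 * f x + (-1) * g x)" by auto
  have "of_real (L2_sq l (\<lambda>x. f x - g x)) = L2_inner l (\<lambda>x. f x - g x) (\<lambda>x. f x - g x)"
    by (rule L2_inner_self[symmetric]) (rule L2_diff[OF assms])
  also have "\<dots> = L2_inner l f f - L2_inner l f g - L2_inner l g f + L2_inner l g g"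
    unfolding d using assms by (simp only: L2_inner_lincomb_left L2_inner_lincomb_right L2_lincomb) simp
  also have "\<dots> = of_real (L2_sq l f) + of_real (L2_sq l g) - (L2_inner l f g + cnj (L2_inner l f g))"
    using assms by (simp add: L2_inner_self L2_inner_commute[of l g f])
  also have "\<dots> = of_real (L2_sq l f + L2_sq l g - 2 * Re (L2_inner l f g))"
    by (simp add: complex_add_cnj)
  finally show ?thesis by (simp only: of_real_eq_iff)
qed

lemma L2_sq_eq_0_AE:
  assumes "f \<in> L2 l" "L2_sq l f = 0"
  shows "AE x in lebesgue_on {l..}. f x = 0"
  using assms integral_nonneg_eq_0_iff_AE[of "lebesgue_on {l..}" "\<lambda>x. (cmod (f x))\<^sup>2"]
  by (simp add: L2_sq_def L2_def)

text \<open>A nonzero value would persist on an interval to the right, which is not a null set. Elements of \<open>D\<^sup>*\<close> of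
  norm zero are therefore zero as functions.\<close>

lemma continuous_AE_zero:
  fixes f :: "real \<Rightarrow> complex"
  assumes c: "continuous_on {l..} f" and ae: "AE x in lebesgue_on {l..}. f x = (0::complex)" and x: "l \<le> x"
  shows "f x = 0"
proof (rule ccontr)
  assume "f x \<noteq> 0"
  then have "\<exists>d>0. \<forall>x'\<in>{l..}. dist x' x < d \<longrightarrow> dist (f x') (f x) < cmod (f x)"
    using c x unfolding continuous_on_iff by force
  then obtain d where d: "d > 0" "\<And>x'. l \<le> x' \<Longrightarrow> dist x' x < d \<Longrightarrow> dist (f x') (f x) < cmod (f x)"
    by auto
  have nz: "f x' \<noteq> 0" if "x' \<in> {x<..<x+d}" for x'
    using d(2)[of x'] that x by (auto simp: dist_real_def dist_norm)
  have "AE t in lebesgue. t \<notin> {x<..<x+d}"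
    using ae nz x by (auto simp: AE_restrict_space_iff elim!: eventually_mono)
  then have "{x<..<x+d} \<in> null_sets lebesgue"
    by (simp add: completion.null_sets_iff_AE)
  then have "emeasure lebesgue {x<..<x+d} = 0" by auto
  then show False using d by simp
qed

lemma tendsto_integral_Ici:
  fixes F :: "real \<Rightarrow> 'b::euclidean_space"
  assumes F: "integrable (lebesgue_on {l..}) F"
  shows "((\<lambda>x. LINT t|lebesgue_on {l..x}. F t) \<longlongrightarrow> (LINT t|lebesgue_on {l..}. F t)) at_top"
proof -
  let ?M = "lebesgue_on {l..}"
  have eq: "(LINT t|lebesgue_on {l..x}. F t) = (LINT t|?M. indicator {..x} t *\<^sub>R F t)" for x
    by (auto simp: integral_restrict_space indicator_def intro!: Bochner_Integration.integral_cong)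
  have [measurable]: "F \<in> borel_measurable ?M" using F by simp
  have [measurable]: "(\<lambda>t. indicator {..x} t *\<^sub>R F t) \<in> borel_measurable ?M" for x
  proof -
    have "indicat_real {..x} \<in> borel_measurable ?M" by (intro measurable_restrict_space1 borel_measurable_indicator) auto
    then show ?thesis by (intro borel_measurable_scaleR) auto
  qed
  show ?thesis
    unfolding eq
  proof (rule integral_dominated_convergence_at_top[where w = "\<lambda>t. norm (F t)"])
    show "AE t in ?M. ((\<lambda>x. indicator {..x} t *\<^sub>R F t) \<longlongrightarrow> F t) at_top"
    proof (rule AE_I2)
      fix t
      have "\<forall>\<^sub>F x in at_top. indicator {..x} t *\<^sub>R F t = F t"
        using eventually_ge_at_top[of t] by eventually_elim simp
      then show "((\<lambda>x. indicator {..x} t *\<^sub>R F t) \<longlongrightarrow> F t) at_top"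
        by (rule tendsto_eventually)
    qed
    show "\<forall>\<^sub>F x in at_top. AE t in ?M. norm (indicator {..x} t *\<^sub>R F t) \<le> norm (F t)"
      by (intro always_eventually allI AE_I2) (simp add: indicator_def)
  qed (use F in auto)
qed

text \<open>Monotone convergence; it turns failure of square integrability into growth of the integrals over
  finite intervals.\<close>

lemma integrable_Ici_of_bounded:
  fixes F :: "real \<Rightarrow> real"
  assumes F: "\<And>x. l \<le> x \<Longrightarrow> integrable (lebesgue_on {l..x}) F" and pos: "\<And>x. l \<le> x \<Longrightarrow> 0 \<le> F x"
    and bd: "\<And>x. l \<le> x \<Longrightarrow> (LINT t|lebesgue_on {l..x}. F t) \<le> C"
  shows "integrable (lebesgue_on {l..}) F"
proof -
  define G where "G n t = indicator {l..l + real n} t * F t" for n t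
  have Gi: "integrable lebesgue (G n)" for n
    using F[of "l + real n"] by (simp add: G_def[abs_def] integrable_restrict_space)
  have GI: "(LINT t|lebesgue. G n t) = (LINT t|lebesgue_on {l..l + real n}. F t)" for n
    by (simp add: G_def integral_restrict_space)
  have mono: "mono (\<lambda>n. G n t)" for t
    using pos[of t] by (intro monoI) (auto simp: G_def indicator_def)
  have lim: "(\<lambda>n. G n t) \<longlonglongrightarrow> indicator {l..} t * F t" for t
  proof (rule tendsto_eventually)
    obtain n0 where "t - l \<le> real n0" using real_arch_simple by blast
    then show "\<forall>\<^sub>F n in sequentially. G n t = indicator {l..} t * F t"
      by (intro eventually_sequentiallyI[of n0]) (auto simp: G_def indicator_def)
  qed
  have inc: "incseq (\<lambda>n. LINT t|lebesgue. G n t)"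
    by (intro monoI integral_mono Gi) (use mono in \<open>auto simp: mono_def\<close>)
  have "convergent (\<lambda>n. LINT t|lebesgue. G n t)"
  proof (rule Bseq_mono_convergent)
    show "Bseq (\<lambda>n. LINT t|lebesgue. G n t)"
    proof (rule BseqI')
      fix n
      have "0 \<le> (LINT t|lebesgue. G n t)"
        using pos by (intro integral_nonneg_AE AE_I2) (auto simp: G_def indicator_def)
      moreover have "(LINT t|lebesgue. G n t) \<le> C"
        using bd[of "l + real n"] by (simp add: GI)
      ultimately show "norm (LINT t|lebesgue. G n t) \<le> C" by simp
    qed
    show "\<forall>m n. m \<le> n \<longrightarrow> (LINT t|lebesgue. G m t) \<le> (LINT t|lebesgue. G n t)"
      using inc by (simp add: mono_def)
  qed
  then obtain I where I: "(\<lambda>n. LINT t|lebesgue. G n t) \<longlonglongrightarrow> I" by (auto simp: convergent_def)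
  have "integrable lebesgue (\<lambda>t. indicator {l..} t * F t)"
  proof (rule integrable_monotone_convergence[OF Gi _ _ I])
    show "(\<lambda>t. indicator {l..} t * F t) \<in> borel_measurable lebesgue"
      by (rule borel_measurable_LIMSEQ_real[OF lim]) (use Gi in auto)
  qed (use mono lim in auto)
  then show ?thesis by (simp add: integrable_restrict_space)
qed

section \<open>The maximal domain\<close>

lemma AC_with_derivative_lincomb:
  assumes f: "AC_with_derivative l f" and g: "AC_with_derivative l g"
  shows "AC_with_derivative l (\<lambda>x. a * f x + b * g x)"
    and "\<And>x. l \<le> x \<Longrightarrow> der l (\<lambda>x. a * f x + b * g x) x = a * der l f x + b * der l g x"
    and "AE x in lebesgue_on {l..}. sl_expr q l (\<lambda>x. a * f x + b * g x) x = a * sl_expr q l f x + b * sl_expr q l g x"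
proof -
  have d0: "((\<lambda>x. a * f x + b * g x) has_vector_derivative (a * der l f x + b * der l g x)) (at x within {l..})"
    if "l \<le> x" for x
    using AC_with_derivative_has_vector_derivative[OF f that] AC_with_derivative_has_vector_derivative[OF g that]
    by (intro has_vector_derivative_add has_vector_derivative_mult_right)
  then have d: "\<forall>x\<ge>l. ((\<lambda>x. a * f x + b * g x) has_vector_derivative (a * der l f x + b * der l g x)) (at x within {l..})" by blast
  have D: "primitive l (\<lambda>x. a * (q x * f x - sl_expr q l f x) + b * (q x * g x - sl_expr q l g x))
      (\<lambda>x. a * der l f x + b * der l g x)"
    by (intro primitive_add primitive_cmult primitive_der_sl_expr f g)
  show "AC_with_derivative l (\<lambda>x. a * f x + b * g x)" by (rule AC_with_derivativeI(1)[OF d D])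
  show "der l (\<lambda>x. a * f x + b * g x) x = a * der l f x + b * der l g x" if "l \<le> x" for x
    by (rule AC_with_derivativeI(2)[OF d D that])
  show "AE x in lebesgue_on {l..}. sl_expr q l (\<lambda>x. a * f x + b * g x) x = a * sl_expr q l f x + b * sl_expr q l g x"
    using AC_with_derivativeI(3)[OF d D, of q] by eventually_elim (simp add: algebra_simps)
qed

lemma AC_with_derivative_cnj:
  assumes f: "AC_with_derivative l f"
  shows "AC_with_derivative l (\<lambda>x. cnj (f x))"
    and "\<And>x. l \<le> x \<Longrightarrow> der l (\<lambda>x. cnj (f x)) x = cnj (der l f x)"
    and "AE x in lebesgue_on {l..}. sl_expr q l (\<lambda>x. cnj (f x)) x = cnj (sl_expr q l f x)"
proof -
  have d0: "((\<lambda>x. cnj (f x)) has_vector_derivative cnj (der l f x)) (at x within {l..})"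
    if "l \<le> x" for x
    using bounded_linear.has_vector_derivative[OF bounded_linear_cnj AC_with_derivative_has_vector_derivative[OF f that]] .
  then have d: "\<forall>x\<ge>l. ((\<lambda>x. cnj (f x)) has_vector_derivative cnj (der l f x)) (at x within {l..})" by blast
  have D: "primitive l (\<lambda>x. cnj (q x * f x - sl_expr q l f x)) (\<lambda>x. cnj (der l f x))"
    by (intro primitive_cnj primitive_der_sl_expr f)
  show "AC_with_derivative l (\<lambda>x. cnj (f x))" by (rule AC_with_derivativeI(1)[OF d D])
  show "der l (\<lambda>x. cnj (f x)) x = cnj (der l f x)" if "l \<le> x" for x
    by (rule AC_with_derivativeI(2)[OF d D that])
  show "AE x in lebesgue_on {l..}. sl_expr q l (\<lambda>x. cnj (f x)) x = cnj (sl_expr q l f x)"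
    using AC_with_derivativeI(3)[OF d D, of q] by eventually_elim (simp add: algebra_simps)
qed

lemma AC_with_derivative_mult_smooth:
  fixes \<theta> :: "real \<Rightarrow> complex"
  assumes \<theta>: "\<And>x. l \<le> x \<Longrightarrow> (\<theta> has_vector_derivative \<theta>1 x) (at x within {l..})"
    and \<theta>1: "primitive l \<theta>2 \<theta>1" and f: "AC_with_derivative l f"
  shows "AC_with_derivative l (\<lambda>x. \<theta> x * f x)"
    and "\<And>x. l \<le> x \<Longrightarrow> der l (\<lambda>x. \<theta> x * f x) x = \<theta>1 x * f x + \<theta> x * der l f x"
    and "AE x in lebesgue_on {l..}. sl_expr q l (\<lambda>x. \<theta> x * f x) x =
           \<theta> x * sl_expr q l f x - \<theta>2 x * f x - 2 * \<theta>1 x * der l f x"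
proof -
  have d0: "((\<lambda>x. \<theta> x * f x) has_vector_derivative (\<theta>1 x * f x + \<theta> x * der l f x)) (at x within {l..})"
    if "l \<le> x" for x
    using has_vector_derivative_mult[OF \<theta>[OF that] AC_with_derivative_has_vector_derivative[OF f that]]
    by (simp add: add.commute)
  then have d: "\<forall>x\<ge>l. ((\<lambda>x. \<theta> x * f x) has_vector_derivative (\<theta>1 x * f x + \<theta> x * der l f x)) (at x within {l..})" by blast
  have "primitive l \<theta>1 \<theta>"
    using \<theta> primitive_continuous_on[OF \<theta>1] by (rule primitive_of_continuous_derivative)
  then have D: "primitive l (\<lambda>x. (\<theta>2 x * f x + \<theta>1 x * der l f x) +
      (\<theta>1 x * der l f x + \<theta> x * (q x * f x - sl_expr q l f x))) (\<lambda>x. \<theta>1 x * f x + \<theta> x * der l f x)"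
    by (intro primitive_add primitive_mult primitive_der primitive_der_sl_expr f \<theta>1)
  show "AC_with_derivative l (\<lambda>x. \<theta> x * f x)" by (rule AC_with_derivativeI(1)[OF d D])
  show "der l (\<lambda>x. \<theta> x * f x) x = \<theta>1 x * f x + \<theta> x * der l f x" if "l \<le> x" for x
    by (rule AC_with_derivativeI(2)[OF d D that])
  show "AE x in lebesgue_on {l..}. sl_expr q l (\<lambda>x. \<theta> x * f x) x =
           \<theta> x * sl_expr q l f x - \<theta>2 x * f x - 2 * \<theta>1 x * der l f x"
    using AC_with_derivativeI(3)[OF d D, of q] by eventually_elim (simp add: algebra_simps)
qed

text \<open>The normalisation of the elements of \<open>D\<^sup>*\<close>, applied to solutions that are arbitrary to the left of \<open>l\<close>.\<close>

definition left_zero :: "real \<Rightarrow> (real \<Rightarrow> complex) \<Rightarrow> real \<Rightarrow> complex" where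
  "left_zero l f x = (if x < l then 0 else f x)"

lemma left_zero_simp [simp]: "l \<le> x \<Longrightarrow> left_zero l f x = f x"
  by (simp add: left_zero_def)

lemma AC_with_derivative_left_zero:
  assumes f: "AC_with_derivative l f"
  shows "AC_with_derivative l (left_zero l f)"
    and "\<And>x. l \<le> x \<Longrightarrow> der l (left_zero l f) x = der l f x"
    and "AE x in lebesgue_on {l..}. sl_expr q l (left_zero l f) x = sl_expr q l f x"
proof -
  have d0: "(left_zero l f has_vector_derivative der l f x) (at x within {l..})" if "l \<le> x" for x
    using that by (intro has_vector_derivative_transform[OF _ _ AC_with_derivative_has_vector_derivative[OF f that]]) auto
  then have d: "\<forall>x\<ge>l. (left_zero l f has_vector_derivative der l f x) (at x within {l..})" by blast
  note D = primitive_der_sl_expr[OF f, of q]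
  show "AC_with_derivative l (left_zero l f)" by (rule AC_with_derivativeI(1)[OF d D])
  show "der l (left_zero l f) x = der l f x" if "l \<le> x" for x
    by (rule AC_with_derivativeI(2)[OF d D that])
  have "AE x in lebesgue_on {l..}. x \<in> {l..}" by (rule AE_I2) simp
  then show "AE x in lebesgue_on {l..}. sl_expr q l (left_zero l f) x = sl_expr q l f x"
    using AC_with_derivativeI(3)[OF d D, of q] by eventually_elim simp
qed

lemma DstarD:
  assumes "f \<in> Dstar q l"
  shows "AC_with_derivative l f" "f \<in> L2 l" "sl_expr q l f \<in> L2 l" "\<And>x. x < l \<Longrightarrow> f x = 0"
  using assms by (auto simp: Dstar_def)

lemma Dstar_lincomb:
  assumes "f \<in> Dstar q l" "g \<in> Dstar q l"
  shows "(\<lambda>x. a * f x + b * g x) \<in> Dstar q l"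
proof -
  note f = DstarD[OF assms(1)] and g = DstarD[OF assms(2)]
  have "AE x in lebesgue_on {l..}. a * sl_expr q l f x + b * sl_expr q l g x = sl_expr q l (\<lambda>x. a * f x + b * g x) x"
    using AC_with_derivative_lincomb(3)[OF f(1) g(1), where q = q and a = a and b = b] by eventually_elim simp
  from L2_cong_AE[OF L2_lincomb[OF f(3) g(3)] this] show ?thesis
    using f g AC_with_derivative_lincomb(1)[OF f(1) g(1)] L2_lincomb[OF f(2) g(2)] by (simp add: Dstar_def)
qed

lemma Dstar_cnj:
  assumes "f \<in> Dstar q l"
  shows "(\<lambda>x. cnj (f x)) \<in> Dstar q l"
proof -
  note f = DstarD[OF assms]
  have "AE x in lebesgue_on {l..}. cnj (sl_expr q l f x) = sl_expr q l (\<lambda>x. cnj (f x)) x"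
    using AC_with_derivative_cnj(3)[OF f(1), of q] by eventually_elim simp
  from L2_cong_AE[OF L2_cnj[OF f(3)] this] show ?thesis
    using f AC_with_derivative_cnj(1)[OF f(1)] L2_cnj[OF f(2)] by (simp add: Dstar_def)
qed

text \<open>The way in which solutions and cutoffs enter \<open>D\<^sup>*\<close>: it suffices to know the expression almost everywhere.\<close>

lemma left_zero_in_Dstar:
  assumes f: "AC_with_derivative l f" "f \<in> L2 l" and u: "u \<in> L2 l" "AE x in lebesgue_on {l..}. sl_expr q l f x = u x"
  shows "left_zero l f \<in> Dstar q l"
proof -
  have "AE x in lebesgue_on {l..}. x \<in> {l..}" by (rule AE_I2) simp
  then have "AE x in lebesgue_on {l..}. f x = left_zero l f x" by eventually_elim simp
  then have "left_zero l f \<in> L2 l" by (rule L2_cong_AE[OF f(2)])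
  moreover have "AE x in lebesgue_on {l..}. u x = sl_expr q l (left_zero l f) x"
    using AC_with_derivative_left_zero(3)[OF f(1), of q] u(2) by eventually_elim simp
  then have "sl_expr q l (left_zero l f) \<in> L2 l" by (rule L2_cong_AE[OF u(1)])
  ultimately show ?thesis
    using AC_with_derivative_left_zero(1)[OF f(1)] by (simp add: Dstar_def left_zero_def)
qed

lemma Dstar_continuous_on: "f \<in> Dstar q l \<Longrightarrow> continuous_on {l..} f"
  using primitive_continuous_on[OF primitive_der[OF DstarD(1)]] .

lemma L2_sq_integrable_on:
  assumes "f \<in> L2 l" "S \<subseteq> {l..}" "S \<in> sets lebesgue"
  shows "f \<in> borel_measurable (lebesgue_on S)" "integrable (lebesgue_on S) (\<lambda>x. (cmod (f x))\<^sup>2)"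
proof -
  have m: "f \<in> borel_measurable (lebesgue_on {l..})" and i: "integrable (lebesgue_on {l..}) (\<lambda>x. (cmod (f x))\<^sup>2)"
    using assms(1) by (simp_all add: L2_def)
  show "f \<in> borel_measurable (lebesgue_on S)" by (rule measurable_restrict_mono[OF m assms(2)])
  show "integrable (lebesgue_on S) (\<lambda>x. (cmod (f x))\<^sup>2)"
    by (rule integrable_lebesgue_on_subset[OF assms(2,3) _ i]) simp
qed

lemma integral_Ici_split:
  fixes F :: "real \<Rightarrow> 'b::euclidean_space"
  assumes F: "integrable (lebesgue_on {l..}) F" and x: "l \<le> x"
  shows "(LINT t|lebesgue_on {l..}. F t) = (LINT t|lebesgue_on {l..x}. F t) + (LINT t|lebesgue_on {x..}. F t)"
proof -
  have 1: "((\<lambda>y. LINT t|lebesgue_on {x..y}. F t) \<longlongrightarrow> (LINT t|lebesgue_on {x..}. F t)) at_top"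
    using F x by (intro tendsto_integral_Ici integrable_lebesgue_on_subset[of "{x..}" "{l..}"]) auto
  have "\<forall>\<^sub>F y in at_top. (LINT t|lebesgue_on {l..y}. F t) = (LINT t|lebesgue_on {l..x}. F t) + (LINT t|lebesgue_on {x..y}. F t)"
    using eventually_ge_at_top[of x]
  proof eventually_elim
    case (elim y)
    then show ?case
      using x F by (intro integral_combine integrable_lebesgue_on_subset[of "{l..y}" "{l..}"]) auto
  qed
  then have "\<forall>\<^sub>F y in at_top. (LINT t|lebesgue_on {l..x}. F t) + (LINT t|lebesgue_on {x..y}. F t) = (LINT t|lebesgue_on {l..y}. F t)"
    by eventually_elim simp
  from Lim_transform_eventually[OF tendsto_add[OF tendsto_const 1] this]
  have "((\<lambda>y. LINT t|lebesgue_on {l..y}. F t) \<longlongrightarrow> (LINT t|lebesgue_on {l..x}. F t) + (LINT t|lebesgue_on {x..}. F t)) at_top" .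
  from tendsto_unique[OF _ tendsto_integral_Ici[OF F] this] show ?thesis by simp
qed

lemma wronskian_constant:
  assumes "AC_with_derivative l f" "AC_with_derivative l g"
    and "AE x in lebesgue_on {l..}. sl_expr q l f x = z * f x"
    and "AE x in lebesgue_on {l..}. sl_expr q l g x = z * g x"
    and "l \<le> x"
  shows "wronskian l f g x = wronskian l f g l"
proof -
  have "AE x in lebesgue_on {l..}. sl_expr q l f x * g x - f x * sl_expr q l g x = 0"
    using assms(3,4) by eventually_elim simp
  from primitive_cong_AE[OF lagrange_identity[OF assms(1,2)] this]
  show ?thesis using primitive_eq[OF _ assms(5)] by fastforce
qed

section \<open>The limit point case\<close>

text \<open>At \<open>\<i>\<close> there is one square integrable solution \<open>\<psi>\<close> and one solution \<open>\<phi>\<close> that is not. The value of \<open>\<psi>\<close> and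
  the initial data of \<open>\<phi>\<close> normalise their Wronskian to \<open>-1\<close>, so every \<open>f\<close> satisfies
  \<open>\<phi> W(f, \<psi>) = \<psi> W(f, \<phi>) + f\<close>.\<close>

locale limit_point =
  fixes q :: "real \<Rightarrow> real" and l :: real and \<phi> \<psi> :: "real \<Rightarrow> complex"
  assumes \<phi>: "AC_with_derivative l \<phi>" "AE x in lebesgue_on {l..}. sl_expr q l \<phi> x = \<i> * \<phi> x"
    and \<phi>_l: "\<phi> l = 0" "der l \<phi> l = 1"
    and \<psi>: "\<psi> \<in> Dstar q l" "AE x in lebesgue_on {l..}. sl_expr q l \<psi> x = \<i> * \<psi> x" "\<psi> l = -1"
    and \<phi>_not_L2: "\<phi> \<notin> L2 l"
begin

lemmas \<psi>_AC = DstarD(1)[OF \<psi>(1)]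

lemma \<phi>_cont: "continuous_on {l..} \<phi>"
  by (rule primitive_continuous_on[OF primitive_der[OF \<phi>(1)]])

lemma \<phi>_L2_on: "x \<ge> l \<Longrightarrow> y \<ge> x \<Longrightarrow> \<phi> \<in> borel_measurable (lebesgue_on {x..y}) \<and> integrable (lebesgue_on {x..y}) (\<lambda>t. (cmod (\<phi> t))\<^sup>2)"
  by (intro conjI continuous_imp_measurable_on_sets_lebesgue continuous_imp_integrable_real continuous_intros
      continuous_on_subset[OF \<phi>_cont]) auto

definition \<phi>_mass :: "real \<Rightarrow> real" where "\<phi>_mass x = (LINT t|lebesgue_on {l..x}. (cmod (\<phi> t))\<^sup>2)"

definition \<psi>_tail :: "real \<Rightarrow> real" where "\<psi>_tail x = (LINT t|lebesgue_on {x..}. (cmod (\<psi> t))\<^sup>2)"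

lemma \<phi>_mass_diff: "l \<le> x \<Longrightarrow> x \<le> y \<Longrightarrow> \<phi>_mass y = \<phi>_mass x + (LINT t|lebesgue_on {x..y}. (cmod (\<phi> t))\<^sup>2)"
  unfolding \<phi>_mass_def using \<phi>_L2_on[of l y] by (intro integral_combine) auto

lemma \<phi>_mass_nonneg: "0 \<le> \<phi>_mass x" by (simp add: \<phi>_mass_def)

lemma \<phi>_mass_mono: "l \<le> x \<Longrightarrow> x \<le> y \<Longrightarrow> \<phi>_mass x \<le> \<phi>_mass y"
  using \<phi>_mass_diff[of x y] by simp

lemma \<phi>_mass_unbounded: "\<exists>y\<ge>x. \<phi>_mass y > C"
proof (rule ccontr)
  assume "\<not> (\<exists>y\<ge>x. \<phi>_mass y > C)"
  then have le: "\<phi>_mass y \<le> C" if "y \<ge> x" for y using that by (meson not_le)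
  have "\<phi>_mass y \<le> C" if "y \<ge> l" for y
    using le[of "max x y"] \<phi>_mass_mono[OF that, of "max x y"] by simp
  then have "integrable (lebesgue_on {l..}) (\<lambda>t. (cmod (\<phi> t))\<^sup>2)"
    using \<phi>_L2_on unfolding \<phi>_mass_def by (intro integrable_Ici_of_bounded[of l _ C]) auto
  moreover have "\<phi> \<in> borel_measurable (lebesgue_on {l..})"
    by (intro continuous_imp_measurable_on_sets_lebesgue \<phi>_cont) auto
  ultimately show False using \<phi>_not_L2 by (simp add: L2_def)
qed

lemma wronskian_\<psi>_\<phi>: "l \<le> x \<Longrightarrow> wronskian l \<psi> \<phi> x = -1"
  using wronskian_constant[OF \<psi>_AC \<phi>(1) \<psi>(2) \<phi>(2)] by (simp add: wronskian_def \<phi>_l \<psi>(3))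

lemma tail_tendsto_0:
  assumes "f \<in> L2 l"
  shows "((\<lambda>x. LINT t|lebesgue_on {x..}. (cmod (f t))\<^sup>2) \<longlongrightarrow> 0) at_top"
proof -
  have i: "integrable (lebesgue_on {l..}) (\<lambda>t. (cmod (f t))\<^sup>2)" using assms by (simp add: L2_def)
  have "((\<lambda>x. L2_sq l f - (LINT t|lebesgue_on {l..x}. (cmod (f t))\<^sup>2)) \<longlongrightarrow> L2_sq l f - L2_sq l f) at_top"
    using tendsto_integral_Ici[OF i] by (intro tendsto_diff tendsto_const) (simp add: L2_sq_def)
  moreover have "\<forall>\<^sub>F x in at_top. L2_sq l f - (LINT t|lebesgue_on {l..x}. (cmod (f t))\<^sup>2) = (LINT t|lebesgue_on {x..}. (cmod (f t))\<^sup>2)"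
    using eventually_ge_at_top[of l] by eventually_elim (simp add: L2_sq_def integral_Ici_split[OF i])
  ultimately show ?thesis by (simp add: tendsto_cong)
qed

lemma L2_remainder: "f \<in> Dstar q l \<Longrightarrow> (\<lambda>x. sl_expr q l f x - \<i> * f x) \<in> L2 l"
  using L2_lincomb[OF DstarD(3,2), of f q l f q 1 "-\<i>"] by simp

text \<open>The density of the Wronskian is \<open>(l(f) - \<i> f) \<phi>\<close>, and Cauchy-Schwarz bounds its integral by the square root
  of the mass of \<open>\<phi>\<close>.\<close>

lemma wronskian_\<phi>_bound:
  assumes f: "f \<in> Dstar q l"
  obtains C where "C > 0" "\<And>x. l \<le> x \<Longrightarrow> (cmod (wronskian l f \<phi> x))\<^sup>2 \<le> C * (1 + \<phi>_mass x)"
proof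
  define u where "u = (\<lambda>x. sl_expr q l f x - \<i> * f x)"
  have u: "u \<in> L2 l" using L2_remainder[OF f] by (simp add: u_def)
  define C where "C = 1 + 2 * (cmod (wronskian l f \<phi> l))\<^sup>2 + 2 * L2_sq l u"
  show "C > 0" using L2_sq_nonneg[of l u] by (simp add: C_def add_pos_nonneg)
  fix x assume x: "l \<le> x"
  have "AE x in lebesgue_on {l..}. sl_expr q l f x * \<phi> x - f x * sl_expr q l \<phi> x = u x * \<phi> x"
    using \<phi>(2) by eventually_elim (simp add: u_def algebra_simps)
  from primitive_eq[OF primitive_cong_AE[OF lagrange_identity[OF DstarD(1)[OF f] \<phi>(1)] this] x]
  have w: "wronskian l f \<phi> x = wronskian l f \<phi> l + (LINT t|lebesgue_on {l..x}. u t * \<phi> t)" .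
  have i: "integrable (lebesgue_on {l..}) (\<lambda>t. (cmod (u t))\<^sup>2)" using u by (simp add: L2_def)
  have "(LINT t|lebesgue_on {l..x}. (cmod (u t))\<^sup>2) \<le> L2_sq l u"
    using integral_Ici_split[OF i x] by (simp add: L2_sq_def)
  then have "(cmod (LINT t|lebesgue_on {l..x}. u t * \<phi> t))\<^sup>2 \<le> L2_sq l u * \<phi>_mass x"
    using Cauchy_Schwarz_lebesgue_integral[of u "lebesgue_on {l..x}" \<phi>] \<phi>_L2_on[of l x] x
      L2_sq_integrable_on[OF u, of "{l..x}"] mult_right_mono[OF _ \<phi>_mass_nonneg, of _ "L2_sq l u" x]
    by (simp add: \<phi>_mass_def) (meson order_trans)
  moreover have "(cmod (wronskian l f \<phi> x))\<^sup>2 \<le> 2 * (cmod (wronskian l f \<phi> l))\<^sup>2 + 2 * (cmod (LINT t|lebesgue_on {l..x}. u t * \<phi> t))\<^sup>2"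
  proof -
    have "(cmod (a + b))\<^sup>2 \<le> 2 * (cmod a)\<^sup>2 + 2 * (cmod b)\<^sup>2" for a b
    proof -
      have "(cmod (a + b))\<^sup>2 \<le> (cmod a + cmod b)\<^sup>2"
        by (intro power_mono norm_triangle_ineq) simp
      also have "\<dots> \<le> 2 * (cmod a)\<^sup>2 + 2 * (cmod b)\<^sup>2"
        using sum_squares_bound[of "cmod a" "cmod b"] by (simp add: power2_sum)
      finally show ?thesis .
    qed
    then show ?thesis by (subst w)
  qed
  ultimately have "(cmod (wronskian l f \<phi> x))\<^sup>2 \<le> 2 * (cmod (wronskian l f \<phi> l))\<^sup>2 + 2 * (L2_sq l u * \<phi>_mass x)"
    by linarith
  also have "\<dots> \<le> C * (1 + \<phi>_mass x)"
  proof -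
    have "2 * A + 2 * (S * p) \<le> (1 + 2 * A + 2 * S) * (1 + p)" if "0 \<le> A" "0 \<le> S" "0 \<le> p" for A S p :: real
      using that mult_nonneg_nonneg[of A p] by (simp add: algebra_simps)
    then show ?thesis unfolding C_def by (simp add: \<phi>_mass_nonneg L2_sq_nonneg)
  qed
  finally show "(cmod (wronskian l f \<phi> x))\<^sup>2 \<le> C * (1 + \<phi>_mass x)" .
qed

text \<open>The density of \<open>W(f, \<psi>)\<close> is integrable on the half-line, so the Wronskian has a limit \<open>a\<close> at infinity. If
  \<open>a\<close> were not zero, the identity \<open>\<phi> W(f, \<psi>) = \<psi> W(f, \<phi>) + f\<close> would bound \<open>\<phi>\<close> by \<open>\<psi> W(f, \<phi>)\<close> and \<open>f\<close> near
  infinity. There \<open>W(f, \<phi>)\<close> grows at most like the square root of the mass of \<open>\<phi>\<close> and \<open>\<psi>\<close> has little mass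
  left, so at most half of the mass of \<open>\<phi>\<close> is accounted for in this way. The mass of \<open>\<phi>\<close> would then be
  bounded, which it is not. With \<open>a = 0\<close> the Wronskian is minus a tail integral, which gives the rate.\<close>

lemma wronskian_\<psi>_tendsto_0:
  assumes f: "f \<in> Dstar q l"
  shows "(wronskian l f \<psi> \<longlongrightarrow> 0) at_top"
    and "\<And>x. l \<le> x \<Longrightarrow> (cmod (wronskian l f \<psi> x))\<^sup>2 \<le>
      (LINT t|lebesgue_on {x..}. (cmod (sl_expr q l f t - \<i> * f t))\<^sup>2) * \<psi>_tail x"
proof -
  define u where "u = (\<lambda>x. sl_expr q l f x - \<i> * f x)"
  have u: "u \<in> L2 l" using L2_remainder[OF f] by (simp add: u_def)
  note f_AC = DstarD(1)[OF f] and f_L2 = DstarD(2)[OF f] and \<psi>_L2 = DstarD(2)[OF \<psi>(1)]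
  have ui: "integrable (lebesgue_on {l..}) (\<lambda>t. u t * \<psi> t)"
    by (rule L2_integrable_mult[OF u \<psi>_L2])
  have "AE x in lebesgue_on {l..}. sl_expr q l f x * \<psi> x - f x * sl_expr q l \<psi> x = u x * \<psi> x"
    using \<psi>(2) by eventually_elim (simp add: u_def algebra_simps)
  note w = primitive_eq[OF primitive_cong_AE[OF lagrange_identity[OF f_AC \<psi>_AC] this]]
  define a where "a = wronskian l f \<psi> l + (LINT t|lebesgue_on {l..}. u t * \<psi> t)"
  have "((\<lambda>x. wronskian l f \<psi> l + (LINT t|lebesgue_on {l..x}. u t * \<psi> t)) \<longlongrightarrow> a) at_top"
    unfolding a_def by (intro tendsto_add tendsto_const tendsto_integral_Ici ui)
  moreover have "\<forall>\<^sub>F x in at_top. wronskian l f \<psi> l + (LINT t|lebesgue_on {l..x}. u t * \<psi> t) = wronskian l f \<psi> x"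
    using eventually_ge_at_top[of l] by eventually_elim (rule w[symmetric])
  ultimately have lim: "(wronskian l f \<psi> \<longlongrightarrow> a) at_top"
    by (rule Lim_transform_eventually)
  have "a = 0"
  proof (rule ccontr)
    assume "a \<noteq> 0"
    define \<delta> where "\<delta> = cmod a / 2"
    have \<delta>: "\<delta> > 0" "\<delta> < cmod a" using \<open>a \<noteq> 0\<close> by (auto simp: \<delta>_def)
    obtain C where C: "C > 0" "\<And>x. l \<le> x \<Longrightarrow> (cmod (wronskian l f \<phi> x))\<^sup>2 \<le> C * (1 + \<phi>_mass x)"
      using wronskian_\<phi>_bound[OF f] by blast
    have "\<forall>\<^sub>F x in at_top. cmod (wronskian l f \<psi> x) > \<delta>"
      using order_tendstoD(1)[OF tendsto_norm[OF lim] \<delta>(2)] .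
    \<comment> \<open>With this much mass of \<open>\<psi>\<close> left, the term with \<open>\<psi>\<close> in \<open>bd\<close> is at most half of \<open>\<delta>\<^sup>2 (1 + \<phi>_mass X)\<close>.\<close>
    moreover have "\<delta>\<^sup>2 / (4 * C) > 0" using C \<delta> by simp
    then have "\<forall>\<^sub>F x in at_top. \<psi>_tail x < \<delta>\<^sup>2 / (4 * C)"
      unfolding \<psi>_tail_def by (rule order_tendstoD(2)[OF tail_tendsto_0[OF \<psi>_L2]])
    ultimately have "\<forall>\<^sub>F x in at_top. cmod (wronskian l f \<psi> x) > \<delta> \<and> \<psi>_tail x < \<delta>\<^sup>2 / (4 * C) \<and> x \<ge> l"
      using eventually_ge_at_top[of l] by eventually_elim auto
    then obtain T where T: "\<And>x. T \<le> x \<Longrightarrow> cmod (wronskian l f \<psi> x) > \<delta> \<and> \<psi>_tail x < \<delta>\<^sup>2 / (4 * C) \<and> x \<ge> l"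
      by (auto simp: eventually_at_top_linorder)
    have lT: "l \<le> T" using T[of T] by simp
    have bd: "\<phi>_mass X \<le> 2 * \<phi>_mass T + 1 + 4 * L2_sq l f / \<delta>\<^sup>2" if X: "X \<ge> T" for X
    proof -
      let ?M = "lebesgue_on {T..X}"
      have \<psi>i: "integrable ?M (\<lambda>t. (cmod (\<psi> t))\<^sup>2)" and fi: "integrable ?M (\<lambda>t. (cmod (f t))\<^sup>2)"
        using L2_sq_integrable_on[OF \<psi>_L2, of "{T..X}"] L2_sq_integrable_on[OF f_L2, of "{T..X}"] lT by auto
      have pt: "\<delta>\<^sup>2 * (cmod (\<phi> t))\<^sup>2 \<le> 2 * C * (1 + \<phi>_mass X) * (cmod (\<psi> t))\<^sup>2 + 2 * (cmod (f t))\<^sup>2"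
        if t: "t \<in> {T..X}" for t
      proof -
        have lt: "l \<le> t" using t lT by simp
        have "\<phi> t * wronskian l f \<psi> t = \<psi> t * wronskian l f \<phi> t - f t * wronskian l \<psi> \<phi> t"
          by (simp add: wronskian_def algebra_simps)
        then have id: "\<phi> t * wronskian l f \<psi> t = \<psi> t * wronskian l f \<phi> t + f t"
          by (simp add: wronskian_\<psi>_\<phi>[OF lt])
        have "\<delta>\<^sup>2 \<le> (cmod (wronskian l f \<psi> t))\<^sup>2"
          using T[of t] t \<delta> by (intro power_mono) auto
        then have "\<delta>\<^sup>2 * (cmod (\<phi> t))\<^sup>2 \<le> (cmod (\<phi> t * wronskian l f \<psi> t))\<^sup>2"
          by (simp add: norm_mult power_mult_distrib mult.commute[of "(cmod (\<phi> t))\<^sup>2"] mult_right_mono)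
        also have "\<dots> \<le> (cmod (\<psi> t * wronskian l f \<phi> t) + cmod (f t))\<^sup>2"
          unfolding id by (intro power_mono norm_triangle_ineq) simp
        also have "\<dots> \<le> 2 * (cmod (\<psi> t * wronskian l f \<phi> t))\<^sup>2 + 2 * (cmod (f t))\<^sup>2"
          using sum_squares_bound[of "cmod (\<psi> t * wronskian l f \<phi> t)" "cmod (f t)"] by (simp add: power2_sum)
        also have "(cmod (\<psi> t * wronskian l f \<phi> t))\<^sup>2 \<le> C * (1 + \<phi>_mass X) * (cmod (\<psi> t))\<^sup>2"
        proof -
          have "(cmod (wronskian l f \<phi> t))\<^sup>2 \<le> C * (1 + \<phi>_mass X)"
            using C(2)[OF lt] \<phi>_mass_mono[OF lt, of X] t C(1) by (smt (verit) atLeastAtMost_iff mult_left_mono)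
          then show ?thesis
            by (simp add: norm_mult power_mult_distrib mult.commute[of "(cmod (\<psi> t))\<^sup>2"] mult_right_mono)
        qed
        finally show ?thesis by simp
      qed
      have "\<delta>\<^sup>2 * (\<phi>_mass X - \<phi>_mass T) = (LINT t|?M. \<delta>\<^sup>2 * (cmod (\<phi> t))\<^sup>2)"
        using \<phi>_mass_diff[OF lT X] by simp
      also have "\<dots> \<le> (LINT t|?M. 2 * C * (1 + \<phi>_mass X) * (cmod (\<psi> t))\<^sup>2 + 2 * (cmod (f t))\<^sup>2)"
        using pt \<phi>_L2_on[OF lT X] \<psi>i fi by (intro integral_mono) auto
      also have "\<dots> = 2 * C * (1 + \<phi>_mass X) * (LINT t|?M. (cmod (\<psi> t))\<^sup>2) + 2 * (LINT t|?M. (cmod (f t))\<^sup>2)"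
        using \<psi>i fi by simp
      also have "(LINT t|?M. (cmod (\<psi> t))\<^sup>2) \<le> \<delta>\<^sup>2 / (4 * C)"
      proof -
        have "integrable (lebesgue_on {T..}) (\<lambda>t. (cmod (\<psi> t))\<^sup>2)"
          using L2_sq_integrable_on(2)[OF \<psi>_L2, of "{T..}"] lT by auto
        from integral_Ici_split[OF this X]
        have "(LINT t|?M. (cmod (\<psi> t))\<^sup>2) \<le> \<psi>_tail T" by (simp add: \<psi>_tail_def)
        then show ?thesis using T[of T] by simp
      qed
      also have "(LINT t|?M. (cmod (f t))\<^sup>2) \<le> L2_sq l f"
      proof -
        have i: "integrable (lebesgue_on {l..}) (\<lambda>t. (cmod (f t))\<^sup>2)"
          using f_L2 by (simp add: L2_def)
        then have "integrable (lebesgue_on {T..}) (\<lambda>t. (cmod (f t))\<^sup>2)"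
          using L2_sq_integrable_on(2)[OF f_L2, of "{T..}"] lT by auto
        from integral_Ici_split[OF this X] integral_Ici_split[OF i lT]
        show ?thesis unfolding L2_sq_def by simp
      qed
      finally have "\<delta>\<^sup>2 * (\<phi>_mass X - \<phi>_mass T) \<le> 2 * C * (1 + \<phi>_mass X) * (\<delta>\<^sup>2 / (4 * C)) + 2 * L2_sq l f"
        using C(1) \<phi>_mass_nonneg[of X] by (simp add: mult_left_mono)
      also have "2 * C * (1 + \<phi>_mass X) * (\<delta>\<^sup>2 / (4 * C)) = \<delta>\<^sup>2 * ((1 + \<phi>_mass X) / 2)"
        using C(1) by (simp add: field_simps)
      finally have "\<delta>\<^sup>2 * (\<phi>_mass X - \<phi>_mass T - (1 + \<phi>_mass X) / 2) \<le> 2 * L2_sq l f"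
        by (simp add: algebra_simps)
      then have "\<phi>_mass X - \<phi>_mass T - (1 + \<phi>_mass X) / 2 \<le> 2 * L2_sq l f / \<delta>\<^sup>2"
        using \<delta>(1) by (simp add: pos_le_divide_eq mult.commute)
      then show ?thesis by (simp add: field_simps)
    qed
    obtain X where "X \<ge> T" "\<phi>_mass X > 2 * \<phi>_mass T + 1 + 4 * L2_sq l f / \<delta>\<^sup>2"
      using \<phi>_mass_unbounded by blast
    then show False using bd[of X] by simp
  qed
  then show "(wronskian l f \<psi> \<longlongrightarrow> 0) at_top" using lim by simp
  fix x assume x: "l \<le> x"
  have "wronskian l f \<psi> x = - (LINT t|lebesgue_on {x..}. u t * \<psi> t)"
    using w[OF x] \<open>a = 0\<close> integral_Ici_split[OF ui x] by (simp add: a_def algebra_simps eq_neg_iff_add_eq_0)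
  then have "(cmod (wronskian l f \<psi> x))\<^sup>2 = (cmod (LINT t|lebesgue_on {x..}. u t * \<psi> t))\<^sup>2" by simp
  also have "\<dots> \<le> (LINT t|lebesgue_on {x..}. (cmod (u t))\<^sup>2) * \<psi>_tail x"
    unfolding \<psi>_tail_def using L2_sq_integrable_on[OF u, of "{x..}"] L2_sq_integrable_on[OF \<psi>_L2, of "{x..}"] x
    by (intro Cauchy_Schwarz_lebesgue_integral) auto
  finally show "(cmod (wronskian l f \<psi> x))\<^sup>2 \<le>
      (LINT t|lebesgue_on {x..}. (cmod (sl_expr q l f t - \<i> * f t))\<^sup>2) * \<psi>_tail x" by (simp add: u_def)
qed

text \<open>Up to the factor \<open>2 \<i>\<close> and signs, the two masses are the Wronskians of \<open>\<psi>\<close> and of \<open>\<phi>\<close> with their own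
  conjugates. The Pluecker relation expresses their product by \<open>|W(\<psi>, \<phi>)|\<^sup>2 = 1\<close> and a square that has the
  favourable sign.\<close>

lemma \<phi>_mass_\<psi>_tail_bound:
  assumes x: "l \<le> x"
  shows "4 * (\<phi>_mass x * \<psi>_tail x) \<le> 1"
proof -
  let ?\<psi> = "\<lambda>x. cnj (\<psi> x)" and ?\<phi> = "\<lambda>x. cnj (\<phi> x)"
  have \<psi>c: "?\<psi> \<in> Dstar q l" by (rule Dstar_cnj[OF \<psi>(1)])
  have \<psi>i: "integrable (lebesgue_on {l..}) (\<lambda>t. (cmod (\<psi> t))\<^sup>2)" using DstarD(2)[OF \<psi>(1)] by (simp add: L2_def)
  have \<psi>ic: "integrable (lebesgue_on {l..}) (\<lambda>t. - 2 * \<i> * of_real ((cmod (\<psi> t))\<^sup>2))"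
    using \<psi>i by (simp del: of_real_power)
  have ae\<psi>: "AE x in lebesgue_on {l..}. sl_expr q l ?\<psi> x * \<psi> x - cnj (\<psi> x) * sl_expr q l \<psi> x = - 2 * \<i> * of_real ((cmod (\<psi> x))\<^sup>2)"
    using AC_with_derivative_cnj(3)[OF \<psi>_AC, of q] \<psi>(2)
    by eventually_elim (simp add: complex_norm_square algebra_simps del: of_real_power)
  have ae\<phi>: "AE x in lebesgue_on {l..}. sl_expr q l ?\<phi> x * \<phi> x - cnj (\<phi> x) * sl_expr q l \<phi> x = - 2 * \<i> * of_real ((cmod (\<phi> x))\<^sup>2)"
    using AC_with_derivative_cnj(3)[OF \<phi>(1), of q] \<phi>(2)
    by eventually_elim (simp add: complex_norm_square algebra_simps del: of_real_power)
  note w\<psi> = primitive_eq[OF primitive_cong_AE[OF lagrange_identity[OF DstarD(1)[OF \<psi>c] \<psi>_AC] ae\<psi>]]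
  have "((\<lambda>x. wronskian l ?\<psi> \<psi> l + (LINT t|lebesgue_on {l..x}. - 2 * \<i> * of_real ((cmod (\<psi> t))\<^sup>2)))
     \<longlongrightarrow> wronskian l ?\<psi> \<psi> l + (LINT t|lebesgue_on {l..}. - 2 * \<i> * of_real ((cmod (\<psi> t))\<^sup>2))) at_top"
    by (intro tendsto_add tendsto_const tendsto_integral_Ici \<psi>ic)
  moreover have "\<forall>\<^sub>F x in at_top. wronskian l ?\<psi> \<psi> l + (LINT t|lebesgue_on {l..x}. - 2 * \<i> * of_real ((cmod (\<psi> t))\<^sup>2)) = wronskian l ?\<psi> \<psi> x"
    using eventually_ge_at_top[of l] by eventually_elim (rule w\<psi>[symmetric])
  ultimately have "(wronskian l ?\<psi> \<psi> \<longlongrightarrow> wronskian l ?\<psi> \<psi> l + (LINT t|lebesgue_on {l..}. - 2 * \<i> * of_real ((cmod (\<psi> t))\<^sup>2))) at_top"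
    by (rule Lim_transform_eventually)
  from tendsto_unique[OF _ wronskian_\<psi>_tendsto_0(1)[OF \<psi>c] this]
  have "wronskian l ?\<psi> \<psi> l + (LINT t|lebesgue_on {l..}. - 2 * \<i> * of_real ((cmod (\<psi> t))\<^sup>2)) = 0" by simp
  moreover have "w = - d" if "a + b = 0" "w = a + c" "b = c + d" for w a b c d :: complex
    using that by (metis add.assoc eq_neg_iff_add_eq_0)
  ultimately have "wronskian l ?\<psi> \<psi> x = - (LINT t|lebesgue_on {x..}. - 2 * \<i> * of_real ((cmod (\<psi> t))\<^sup>2))"
    using w\<psi>[OF x] integral_Ici_split[OF \<psi>ic x] by blast
  then have W\<psi>: "wronskian l ?\<psi> \<psi> x = 2 * \<i> * of_real (\<psi>_tail x)"
    unfolding \<psi>_tail_def by (simp del: of_real_power)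
  have "wronskian l ?\<phi> \<phi> l = 0"
    using AC_with_derivative_cnj(2)[OF \<phi>(1)] by (simp add: wronskian_def \<phi>_l)
  then have W\<phi>: "wronskian l ?\<phi> \<phi> x = - 2 * \<i> * of_real (\<phi>_mass x)"
    using primitive_eq[OF primitive_cong_AE[OF lagrange_identity[OF AC_with_derivative_cnj(1)[OF \<phi>(1)] \<phi>(1)] ae\<phi>] x]
    by (simp add: \<phi>_mass_def del: of_real_power)
  have "wronskian l ?\<psi> \<psi> x * wronskian l ?\<phi> \<phi> x =
     wronskian l \<psi> \<phi> x * cnj (wronskian l \<psi> \<phi> x) - wronskian l \<psi> ?\<phi> x * cnj (wronskian l \<psi> ?\<phi> x)"
    using AC_with_derivative_cnj(2)[OF \<phi>(1) x] AC_with_derivative_cnj(2)[OF \<psi>_AC x]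
    by (simp add: wronskian_def algebra_simps)
  then have "of_real (4 * (\<phi>_mass x * \<psi>_tail x)) = (of_real (1 - (cmod (wronskian l \<psi> ?\<phi> x))\<^sup>2) :: complex)"
    unfolding W\<psi> W\<phi> wronskian_\<psi>_\<phi>[OF x] complex_norm_square[symmetric] by (simp add: algebra_simps)
  then have "4 * (\<phi>_mass x * \<psi>_tail x) = 1 - (cmod (wronskian l \<psi> ?\<phi> x))\<^sup>2"
    by (simp only: of_real_eq_iff)
  then show ?thesis by simp
qed

lemma wronskian_prod_tendsto_0:
  assumes f: "f \<in> Dstar q l" and g: "g \<in> Dstar q l"
  shows "((\<lambda>x. wronskian l f \<psi> x * wronskian l g \<phi> x) \<longlongrightarrow> 0) at_top"
proof -
  define U where "U x = (LINT t|lebesgue_on {x..}. (cmod (sl_expr q l f t - \<i> * f t))\<^sup>2)" for x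
  have U: "(U \<longlongrightarrow> 0) at_top" unfolding U_def by (rule tail_tendsto_0[OF L2_remainder[OF f]])
  obtain C where C: "C > 0" "\<And>x. l \<le> x \<Longrightarrow> (cmod (wronskian l g \<phi> x))\<^sup>2 \<le> C * (1 + \<phi>_mass x)"
    using wronskian_\<phi>_bound[OF g] by blast
  have le: "(cmod (wronskian l f \<psi> x * wronskian l g \<phi> x))\<^sup>2 \<le> U x * (C * (L2_sq l \<psi> + 1))" if x: "l \<le> x" for x
  proof -
    have U0: "0 \<le> U x" by (simp add: U_def)
    have \<psi>_tail0: "0 \<le> \<psi>_tail x" by (simp add: \<psi>_tail_def)
    have \<psi>_tail1: "\<psi>_tail x \<le> L2_sq l \<psi>"
      using integral_Ici_split[of l "\<lambda>t. (cmod (\<psi> t))\<^sup>2", OF _ x] DstarD(2)[OF \<psi>(1)]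
      by (simp add: \<psi>_tail_def L2_sq_def L2_def)
    have "(cmod (wronskian l f \<psi> x * wronskian l g \<phi> x))\<^sup>2 = (cmod (wronskian l f \<psi> x))\<^sup>2 * (cmod (wronskian l g \<phi> x))\<^sup>2"
      by (simp add: norm_mult power_mult_distrib)
    also have "\<dots> \<le> (U x * \<psi>_tail x) * (C * (1 + \<phi>_mass x))"
      using wronskian_\<psi>_tendsto_0(2)[OF f x] C(2)[OF x] U0 \<psi>_tail0
      by (intro mult_mono) (auto simp: U_def)
    also have "\<dots> = U x * (C * (\<psi>_tail x + \<phi>_mass x * \<psi>_tail x))" by (simp add: algebra_simps)
    also have "\<dots> \<le> U x * (C * (L2_sq l \<psi> + 1))"
      using \<phi>_mass_\<psi>_tail_bound[OF x] \<psi>_tail1 C(1) U0 by (intro mult_left_mono) auto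
    finally show ?thesis .
  qed
  have "((\<lambda>x. U x * (C * (L2_sq l \<psi> + 1))) \<longlongrightarrow> 0) at_top"
    using tendsto_mult_left_zero[OF U] .
  moreover have "\<forall>\<^sub>F x in at_top. (cmod (wronskian l f \<psi> x * wronskian l g \<phi> x))\<^sup>2 \<le> U x * (C * (L2_sq l \<psi> + 1))"
    using eventually_ge_at_top[of l] by eventually_elim (rule le)
  ultimately have "((\<lambda>x. (cmod (wronskian l f \<psi> x * wronskian l g \<phi> x))\<^sup>2) \<longlongrightarrow> 0) at_top"
    by (intro tendsto_sandwich[OF always_eventually[OF allI[OF zero_le_power2]] _ tendsto_const])
  then have "((\<lambda>x. sqrt ((cmod (wronskian l f \<psi> x * wronskian l g \<phi> x))\<^sup>2)) \<longlongrightarrow> sqrt 0) at_top"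
    by (rule tendsto_real_sqrt)
  then show ?thesis by (simp add: tendsto_norm_zero_iff)
qed

text \<open>By the Pluecker relation \<open>W(f, g)\<close> is a combination of products \<open>W(f, \<psi>) W(g, \<phi>)\<close>. The square of
  the first factor is small compared with the tail of \<open>\<psi>\<close>, the square of the second is bounded by a multiple of
  one plus the mass of \<open>\<phi>\<close>, and the product of tail and mass is bounded.\<close>

theorem wronskian_tendsto_0:
  assumes f: "f \<in> Dstar q l" and g: "g \<in> Dstar q l"
  shows "(wronskian l f g \<longlongrightarrow> 0) at_top"
proof -
  have "((\<lambda>x. wronskian l g \<psi> x * wronskian l f \<phi> x - wronskian l f \<psi> x * wronskian l g \<phi> x) \<longlongrightarrow> 0 - 0) at_top"
    by (intro tendsto_diff wronskian_prod_tendsto_0 f g)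
  moreover have "\<forall>\<^sub>F x in at_top. wronskian l g \<psi> x * wronskian l f \<phi> x - wronskian l f \<psi> x * wronskian l g \<phi> x = wronskian l f g x"
    using eventually_ge_at_top[of l]
  proof eventually_elim
    case (elim x)
    have "wronskian l g \<psi> x * wronskian l f \<phi> x - wronskian l f \<psi> x * wronskian l g \<phi> x = - wronskian l \<psi> \<phi> x * wronskian l f g x"
      by (simp add: wronskian_def algebra_simps)
    then show ?case by (simp add: wronskian_\<psi>_\<phi>[OF elim])
  qed
  ultimately show ?thesis by (simp add: tendsto_cong)
qed

theorem green_formula:
  assumes f: "f \<in> Dstar q l" and g: "g \<in> Dstar q l"
  shows "L2_inner l (sl_expr q l f) g - L2_inner l f (sl_expr q l g) = der l f l * cnj (g l) - f l * cnj (der l g l)"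
proof -
  let ?g = "\<lambda>x. cnj (g x)"
  have gc: "?g \<in> Dstar q l" by (rule Dstar_cnj[OF g])
  define F where "F = (\<lambda>x. sl_expr q l f x * cnj (g x) - f x * cnj (sl_expr q l g x))"
  have i: "integrable (lebesgue_on {l..}) (\<lambda>x. sl_expr q l f x * cnj (g x))"
    "integrable (lebesgue_on {l..}) (\<lambda>x. f x * cnj (sl_expr q l g x))"
    using DstarD[OF f] DstarD[OF g] by (auto intro: L2_integrable_mult_cnj)
  then have Fi: "integrable (lebesgue_on {l..}) F" by (simp add: F_def)
  have "AE x in lebesgue_on {l..}. sl_expr q l f x * ?g x - f x * sl_expr q l ?g x = F x"
    using AC_with_derivative_cnj(3)[OF DstarD(1)[OF g], of q] by eventually_elim (simp add: F_def)
  note w = primitive_eq[OF primitive_cong_AE[OF lagrange_identity[OF DstarD(1)[OF f] DstarD(1)[OF gc]] this]]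
  have "((\<lambda>x. wronskian l f ?g l + (LINT t|lebesgue_on {l..x}. F t)) \<longlongrightarrow> wronskian l f ?g l + (LINT t|lebesgue_on {l..}. F t)) at_top"
    by (intro tendsto_add tendsto_const tendsto_integral_Ici Fi)
  moreover have "\<forall>\<^sub>F x in at_top. wronskian l f ?g l + (LINT t|lebesgue_on {l..x}. F t) = wronskian l f ?g x"
    using eventually_ge_at_top[of l] by eventually_elim (rule w[symmetric])
  ultimately have "(wronskian l f ?g \<longlongrightarrow> wronskian l f ?g l + (LINT t|lebesgue_on {l..}. F t)) at_top"
    by (rule Lim_transform_eventually)
  from tendsto_unique[OF _ wronskian_tendsto_0[OF f gc] this]
  have "wronskian l f ?g l + (LINT t|lebesgue_on {l..}. F t) = 0" by simp
  moreover have "(LINT t|lebesgue_on {l..}. F t) = L2_inner l (sl_expr q l f) g - L2_inner l f (sl_expr q l g)"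
    using i by (simp add: F_def L2_inner_def)
  ultimately show ?thesis
    using AC_with_derivative_cnj(2)[OF DstarD(1)[OF g] order_refl]
    by (simp add: wronskian_def algebra_simps add_eq_0_iff2)
qed

end

section \<open>Cutoff functions and moments\<close>

lemma has_real_derivative_max_0_power:
  "((\<lambda>u::real. (max 0 u) ^ Suc (Suc n)) has_real_derivative (real (Suc (Suc n)) * (max 0 u) ^ Suc n)) (at u)"
proof -
  consider "u < 0" | "u > 0" | "u = 0" by linarith
  then show ?thesis
  proof cases
    case 1
    have "((\<lambda>u. 0) has_real_derivative 0) (at u)" by simp
    from has_field_derivative_transform_within_open[OF this open_lessThan[of 0], of "\<lambda>u. (max 0 u) ^ Suc (Suc n)"] 1
    show ?thesis by simp
  next
    case 2
    have "((\<lambda>u. u ^ Suc (Suc n)) has_real_derivative (real (Suc (Suc n)) * u ^ Suc n)) (at u)"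
      using DERIV_power[OF DERIV_ident, of "Suc (Suc n)" u UNIV] by simp
    from has_field_derivative_transform_within_open[OF this open_greaterThan[of 0], of "\<lambda>u. (max 0 u) ^ Suc (Suc n)"] 2
    show ?thesis by (simp add: max_def)
  next
    case 3
    have "(\<lambda>h::real. max 0 h * (max 0 h ^ n * (max 0 h / h))) \<midarrow>0\<rightarrow> 0"
    proof (rule Lim_null_comparison)
      show "\<forall>\<^sub>F h in at 0. norm (max 0 h * (max 0 h ^ n * (max 0 h / h))) \<le> max 0 h"
        unfolding eventually_at
      proof (intro exI[of _ 1] conjI ballI impI)
        fix h :: real assume h: "h \<noteq> 0 \<and> dist h 0 < 1"
        then have "max 0 h ^ n \<le> 1" by (intro power_le_one) auto
        then show "norm (max 0 h * (max 0 h ^ n * (max 0 h / h))) \<le> max 0 h"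
          using h by (auto simp: max_def mult_left_le)
      qed simp
      show "(max 0 \<longlongrightarrow> 0) (at (0::real))"
        using tendsto_max[OF tendsto_const tendsto_ident_at, of 0 "0::real" UNIV] by simp
    qed
    then show ?thesis using 3 by (simp add: has_field_derivative_iff mult_ac)
  qed
qed

text \<open>Powers of the positive part of \<open>b - x\<close> serve as cutoffs because their derivatives are of the same kind. The
  cube has an absolutely continuous derivative.\<close>

definition cutoff :: "real \<Rightarrow> nat \<Rightarrow> real \<Rightarrow> complex" where
  "cutoff b n x = of_real ((max 0 (b - x)) ^ n)"

lemma cutoff_has_vector_derivative:
  "(cutoff b (Suc (Suc n)) has_vector_derivative - (of_nat (Suc (Suc n)) * cutoff b (Suc n) x)) (at x within S)"
proof -
  have "((\<lambda>x. (max 0 (b - x)) ^ Suc (Suc n)) has_real_derivative (real (Suc (Suc n)) * (max 0 (b - x)) ^ Suc n) * (0 - 1)) (at x)"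
    by (rule DERIV_chain2[OF has_real_derivative_max_0_power]) (intro derivative_intros)
  then have "((\<lambda>x. (max 0 (b - x)) ^ Suc (Suc n)) has_real_derivative - (real (Suc (Suc n)) * (max 0 (b - x)) ^ Suc n)) (at x within S)"
    by (auto intro: has_field_derivative_at_within)
  then have "((\<lambda>x. complex_of_real ((max 0 (b - x)) ^ Suc (Suc n))) has_vector_derivative of_real (- (real (Suc (Suc n)) * (max 0 (b - x)) ^ Suc n))) (at x within S)"
    by (intro has_vector_derivative_of_real) (simp add: has_real_derivative_iff_has_vector_derivative)
  then show ?thesis by (simp add: cutoff_def[abs_def])
qed

lemma continuous_on_cutoff: "continuous_on S (cutoff b n)"
  unfolding cutoff_def[abs_def] by (intro continuous_intros)

lemma cutoff_zero: "b \<le> x \<Longrightarrow> n > 0 \<Longrightarrow> cutoff b n x = 0"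
  by (simp add: cutoff_def)

lemma norm_cutoff: "x \<le> b \<Longrightarrow> cmod (cutoff b n x) = (b - x) ^ n"
  unfolding cutoff_def norm_of_real by simp

lemma L2_of_bounded_support:
  assumes c: "continuous_on {l..} g" and z: "\<And>x. b \<le> x \<Longrightarrow> g x = 0"
  shows "g \<in> L2 l"
proof -
  have "integrable (lebesgue_on {l..b}) (\<lambda>x. (cmod (g x))\<^sup>2)"
    by (intro continuous_imp_integrable_real continuous_intros continuous_on_subset[OF c]) auto
  then have "integrable lebesgue (\<lambda>x. indicator {l..b} x *\<^sub>R (cmod (g x))\<^sup>2)"
    by (simp add: integrable_restrict_space)
  also have "(\<lambda>x. indicator {l..b} x *\<^sub>R (cmod (g x))\<^sup>2) = (\<lambda>x. indicator {l..} x *\<^sub>R (cmod (g x))\<^sup>2)"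
    using z by (auto simp: indicator_def fun_eq_iff)
  finally have "integrable (lebesgue_on {l..}) (\<lambda>x. (cmod (g x))\<^sup>2)"
    by (simp add: integrable_restrict_space)
  then show ?thesis
    using continuous_imp_measurable_on_sets_lebesgue[OF c] by (simp add: L2_def)
qed

text \<open>A cutoff times an arbitrary smooth function need not lie in \<open>D\<^sup>*\<close>, as \<open>q\<close> is merely locally summable. A cutoff
  times a solution for \<open>0\<close> does: the term with \<open>q\<close> disappears.\<close>

definition bump :: "real \<Rightarrow> real \<Rightarrow> (real \<Rightarrow> complex) \<Rightarrow> real \<Rightarrow> complex" where
  "bump l b f = left_zero l (\<lambda>x. cutoff b 3 x * f x)"

lemma bump:
  assumes f: "AC_with_derivative l f" "AE x in lebesgue_on {l..}. sl_expr q l f x = 0"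
  shows "bump l b f \<in> Dstar q l"
    and "\<And>x. l \<le> x \<Longrightarrow> bump l b f x = cutoff b 3 x * f x"
    and "der l (bump l b f) l = - 3 * cutoff b 2 l * f l + cutoff b 3 l * der l f l"
    and "AE x in lebesgue_on {l..}. sl_expr q l (bump l b f) x =
           - 6 * cutoff b 1 x * f x + 6 * cutoff b 2 x * der l f x"
proof -
  have 3: "(cutoff b 3 has_vector_derivative - 3 * cutoff b 2 x) (at x within {l..})" for x
    using cutoff_has_vector_derivative[of b 1 x] by (simp add: numeral_eq_Suc)
  have "(cutoff b 2 has_vector_derivative - 2 * cutoff b 1 x) (at x within {l..})" for x
    using cutoff_has_vector_derivative[of b 0 x] by (simp add: numeral_eq_Suc)
  then have "primitive l (\<lambda>x. - 2 * cutoff b 1 x) (cutoff b 2)"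
    by (intro primitive_of_continuous_derivative continuous_intros continuous_on_cutoff)
  then have "primitive l (\<lambda>x. - 3 * (- 2 * cutoff b 1 x)) (\<lambda>x. - 3 * cutoff b 2 x)"
    by (rule primitive_cmult)
  then have 2: "primitive l (\<lambda>x. 6 * cutoff b 1 x) (\<lambda>x. - 3 * cutoff b 2 x)" by simp
  note v = AC_with_derivative_mult_smooth[OF 3 2 f(1)]
  have cf: "continuous_on {l..} f" and cd: "continuous_on {l..} (der l f)"
    using primitive_continuous_on primitive_der[OF f(1)] primitive_der_der[OF f(1)] by blast+
  have L: "(\<lambda>x. cutoff b 3 x * f x) \<in> L2 l"
    by (rule L2_of_bounded_support[of _ _ b]) (auto intro!: continuous_intros continuous_on_cutoff cf simp: cutoff_zero)
  have L': "(\<lambda>x. - 6 * cutoff b 1 x * f x + 6 * cutoff b 2 x * der l f x) \<in> L2 l"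
    by (rule L2_of_bounded_support[of _ _ b]) (auto intro!: continuous_intros continuous_on_cutoff cf cd simp: cutoff_zero)
  have ae: "AE x in lebesgue_on {l..}. sl_expr q l (\<lambda>x. cutoff b 3 x * f x) x = - 6 * cutoff b 1 x * f x + 6 * cutoff b 2 x * der l f x"
    using v(3)[of q] f(2) by eventually_elim simp
  show "bump l b f \<in> Dstar q l"
    unfolding bump_def by (rule left_zero_in_Dstar[OF v(1) L L' ae])
  show "bump l b f x = cutoff b 3 x * f x" if "l \<le> x" for x
    using that by (simp add: bump_def)
  show "der l (bump l b f) l = - 3 * cutoff b 2 l * f l + cutoff b 3 l * der l f l"
    unfolding bump_def using AC_with_derivative_left_zero(2)[OF v(1) order_refl] v(2)[OF order_refl] by simp
  show "AE x in lebesgue_on {l..}. sl_expr q l (bump l b f) x = - 6 * cutoff b 1 x * f x + 6 * cutoff b 2 x * der l f x"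
    unfolding bump_def using AC_with_derivative_left_zero(3)[OF v(1), of q] ae by eventually_elim simp
qed

lemma primitive_unique_AE:
  assumes "primitive l F f" "primitive l G f"
  shows "AE x in lebesgue_on {l..}. F x = G x"
  using der_eq_AE[OF assms(1)] der_eq_AE[OF assms(2)] by eventually_elim simp

lemma continuous_AE_eq:
  fixes f g :: "real \<Rightarrow> complex"
  assumes "continuous_on {l..} f" "continuous_on {l..} g" "AE x in lebesgue_on {l..}. f x = g x" "l \<le> x"
  shows "f x = g x"
proof -
  have "AE x in lebesgue_on {l..}. f x - g x = 0" using assms(3) by eventually_elim simp
  from continuous_AE_zero[OF continuous_on_diff[OF assms(1,2)] this assms(4)] show ?thesis by simp
qed

lemma primitive_indefinite:
  assumes "\<And>b. l \<le> b \<Longrightarrow> integrable (lebesgue_on {l..b}) F"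
  shows "primitive l F (\<lambda>x. LINT t|lebesgue_on {l..x}. F t)" and "(LINT t|lebesgue_on {l..l}. F t) = 0"
proof -
  show z: "(LINT t|lebesgue_on {l..l}. F t) = 0"
    using lebesgue_integral_eq_integral[of "{l..l}" F] assms[of l] by simp
  show "primitive l F (\<lambda>x. LINT t|lebesgue_on {l..x}. F t)"
    unfolding primitive_def using assms z by simp
qed

lemma primitive_power: "primitive l (\<lambda>x. of_nat (Suc n) * of_real (x - c) ^ n) (\<lambda>x. of_real (x - c) ^ Suc n)"
proof (rule primitive_of_continuous_derivative)
  fix x
  have "((\<lambda>x. (x - c) ^ Suc n) has_real_derivative (real (Suc n) * (x - c) ^ n)) (at x within {l..})"
  proof -
    have "((\<lambda>x. x - c) has_real_derivative 1) (at x within {l..})"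
      by (auto intro!: derivative_eq_intros)
    from DERIV_power_Suc[OF this, of n] show ?thesis by simp
  qed
  then have "((\<lambda>x. complex_of_real ((x - c) ^ Suc n)) has_vector_derivative of_real (real (Suc n) * (x - c) ^ n)) (at x within {l..})"
    by (intro has_vector_derivative_of_real) (simp add: has_real_derivative_iff_has_vector_derivative)
  then show "((\<lambda>x. complex_of_real (x - c) ^ Suc n) has_vector_derivative of_nat (Suc n) * of_real (x - c) ^ n) (at x within {l..})"
    by simp
qed (intro continuous_intros)

text \<open>Integration by parts; both boundary terms vanish, at \<open>l\<close> because of \<open>G1\<close> and at \<open>b\<close> because of the power.\<close>

lemma moment_by_parts:
  fixes G :: "real \<Rightarrow> complex"
  assumes pG: "primitive l G G1" and G1l: "G1 l = 0" and b: "l \<le> b"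
  shows "(LINT x|lebesgue_on {l..b}. of_real (b - x) ^ Suc n * G x) =
    of_nat (Suc n) * (LINT x|lebesgue_on {l..b}. of_real (b - x) ^ n * G1 x)"
proof -
  have "primitive l (\<lambda>x. (- 1) ^ Suc n * (of_nat (Suc n) * of_real (x - b) ^ n)) (\<lambda>x. (- 1) ^ Suc n * of_real (x - b) ^ Suc n)"
    by (rule primitive_cmult[OF primitive_power])
  moreover have "(- 1) ^ Suc n * of_real (x - b) ^ Suc n = (of_real (b - x) :: complex) ^ Suc n" for x
    unfolding power_mult_distrib[symmetric] by simp
  moreover have "(- 1) ^ Suc n * (of_nat (Suc n) * of_real (x - b) ^ n) = - of_nat (Suc n) * (of_real (b - x) :: complex) ^ n" for x
  proof -
    have "(- 1) ^ n * of_real (x - b) ^ n = (of_real (b - x) :: complex) ^ n"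
      unfolding power_mult_distrib[symmetric] by simp
    then show ?thesis by (simp add: algebra_simps)
  qed
  ultimately have p: "primitive l (\<lambda>x. - of_nat (Suc n) * of_real (b - x) ^ n) (\<lambda>x. of_real (b - x) ^ Suc n)"
    by simp
  have cG: "continuous_on {l..} G1" by (rule primitive_continuous_on[OF pG])
  have cp: "continuous_on {l..b} (\<lambda>x. of_real (b - x) ^ n * G1 x)"
    by (intro continuous_intros continuous_on_subset[OF cG]) auto
  have i1: "integrable (lebesgue_on {l..b}) (\<lambda>x. of_real (b - x) ^ n * G1 x)"
    by (rule continuous_imp_integrable_real[OF cp])
  have pm: "primitive l (\<lambda>x. (- of_nat (Suc n) * of_real (b - x) ^ n) * G1 x + of_real (b - x) ^ Suc n * G x)
     (\<lambda>x. of_real (b - x) ^ Suc n * G1 x)"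
    by (rule primitive_mult[OF p pG])
  then have "integrable (lebesgue_on {l..b}) (\<lambda>x. (- of_nat (Suc n) * of_real (b - x) ^ n) * G1 x + of_real (b - x) ^ Suc n * G x)"
    using b unfolding primitive_def by blast
  from Bochner_Integration.integrable_add[OF this integrable_mult_right[OF i1, of "of_nat (Suc n)"]]
  have i2: "integrable (lebesgue_on {l..b}) (\<lambda>x. of_real (b - x) ^ Suc n * G x)"
    by (simp add: algebra_simps)
  have "0 = (LINT x|lebesgue_on {l..b}. (- of_nat (Suc n) * of_real (b - x) ^ n) * G1 x + of_real (b - x) ^ Suc n * G x)"
    using primitive_eq[OF pm b] by (simp add: G1l del: of_nat_Suc)
  also have "\<dots> = (LINT x|lebesgue_on {l..b}. - of_nat (Suc n) * (of_real (b - x) ^ n * G1 x) + of_real (b - x) ^ Suc n * G x)"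
    by (simp only: mult.assoc)
  also have "\<dots> = - of_nat (Suc n) * (LINT x|lebesgue_on {l..b}. of_real (b - x) ^ n * G1 x) + (LINT x|lebesgue_on {l..b}. of_real (b - x) ^ Suc n * G x)"
    using i1 i2 by (subst Bochner_Integration.integral_add) (simp_all del: power_Suc of_nat_Suc)
  finally show ?thesis by (simp add: eq_neg_iff_add_eq_0 del: power_Suc of_nat_Suc)
qed

text \<open>Each integration by parts replaces \<open>G\<close> by its indefinite integral and lowers the exponent by one. At exponent
  zero the hypothesis says that an iterated integral of \<open>G\<close> is a power, and differentiating back shows that \<open>G\<close>
  is one, too.\<close>

lemma moments_determine:
  fixes G :: "real \<Rightarrow> complex"
  assumes "\<And>b. l \<le> b \<Longrightarrow> integrable (lebesgue_on {l..b}) G"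
    and "\<And>b. l \<le> b \<Longrightarrow> (LINT x|lebesgue_on {l..b}. of_real (b - x) ^ n * G x) = K * of_real (b - l) ^ (n + Suc k)"
  shows "\<exists>c. AE x in lebesgue_on {l..}. G x = c * of_real (x - l) ^ k"
  using assms
proof (induction n arbitrary: G k K)
  case 0
  note p = primitive_indefinite[OF 0(1)]
  have "primitive l G (\<lambda>x. K * of_real (x - l) ^ Suc k)"
    by (rule primitive_cong[OF p(1)]) (use 0(2) in simp_all)
  from primitive_unique_AE[OF this primitive_cmult[OF primitive_power]]
  have "AE x in lebesgue_on {l..}. G x = (K * of_nat (Suc k)) * of_real (x - l) ^ k"
    by eventually_elim simp
  then show ?case by blast
next
  case (Suc n)
  define G1 where "G1 = (\<lambda>x. LINT t|lebesgue_on {l..x}. G t)"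
  note p = primitive_indefinite[OF Suc.prems(1), folded G1_def]
  have G1l: "G1 l = 0" using p(2) by (simp add: G1_def)
  have cG: "continuous_on {l..} G1" by (rule primitive_continuous_on[OF p(1)])
  have "(LINT x|lebesgue_on {l..b}. of_real (b - x) ^ n * G1 x) = (K / of_nat (Suc n)) * of_real (b - l) ^ (n + Suc (Suc k))"
    if "l \<le> b" for b
  proof -
    have "of_nat (Suc n) * (LINT x|lebesgue_on {l..b}. of_real (b - x) ^ n * G1 x) = K * of_real (b - l) ^ (Suc n + Suc k)"
      using moment_by_parts[OF p(1) G1l that, of n] Suc.prems(2)[OF that] by simp
    then show ?thesis by (simp add: field_simps del: of_nat_Suc)
  qed
  moreover have "integrable (lebesgue_on {l..b}) G1" if "l \<le> b" for b
    by (intro continuous_imp_integrable_real continuous_on_subset[OF cG]) auto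
  ultimately obtain c where c: "AE x in lebesgue_on {l..}. G1 x = c * of_real (x - l) ^ Suc k"
    using Suc.IH by blast
  have "G1 x = c * of_real (x - l) ^ Suc k" if "l \<le> x" for x
    by (rule continuous_AE_eq[OF cG _ c that]) (intro continuous_intros)
  then have "primitive l G (\<lambda>x. c * of_real (x - l) ^ Suc k)"
    by (intro primitive_cong[OF p(1)]) blast
  from primitive_unique_AE[OF this primitive_cmult[OF primitive_power]]
  have "AE x in lebesgue_on {l..}. G x = (c * of_nat (Suc k)) * of_real (x - l) ^ k"
    by eventually_elim simp
  then show ?case by blast
qed

text \<open>After one integration by parts the previous lemma applies with degree zero: the indefinite integral of \<open>G\<close> is
  constant. It vanishes at \<open>l\<close>, so it is zero.\<close>

lemma moments_zero:
  fixes G :: "real \<Rightarrow> complex"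
  assumes G: "\<And>b. l \<le> b \<Longrightarrow> integrable (lebesgue_on {l..b}) G"
    and K: "\<And>b. l \<le> b \<Longrightarrow> (LINT x|lebesgue_on {l..b}. of_real (b - x) ^ Suc n * G x) = K * of_real (b - l) ^ Suc n"
  shows "AE x in lebesgue_on {l..}. G x = 0"
proof -
  define G1 where "G1 = (\<lambda>x. LINT t|lebesgue_on {l..x}. G t)"
  note p = primitive_indefinite[OF G, folded G1_def]
  have G1l: "G1 l = 0" using p(2) by (simp add: G1_def)
  have cG: "continuous_on {l..} G1" by (rule primitive_continuous_on[OF p(1)])
  have "(LINT x|lebesgue_on {l..b}. of_real (b - x) ^ n * G1 x) = (K / of_nat (Suc n)) * of_real (b - l) ^ (n + Suc 0)"
    if "l \<le> b" for b
  proof -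
    have "of_nat (Suc n) * (LINT x|lebesgue_on {l..b}. of_real (b - x) ^ n * G1 x) = K * of_real (b - l) ^ Suc n"
      using moment_by_parts[OF p(1) G1l that, of n] K[OF that] by simp
    then show ?thesis by (simp add: field_simps del: of_nat_Suc)
  qed
  moreover have "integrable (lebesgue_on {l..b}) G1" if "l \<le> b" for b
    by (intro continuous_imp_integrable_real continuous_on_subset[OF cG]) auto
  ultimately obtain c where c: "AE x in lebesgue_on {l..}. G1 x = c * of_real (x - l) ^ 0"
    using moments_determine by blast
  have G1: "G1 x = c * of_real (x - l) ^ 0" if "l \<le> x" for x
    by (rule continuous_AE_eq[OF cG _ c that]) (intro continuous_intros)
  have "c = 0" using G1[of l] G1l by simp
  then have "G1 x = 0" if "l \<le> x" for x using G1[OF that] by simp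
  then have "primitive l G (\<lambda>x. 0)"
    by (intro primitive_cong[OF p(1)])
  from primitive_unique_AE[OF this primitive_const] show ?thesis .
qed

section \<open>The energy form\<close>

locale weyl_problem =
  fixes q :: "real \<Rightarrow> real" and l :: real
    and \<phi>1 \<phi>2 :: "complex \<Rightarrow> real \<Rightarrow> complex" and minf :: "complex \<Rightarrow> complex" and m :: real
  assumes deficiency: "deficiency_index q l \<i> = 1"
    and nonneg: "nonnegative_op l (minimal_op q l)"
    and fundamental: "fundamental_solutions q l \<phi>1 \<phi>2"
    and weyl: "weyl_function l \<phi>1 \<phi>2 minf"
    and m_limit: "((\<lambda>t::real. minf (complex_of_real t)) \<longlongrightarrow> complex_of_real m) (at_left 0)"
begin

definition \<psi> :: "complex \<Rightarrow> real \<Rightarrow> complex" where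
  "\<psi> z = left_zero l (\<lambda>x. \<phi>2 z x + minf z * \<phi>1 z x)"

lemma solution_\<phi>:
  "AC_with_derivative l (\<phi>1 z)" "AE x in lebesgue_on {l..}. sl_expr q l (\<phi>1 z) x = z * \<phi>1 z x"
  "\<phi>1 z l = 0" "der l (\<phi>1 z) l = 1"
  "AC_with_derivative l (\<phi>2 z)" "AE x in lebesgue_on {l..}. sl_expr q l (\<phi>2 z) x = z * \<phi>2 z x"
  "\<phi>2 z l = -1" "der l (\<phi>2 z) l = 0"
  using fundamental by (auto simp: fundamental_solutions_def sl_solution_def)

lemma \<psi>:
  assumes "z \<notin> \<real>\<^sub>\<ge>\<^sub>0"
  shows "\<psi> z \<in> Dstar q l" and "AE x in lebesgue_on {l..}. sl_expr q l (\<psi> z) x = z * \<psi> z x"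
    and "\<psi> z l = -1" and "der l (\<psi> z) l = minf z"
proof -
  define f where "f = (\<lambda>x. 1 * \<phi>2 z x + minf z * \<phi>1 z x)"
  have fL: "f \<in> L2 l" using weyl assms by (simp add: weyl_function_def f_def)
  note f = AC_with_derivative_lincomb(1,2)[OF solution_\<phi>(5)[of z] solution_\<phi>(1)[of z], where a=1 and b="minf z", folded f_def]
    AC_with_derivative_lincomb(3)[OF solution_\<phi>(5)[of z] solution_\<phi>(1)[of z], where a=1 and b="minf z" and q=q, folded f_def]
  have ae: "AE x in lebesgue_on {l..}. sl_expr q l f x = z * f x"
    using f(3) solution_\<phi>(2)[of z] solution_\<phi>(6)[of z] by eventually_elim (simp add: f_def algebra_simps)
  have eq: "\<psi> z = left_zero l f" by (simp add: \<psi>_def f_def)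
  show "\<psi> z \<in> Dstar q l"
    unfolding eq by (rule left_zero_in_Dstar[OF f(1) fL L2_cmult[OF fL] ae])
  have "AE x in lebesgue_on {l..}. x \<in> {l..}" by (rule AE_I2) simp
  then show "AE x in lebesgue_on {l..}. sl_expr q l (\<psi> z) x = z * \<psi> z x"
    unfolding eq using AC_with_derivative_left_zero(3)[OF f(1), of q] ae by eventually_elim simp
  show "\<psi> z l = -1" unfolding eq by (simp add: f_def solution_\<phi>)
  show "der l (\<psi> z) l = minf z"
    unfolding eq using AC_with_derivative_left_zero(2)[OF f(1) order_refl] f(2)[OF order_refl] by (simp add: solution_\<phi>)
qed

lemma i_notin [simp]: "\<i> \<notin> \<real>\<^sub>\<ge>\<^sub>0" "- \<i> \<notin> \<real>\<^sub>\<ge>\<^sub>0"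
  by (auto simp: complex_nonneg_Reals_iff)

lemma neg_notin: "t < 0 \<Longrightarrow> complex_of_real t \<notin> \<real>\<^sub>\<ge>\<^sub>0"
  by (auto simp: complex_nonneg_Reals_iff)

text \<open>Otherwise the kernel would contain two functions that are independent because of their data at \<open>l\<close>, and its
  dimension would not be one.\<close>

lemma \<phi>1_not_L2: "\<phi>1 \<i> \<notin> L2 l"
proof
  assume L: "\<phi>1 \<i> \<in> L2 l"
  define \<phi> where "\<phi> = left_zero l (\<phi>1 \<i>)"
  note s = solution_\<phi>[of \<i>]
  have "\<phi> \<in> Dstar q l"
    unfolding \<phi>_def by (rule left_zero_in_Dstar[OF s(1) L L2_cmult[OF L] s(2)])
  moreover have "AE x in lebesgue_on {l..}. x \<in> {l..}" by (rule AE_I2) simp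
  then have "AE x in lebesgue_on {l..}. sl_expr q l \<phi> x = \<i> * \<phi> x"
    unfolding \<phi>_def using AC_with_derivative_left_zero(3)[OF s(1), of q] s(2) by eventually_elim simp
  ultimately have \<phi>S: "\<phi> \<in> {y \<in> Dstar q l. AE x in lebesgue_on {l..}. sl_expr q l y x = \<i> * y x}" (is "_ \<in> ?S") by simp
  have \<psi>S: "\<psi> \<i> \<in> ?S" using \<psi>[of \<i>] by simp
  interpret vs: vector_space "\<lambda>(c::complex) (f :: real \<Rightarrow> complex) x. c * f x"
    by unfold_locales (auto simp: fun_eq_iff algebra_simps)
  obtain B where B: "B \<subseteq> ?S" "vs.independent B" "?S \<subseteq> vs.span B" "card B = vs.dim ?S"
    using vs.basis_exists by blast
  then have "card B = 1" using deficiency by (simp add: deficiency_index_def)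
  then obtain b where b: "B = {b}" by (auto simp: card_1_singleton_iff)
  obtain c1 c2 where c: "\<phi> = (\<lambda>x. c1 * b x)" "\<psi> \<i> = (\<lambda>x. c2 * b x)"
    using \<phi>S \<psi>S B(3) unfolding b vs.span_singleton by blast
  have "c2 * b l = -1" using \<psi>(3)[of \<i>] c(2) by simp
  moreover have "c1 * b l = 0" using c(1) s(3) by (metis \<phi>_def left_zero_simp order_refl)
  ultimately have "c1 = 0" by auto
  then have "\<phi> = (\<lambda>x. 0)" using c(1) by simp
  moreover have "((\<lambda>x. 0 :: complex) has_vector_derivative 0) (at l within {l..})" by simp
  then have "der l (\<lambda>x. 0) l = 0" by (rule der_eqI) simp
  ultimately show False
    using AC_with_derivative_left_zero(2)[OF s(1) order_refl] s(4) by (simp add: \<phi>_def)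
qed

sublocale lp: limit_point q l "\<phi>1 \<i>" "\<psi> \<i>"
  using solution_\<phi>[of \<i>] \<psi>[of \<i>] \<phi>1_not_L2 by unfold_locales auto

text \<open>Formally, after an integration by parts, the integral of \<open>f' cnj g' + q f cnj g\<close>.\<close>

definition form :: "(real \<Rightarrow> complex) \<Rightarrow> (real \<Rightarrow> complex) \<Rightarrow> complex" where
  "form f g = L2_inner l (sl_expr q l f) g - der l f l * cnj (g l)"

definition qform :: "(real \<Rightarrow> complex) \<Rightarrow> real" where
  "qform f = Re (form f f)"

text \<open>This is where the limit point case enters: the form is Hermitian because Green's formula has no
  contribution from infinity.\<close>

lemma form_commute:
  assumes "f \<in> Dstar q l" "g \<in> Dstar q l"
  shows "form g f = cnj (form f g)"
proof -
  have "L2_inner l f (sl_expr q l g) = form f g + f l * cnj (der l g l)"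
    using lp.green_formula[OF assms] by (simp add: form_def algebra_simps)
  then show ?thesis
    using L2_inner_commute[of l "sl_expr q l g" f] by (simp add: form_def[of g f] mult.commute)
qed

lemma form_self:
  assumes "f \<in> Dstar q l"
  shows "form f f = of_real (qform f)"
  using form_commute[OF assms assms] by (metis qform_def complex_is_Real_iff Reals_cnj_iff of_real_Re)

lemma form_lincomb_left:
  assumes f: "f \<in> Dstar q l" and g: "g \<in> Dstar q l" and h: "h \<in> Dstar q l"
  shows "form (\<lambda>x. a * f x + b * g x) h = a * form f h + b * form g h"
proof -
  note fg = AC_with_derivative_lincomb(1,2)[OF DstarD(1)[OF f] DstarD(1)[OF g], where a=a and b=b]
    AC_with_derivative_lincomb(3)[OF DstarD(1)[OF f] DstarD(1)[OF g], where a=a and b=b and q=q]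
  have ae: "AE x in lebesgue_on {l..}. a * sl_expr q l f x + b * sl_expr q l g x = sl_expr q l (\<lambda>x. a * f x + b * g x) x"
    using fg(3) by eventually_elim simp
  have "L2_inner l (sl_expr q l (\<lambda>x. a * f x + b * g x)) h = a * L2_inner l (sl_expr q l f) h + b * L2_inner l (sl_expr q l g) h"
    using L2_inner_cong_AE[OF L2_lincomb[OF DstarD(3)[OF f] DstarD(3)[OF g]] DstarD(2)[OF h] ae]
      L2_inner_lincomb_left[OF DstarD(3)[OF f] DstarD(3)[OF g] DstarD(2)[OF h]] by simp
  then show ?thesis
    by (simp add: form_def fg(2) algebra_simps)
qed

lemma form_lincomb_right:
  assumes f: "f \<in> Dstar q l" and g: "g \<in> Dstar q l" and h: "h \<in> Dstar q l"
  shows "form h (\<lambda>x. a * f x + b * g x) = cnj a * form h f + cnj b * form h g"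
  using form_commute[OF Dstar_lincomb[OF f g] h, of a b] form_lincomb_left[OF f g h, of a b]
    form_commute[OF f h] form_commute[OF g h] by simp

lemma Dstar_add_cmult: "f \<in> Dstar q l \<Longrightarrow> g \<in> Dstar q l \<Longrightarrow> (\<lambda>x. f x + c * g x) \<in> Dstar q l"
  using Dstar_lincomb[of f q l g 1 c] by simp

lemma der_add_cmult: "f \<in> Dstar q l \<Longrightarrow> g \<in> Dstar q l \<Longrightarrow> der l (\<lambda>x. f x + c * g x) l = der l f l + c * der l g l"
  using AC_with_derivative_lincomb(2)[OF DstarD(1) DstarD(1), of f q l g q l 1 c] by simp

lemma qform_add_cmult:
  assumes f: "f \<in> Dstar q l" and g: "g \<in> Dstar q l"
  shows "qform (\<lambda>x. f x + c * g x) = qform f + 2 * Re (cnj c * form f g) + (cmod c)\<^sup>2 * qform g"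
proof -
  have "form (\<lambda>x. 1 * f x + c * g x) (\<lambda>x. 1 * f x + c * g x) =
     form f f + c * form g f + (cnj c * form f g + cnj c * c * form g g)"
    using f g Dstar_lincomb[OF f g, of 1 c]
    by (simp only: form_lincomb_left form_lincomb_right) (simp add: algebra_simps)
  also have "cnj c * c * form g g = of_real ((cmod c)\<^sup>2 * qform g)"
    by (simp add: form_self[OF g] complex_norm_square mult.commute del: of_real_power)
  also have "c * form g f = cnj (cnj c * form f g)"
    by (simp add: form_commute[OF f g])
  finally have "Re (form (\<lambda>x. 1 * f x + c * g x) (\<lambda>x. 1 * f x + c * g x)) =
     qform f + Re (cnj c * form f g) + (Re (cnj c * form f g) + (cmod c)\<^sup>2 * qform g)"
    by (simp add: qform_def)
  then show ?thesis by (simp add: qform_def)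
qed

lemma qform_minimal_nonneg:
  assumes "f \<in> Dstar q l" "f l = 0" "der l f l = 0"
  shows "0 \<le> qform f"
proof -
  have "(f, sl_expr q l f) \<in> minimal_op q l"
    using assms DstarD(3)[OF assms(1)] by (simp add: minimal_op_def sl_op_def)
  then have "L2_inner l (sl_expr q l f) f \<in> \<real>\<^sub>\<ge>\<^sub>0"
    using nonneg unfolding nonnegative_op_def by blast
  then show ?thesis using assms by (simp add: qform_def form_def complex_nonneg_Reals_iff)
qed

end

section \<open>The sharp lower bound of the form\<close>

lemma norm_integral_le_of_support:
  fixes F :: "real \<Rightarrow> complex"
  assumes F: "integrable (lebesgue_on {l..}) F" and b: "l \<le> b"
    and le: "AE x in lebesgue_on {l..}. cmod (F x) \<le> K * indicator {l..b} x"
  shows "cmod (LINT x|lebesgue_on {l..}. F x) \<le> K * (b - l)"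
proof -
  have eq: "(\<lambda>x. indicator {l..} x *\<^sub>R (K * indicator {l..b} x)) = (\<lambda>x. K * indicat_real {l..b} x)"
    by (auto simp: indicator_def)
  have i: "integrable (lebesgue_on {l..}) (\<lambda>x. K * indicat_real {l..b} x)"
    by (subst integrable_restrict_space)
      (simp, unfold eq, intro integrable_mult_right integrable_real_indicator, use b in simp_all)
  have "cmod (LINT x|lebesgue_on {l..}. F x) \<le> (LINT x|lebesgue_on {l..}. cmod (F x))"
    by (rule integral_norm_bound)
  also have "\<dots> \<le> (LINT x|lebesgue_on {l..}. K * indicat_real {l..b} x)"
    by (intro integral_mono_AE integrable_norm F i le)
  also have "\<dots> = K * (b - l)"
    using b by (subst integral_restrict_space) (simp, unfold eq, simp)
  finally show ?thesis .
qed

context weyl_problem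
begin

lemma qform_cmult:
  assumes "f \<in> Dstar q l"
  shows "(\<lambda>x. c * f x) \<in> Dstar q l" "qform (\<lambda>x. c * f x) = (cmod c)\<^sup>2 * qform f"
    "der l (\<lambda>x. c * f x) l = c * der l f l"
proof -
  show D: "(\<lambda>x. c * f x) \<in> Dstar q l" using Dstar_lincomb[OF assms assms, of c 0] by simp
  have "form (\<lambda>x. c * f x) (\<lambda>x. c * f x) = c * cnj c * form f f"
    using form_lincomb_left[OF assms assms D, of c 0] form_lincomb_right[OF assms assms assms, of c 0] by simp
  also have "\<dots> = of_real ((cmod c)\<^sup>2 * qform f)"
    by (simp add: form_self[OF assms] complex_norm_square[symmetric] del: of_real_power)
  finally show "qform (\<lambda>x. c * f x) = (cmod c)\<^sup>2 * qform f" by (simp add: qform_def)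
  show "der l (\<lambda>x. c * f x) l = c * der l f l"
    using AC_with_derivative_lincomb(2)[OF DstarD(1)[OF assms] DstarD(1)[OF assms], of l c 0] by simp
qed

text \<open>The derivative at the endpoint is not controlled by the form. A solution that vanishes at \<open>l\<close> with slope one,
  cut off at distance \<open>\<epsilon>\<close>, is of size \<open>\<epsilon>\<close> on an interval of length \<open>\<epsilon>\<close>, and its Sturm-Liouville expression
  is of size \<open>1 / \<epsilon>\<close>. So the form is of order \<open>\<epsilon>\<close> and the squared norm of order \<open>\<epsilon>\<^sup>3\<close>.\<close>

lemma small_bumps:
  obtains \<eta> :: "nat \<Rightarrow> real \<Rightarrow> complex"
  where "\<And>n. \<eta> n \<in> Dstar q l" "\<And>n. \<eta> n l = 0" "\<And>n. der l (\<eta> n) l = 1"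
    "(\<lambda>n. L2_sq l (\<eta> n)) \<longlonglongrightarrow> 0" "(\<lambda>n. qform (\<eta> n)) \<longlonglongrightarrow> 0"
proof -
  let ?f = "\<phi>1 0"
  note f_AC = solution_\<phi>(1)[of 0]
  have f0: "AE x in lebesgue_on {l..}. sl_expr q l ?f x = 0"
    using solution_\<phi>(2)[of 0] by simp
  have cd: "continuous_on {l..} (der l ?f)" and cf: "continuous_on {l..} ?f"
    using primitive_continuous_on primitive_der[OF f_AC] primitive_der_der[OF f_AC] by blast+
  obtain d where d: "d > 0" "\<And>x. l \<le> x \<Longrightarrow> dist x l < d \<Longrightarrow> dist (der l ?f x) (der l ?f l) < 1"
    using cd unfolding continuous_on_iff by (metis atLeast_iff order_refl zero_less_one)
  have d2: "cmod (der l ?f x) \<le> 2" if "l \<le> x" "x < l + d" for x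
  proof -
    have "cmod (der l ?f x - 1) < 1" using d(2)[of x] that by (simp add: dist_norm solution_\<phi>)
    then show ?thesis using norm_triangle_ineq2[of "der l ?f x" 1] by simp
  qed
  have f2: "cmod (?f x) \<le> 2 * (x - l)" if x: "l \<le> x" "x < l + d" for x
  proof -
    have i: "integrable (lebesgue_on {l..x}) (der l ?f)"
      by (intro continuous_imp_integrable_real continuous_on_subset[OF cd]) auto
    have "?f x = (LINT t|lebesgue_on {l..x}. der l ?f t)"
      using primitive_eq[OF primitive_der[OF f_AC] x(1)] by (simp add: solution_\<phi>)
    also have "cmod \<dots> \<le> (LINT t|lebesgue_on {l..x}. cmod (der l ?f t))"
      by (rule integral_norm_bound)
    also have "\<dots> \<le> (LINT t|lebesgue_on {l..x}. 2)"
      using x d2 by (intro integral_mono integrable_norm[OF i] continuous_imp_integrable_real[OF continuous_on_const]) auto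
    also have "\<dots> = 2 * (x - l)" using x by (simp add: measure_restrict_space)
    finally show ?thesis .
  qed
  \<comment> \<open>The cutoff at distance \<open>\<epsilon> n\<close> stays where the bounds \<open>d2\<close> and \<open>f2\<close> hold. It is a cube of size \<open>\<epsilon> n ^ 3\<close>, by
    which the functions \<open>v n\<close> are divided in the end.\<close>
  define \<epsilon> where "\<epsilon> n = d / (2 * real (Suc n))" for n
  have \<epsilon>: "0 < \<epsilon> n" "\<epsilon> n < d" for n
    using d(1) by (auto simp: \<epsilon>_def divide_simps)
  have "(\<lambda>n. d / 2 * (1 / real (Suc n))) \<longlonglongrightarrow> d / 2 * 0"
    by (intro tendsto_mult_left) (rule LIMSEQ_Suc[OF lim_1_over_n])
  then have \<epsilon>0: "\<epsilon> \<longlonglongrightarrow> 0" by (simp add: \<epsilon>_def[abs_def])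
  define v where "v n = bump l (l + \<epsilon> n) ?f" for n
  note bump = bump[OF f_AC f0]
  have v: "v n \<in> Dstar q l" "v n l = 0" "der l (v n) l = of_real (\<epsilon> n ^ 3)" for n
  proof -
    show "v n \<in> Dstar q l" unfolding v_def by (rule bump(1))
    show "v n l = 0" unfolding v_def bump(2)[OF order_refl] by (simp add: solution_\<phi>)
    show "der l (v n) l = of_real (\<epsilon> n ^ 3)"
      using \<epsilon>[of n] unfolding v_def bump(3) by (simp add: solution_\<phi> cutoff_def)
  qed
  have vb: "cmod (v n x) \<le> 2 * \<epsilon> n ^ 4 * indicator {l..l + \<epsilon> n} x" if x: "l \<le> x" for n x
  proof (cases "x \<le> l + \<epsilon> n")
    case True
    have "cmod (v n x) = (l + \<epsilon> n - x) ^ 3 * cmod (?f x)"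
      using True by (simp add: v_def bump(2)[OF x] norm_mult norm_cutoff)
    also have "\<dots> \<le> \<epsilon> n ^ 3 * (2 * \<epsilon> n)"
      using True x \<epsilon>[of n] f2[of x] by (intro mult_mono power_mono) auto
    finally show ?thesis using True x by (simp add: eval_nat_numeral mult_ac)
  next
    case False
    then show ?thesis by (simp add: v_def bump(2)[OF x] cutoff_zero)
  qed
  have slb: "AE x in lebesgue_on {l..}. cmod (sl_expr q l (v n) x) \<le> 24 * \<epsilon> n ^ 2" for n
  proof -
    have "AE x in lebesgue_on {l..}. x \<in> {l..}" by (rule AE_I2) simp
    with bump(4)[of "l + \<epsilon> n", folded v_def] show ?thesis
    proof eventually_elim
      case (elim x)
      show ?case
      proof (cases "x \<le> l + \<epsilon> n")
        case True
        have "cmod (sl_expr q l (v n) x) \<le> cmod (6 * cutoff (l + \<epsilon> n) 1 x * ?f x) + cmod (6 * cutoff (l + \<epsilon> n) 2 x * der l ?f x)"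
          unfolding elim using norm_triangle_ineq[of "- 6 * cutoff (l + \<epsilon> n) 1 x * ?f x"] by simp
        also have "\<dots> = 6 * (l + \<epsilon> n - x) * cmod (?f x) + 6 * (l + \<epsilon> n - x) ^ 2 * cmod (der l ?f x)"
          using True by (simp add: norm_mult norm_cutoff)
        also have "\<dots> \<le> 6 * \<epsilon> n * (2 * \<epsilon> n) + 6 * \<epsilon> n ^ 2 * 2"
          using True elim(2) \<epsilon>[of n] f2[of x] d2[of x] by (intro add_mono mult_mono power_mono) auto
        finally show ?thesis by (simp add: power2_eq_square)
      next
        case False
        then show ?thesis unfolding elim by (simp add: cutoff_zero)
      qed
    qed
  qed
  have vs: "L2_sq l (v n) \<le> 4 * \<epsilon> n ^ 9" for n
  proof -
    have i: "integrable (lebesgue_on {l..}) (\<lambda>x. v n x * cnj (v n x))"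
      by (rule L2_integrable_mult_cnj[OF DstarD(2)[OF v(1)] DstarD(2)[OF v(1)]])
    have "AE x in lebesgue_on {l..}. cmod (v n x * cnj (v n x)) \<le> 4 * \<epsilon> n ^ 8 * indicator {l..l + \<epsilon> n} x"
    proof (rule AE_I2)
      fix x assume "x \<in> space (lebesgue_on {l..})"
      then have "cmod (v n x) ^ 2 \<le> (2 * \<epsilon> n ^ 4 * indicator {l..l + \<epsilon> n} x) ^ 2"
        by (intro power_mono vb) auto
      then show "cmod (v n x * cnj (v n x)) \<le> 4 * \<epsilon> n ^ 8 * indicator {l..l + \<epsilon> n} x"
        by (auto simp: norm_mult power2_eq_square indicator_def power_mult_distrib simp flip: power_add split: if_splits)
    qed
    from norm_integral_le_of_support[OF i _ this]
    have "cmod (L2_inner l (v n) (v n)) \<le> 4 * \<epsilon> n ^ 8 * \<epsilon> n"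
      using \<epsilon>[of n] by (simp add: L2_inner_def)
    then show ?thesis
      using L2_inner_self[OF DstarD(2)[OF v(1)], of n] L2_sq_nonneg[of l "v n"] by (simp add: eval_nat_numeral mult_ac)
  qed
  have vq: "\<bar>qform (v n)\<bar> \<le> 48 * \<epsilon> n ^ 7" for n
  proof -
    have i: "integrable (lebesgue_on {l..}) (\<lambda>x. sl_expr q l (v n) x * cnj (v n x))"
      by (rule L2_integrable_mult_cnj[OF DstarD(3)[OF v(1)] DstarD(2)[OF v(1)]])
    have "AE x in lebesgue_on {l..}. x \<in> {l..}" by (rule AE_I2) simp
    with slb[of n] have "AE x in lebesgue_on {l..}. cmod (sl_expr q l (v n) x * cnj (v n x)) \<le> 48 * \<epsilon> n ^ 6 * indicator {l..l + \<epsilon> n} x"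
    proof eventually_elim
      case (elim x)
      have "cmod (sl_expr q l (v n) x) * cmod (v n x) \<le> (24 * \<epsilon> n ^ 2) * (2 * \<epsilon> n ^ 4 * indicator {l..l + \<epsilon> n} x)"
        using elim vb[of x n] by (intro mult_mono) auto
      then show ?case by (simp add: norm_mult eval_nat_numeral mult_ac)
    qed
    from norm_integral_le_of_support[OF i _ this]
    have "cmod (form (v n) (v n)) \<le> 48 * \<epsilon> n ^ 6 * \<epsilon> n"
      using \<epsilon>[of n] by (simp add: L2_inner_def form_def v)
    then show ?thesis
      by (simp add: form_self[OF v(1)] eval_nat_numeral mult_ac)
  qed
  define \<eta> where "\<eta> n = (\<lambda>x. of_real (1 / \<epsilon> n ^ 3) * v n x)" for n
  note c = qform_cmult[OF v(1)]
  have 1: "\<eta> n \<in> Dstar q l" for n unfolding \<eta>_def by (rule c(1))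
  have 2: "\<eta> n l = 0" for n by (simp add: \<eta>_def v)
  have 3: "der l (\<eta> n) l = 1" for n unfolding \<eta>_def c(3) using \<epsilon>[of n] by (simp add: v)
  have sc: "(cmod (of_real (1 / \<epsilon> n ^ 3)))\<^sup>2 = 1 / \<epsilon> n ^ 6" for n
    using \<epsilon>[of n] by (simp add: norm_divide norm_power power_divide flip: power_mult)
  have "L2_sq l (\<eta> n) \<le> 4 * \<epsilon> n ^ 3" for n
  proof -
    have "L2_sq l (\<eta> n) = 1 / \<epsilon> n ^ 6 * L2_sq l (v n)"
      unfolding L2_sq_def \<eta>_def norm_mult power_mult_distrib sc by simp
    also have "\<dots> \<le> 1 / \<epsilon> n ^ 6 * (4 * \<epsilon> n ^ 9)"
      using \<epsilon>[of n] by (intro mult_left_mono vs) auto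
    also have "\<dots> = 4 * \<epsilon> n ^ 3" using \<epsilon>[of n] by (simp add: eval_nat_numeral)
    finally show ?thesis .
  qed
  moreover have "(\<lambda>n. 4 * \<epsilon> n ^ 3) \<longlonglongrightarrow> 4 * 0 ^ 3" by (intro tendsto_intros \<epsilon>0)
  then have "(\<lambda>n. 4 * \<epsilon> n ^ 3) \<longlonglongrightarrow> 0" by simp
  ultimately have 4: "(\<lambda>n. L2_sq l (\<eta> n)) \<longlonglongrightarrow> 0"
    by (intro Lim_null_comparison[of "\<lambda>n. L2_sq l (\<eta> n)" "\<lambda>n. 4 * \<epsilon> n ^ 3"]) (auto simp: L2_sq_nonneg)
  have "\<bar>qform (\<eta> n)\<bar> \<le> 48 * \<epsilon> n" for n
  proof -
    have "\<bar>qform (\<eta> n)\<bar> = 1 / \<epsilon> n ^ 6 * \<bar>qform (v n)\<bar>"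
      unfolding \<eta>_def c(2) sc using \<epsilon>[of n] by (simp add: abs_mult)
    also have "\<dots> \<le> 1 / \<epsilon> n ^ 6 * (48 * \<epsilon> n ^ 7)"
      using \<epsilon>[of n] by (intro mult_left_mono vq) auto
    also have "\<dots> = 48 * \<epsilon> n" using \<epsilon>[of n] by (simp add: eval_nat_numeral)
    finally show ?thesis .
  qed
  moreover have "(\<lambda>n. 48 * \<epsilon> n) \<longlonglongrightarrow> 48 * 0" by (intro tendsto_intros \<epsilon>0)
  then have "(\<lambda>n. 48 * \<epsilon> n) \<longlonglongrightarrow> 0" by simp
  ultimately have 5: "(\<lambda>n. qform (\<eta> n)) \<longlonglongrightarrow> 0"
    by (intro Lim_null_comparison[of "\<lambda>n. qform (\<eta> n)" "\<lambda>n. 48 * \<epsilon> n"]) auto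
  show thesis by (rule that[OF 1 2 3 4 5])
qed

text \<open>Adding a multiple of a small bump changes the derivative at \<open>l\<close> at no cost; the mixed term is an inner product
  with the bump because the bump vanishes at \<open>l\<close>.\<close>

lemma perturb_derivative:
  assumes f: "f \<in> Dstar q l"
  obtains g :: "nat \<Rightarrow> real \<Rightarrow> complex" where "\<And>n. g n \<in> Dstar q l" "\<And>n. g n l = f l" "\<And>n. der l (g n) l = k"
    "(\<lambda>n. qform (g n)) \<longlonglongrightarrow> qform f"
proof -
  obtain \<eta> :: "nat \<Rightarrow> real \<Rightarrow> complex" where \<eta>: "\<And>n. \<eta> n \<in> Dstar q l" "\<And>n. \<eta> n l = 0" "\<And>n. der l (\<eta> n) l = 1"
    "(\<lambda>n. L2_sq l (\<eta> n)) \<longlonglongrightarrow> 0" "(\<lambda>n. qform (\<eta> n)) \<longlonglongrightarrow> 0"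
    using small_bumps by blast
  define c where "c = k - der l f l"
  define g where "g n = (\<lambda>x. f x + c * \<eta> n x)" for n
  have 1: "g n \<in> Dstar q l" "g n l = f l" "der l (g n) l = k" for n
    using Dstar_add_cmult[OF f \<eta>(1)] der_add_cmult[OF f \<eta>(1)] by (simp_all add: g_def \<eta> c_def)
  have "(\<lambda>n. sqrt (L2_sq l (sl_expr q l f) * L2_sq l (\<eta> n))) \<longlonglongrightarrow> sqrt (L2_sq l (sl_expr q l f) * 0)"
    by (intro tendsto_intros \<eta>)
  then have s: "(\<lambda>n. sqrt (L2_sq l (sl_expr q l f) * L2_sq l (\<eta> n))) \<longlonglongrightarrow> 0" by simp
  have "cmod (form f (\<eta> n)) \<le> sqrt (L2_sq l (sl_expr q l f) * L2_sq l (\<eta> n))" for n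
    using L2_inner_Cauchy_Schwarz[OF DstarD(3)[OF f] DstarD(2)[OF \<eta>(1)], of n]
    by (intro real_le_rsqrt) (simp add: form_def \<eta>)
  then have "(\<lambda>n. form f (\<eta> n)) \<longlonglongrightarrow> 0"
    by (intro Lim_null_comparison[OF _ s]) auto
  then have "(\<lambda>n. qform f + 2 * Re (cnj c * form f (\<eta> n)) + (cmod c)\<^sup>2 * qform (\<eta> n)) \<longlonglongrightarrow>
      qform f + 2 * Re (cnj c * 0) + (cmod c)\<^sup>2 * 0"
    by (intro tendsto_intros \<eta>)
  then have "(\<lambda>n. qform (g n)) \<longlonglongrightarrow> qform f"
    by (simp add: g_def qform_add_cmult[OF f \<eta>(1)])
  with 1 that show thesis by blast
qed

text \<open>Functions in the minimal domain approximate \<open>f\<close> in the form: the derivative can be perturbed to zero.\<close>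

lemma qform_dirichlet_nonneg:
  assumes "f \<in> Dstar q l" "f l = 0"
  shows "0 \<le> qform f"
proof -
  obtain g :: "nat \<Rightarrow> real \<Rightarrow> complex" where g: "\<And>n. g n \<in> Dstar q l" "\<And>n. g n l = f l" "\<And>n. der l (g n) l = 0"
    "(\<lambda>n. qform (g n)) \<longlonglongrightarrow> qform f"
    using perturb_derivative[OF assms(1)] by blast
  have "0 \<le> qform (g n)" for n
    using g assms(2) by (intro qform_minimal_nonneg) auto
  then show ?thesis using g(4) by (intro LIMSEQ_le_const) auto
qed

lemma form_\<psi>:
  assumes "z \<notin> \<real>\<^sub>\<ge>\<^sub>0" "g \<in> Dstar q l"
  shows "form (\<psi> z) g = z * L2_inner l (\<psi> z) g - minf z * cnj (g l)"
proof -
  note z = \<psi>[OF assms(1)]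
  have "AE x in lebesgue_on {l..}. z * \<psi> z x = sl_expr q l (\<psi> z) x"
    using z(2) by eventually_elim simp
  from L2_inner_cong_AE[OF L2_cmult[OF DstarD(2)[OF z(1)]] DstarD(2)[OF assms(2)] this]
  have "L2_inner l (sl_expr q l (\<psi> z)) g = L2_inner l (\<lambda>x. z * \<psi> z x) g" .
  also have "\<dots> = z * L2_inner l (\<psi> z) g"
    using L2_inner_lincomb_left[OF DstarD(2)[OF z(1)] DstarD(2)[OF z(1)] DstarD(2)[OF assms(2)], of z 0] by simp
  finally show ?thesis using z by (simp add: form_def)
qed

lemma qform_\<psi>_negative:
  assumes "t < 0"
  shows "qform (\<psi> t) = t * L2_sq l (\<psi> t) + Re (minf t)"
  using form_\<psi>[OF neg_notin[OF assms] \<psi>(1)[OF neg_notin[OF assms]]] \<psi>[OF neg_notin[OF assms]]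
    L2_inner_self[OF DstarD(2)[OF \<psi>(1)[OF neg_notin[OF assms]]]]
  by (simp add: qform_def)

text \<open>The function \<open>g = f + f(l) \<psi>\<close> vanishes at \<open>l\<close>, and \<open>\<psi>\<close> is orthogonal to it with respect to the form shifted by \<open>t\<close>.
  So the shifted form splits into a nonnegative part from \<open>g\<close> and the contribution of \<open>\<psi>\<close>, which is the Weyl
  function.\<close>

lemma qform_lower_bound_negative:
  assumes f: "f \<in> Dstar q l" and t: "t < 0"
  shows "Re (minf t) * (cmod (f l))\<^sup>2 + t * L2_sq l f \<le> qform f"
proof -
  let ?\<psi> = "\<psi> t"
  note p = \<psi>[OF neg_notin[OF t]]
  define g where "g = (\<lambda>x. f x + f l * ?\<psi> x)"
  have g: "g \<in> Dstar q l" "g l = 0"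
    unfolding g_def using Dstar_add_cmult[OF f p(1)] p(3) by auto
  have f_eq: "f = (\<lambda>x. g x + (- f l) * ?\<psi> x)" by (simp add: g_def)
  have "form g ?\<psi> = cnj (form ?\<psi> g)" by (rule form_commute[OF p(1) g(1)])
  also have "\<dots> = t * L2_inner l g ?\<psi>"
    using form_\<psi>[OF neg_notin[OF t] g(1)] g(2) L2_inner_commute[of l g ?\<psi>] by simp
  finally have cross: "form g ?\<psi> = t * L2_inner l g ?\<psi>" .
  have "qform f = qform g + 2 * Re (cnj (- f l) * (t * L2_inner l g ?\<psi>)) + (cmod (f l))\<^sup>2 * qform ?\<psi>"
    using qform_add_cmult[OF g(1) p(1), of "- f l", folded f_eq] by (simp add: cross)
  moreover have "L2_sq l f = L2_sq l g + 2 * Re (cnj (- f l) * L2_inner l g ?\<psi>) + (cmod (f l))\<^sup>2 * L2_sq l ?\<psi>"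
  proof -
    note gL = DstarD(2)[OF g(1)] and pL = DstarD(2)[OF p(1)]
    have "f = (\<lambda>x. g x - (\<lambda>x. f l * ?\<psi> x) x)" by (simp add: g_def)
    from arg_cong[OF this, of "L2_sq l"] L2_sq_diff[OF gL L2_cmult[OF pL, of "f l"]]
    have "L2_sq l f = L2_sq l g + L2_sq l (\<lambda>x. f l * ?\<psi> x) - 2 * Re (L2_inner l g (\<lambda>x. f l * ?\<psi> x))" by simp
    moreover have "L2_sq l (\<lambda>x. f l * ?\<psi> x) = (cmod (f l))\<^sup>2 * L2_sq l ?\<psi>"
      by (simp add: L2_sq_def norm_mult power_mult_distrib)
    moreover have "L2_inner l g (\<lambda>x. f l * ?\<psi> x) = cnj (f l) * L2_inner l g ?\<psi>"
      using L2_inner_lincomb_right[OF pL pL gL, of "f l" 0] by simp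
    ultimately show ?thesis by simp
  qed
  moreover have "Re (cnj (- f l) * (t * L2_inner l g ?\<psi>)) = t * Re (cnj (- f l) * L2_inner l g ?\<psi>)"
    by (simp add: algebra_simps)
  ultimately have "qform f - t * L2_sq l f = (qform g - t * L2_sq l g) + (cmod (f l))\<^sup>2 * (qform ?\<psi> - t * L2_sq l ?\<psi>)"
    by (simp only: algebra_simps) 
  moreover have "qform ?\<psi> - t * L2_sq l ?\<psi> = Re (minf t)" using qform_\<psi>_negative[OF t] by simp
  moreover have "0 \<le> qform g" by (rule qform_dirichlet_nonneg[OF g])
  moreover have "t * L2_sq l g \<le> 0" using t L2_sq_nonneg[of l g] by (simp add: mult_nonpos_nonneg)
  ultimately show ?thesis by (simp add: mult.commute)
qed

text \<open>The norm of \<open>f\<close> enters the bound for negative \<open>t\<close> with the factor \<open>t\<close> and disappears in the limit.\<close>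

theorem qform_lower_bound:
  assumes f: "f \<in> Dstar q l"
  shows "m * (cmod (f l))\<^sup>2 \<le> qform f"
proof -
  have "((\<lambda>t. Re (minf (of_real t)) * (cmod (f l))\<^sup>2 + t * L2_sq l f) \<longlongrightarrow> Re (of_real m) * (cmod (f l))\<^sup>2 + 0 * L2_sq l f) (at_left 0)"
    by (intro tendsto_intros m_limit)
  moreover have "\<forall>\<^sub>F t in at_left 0. Re (minf (of_real t)) * (cmod (f l))\<^sup>2 + t * L2_sq l f \<le> qform f"
    using qform_lower_bound_negative[OF f] by (auto simp: eventually_at_left_field intro!: exI[of _ "-1"])
  ultimately have "Re (of_real m) * (cmod (f l))\<^sup>2 + 0 * L2_sq l f \<le> qform f"
    by (rule tendsto_upperbound) simp
  then show ?thesis by simp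
qed

text \<open>The Weyl solutions for \<open>t\<close> close to \<open>-0\<close> nearly attain the bound, as their form is at most \<open>m\<^sub>\<infinity>(t)\<close>; afterwards
  the derivative at \<open>l\<close> is adjusted.\<close>

theorem qform_lower_bound_sharp:
  assumes "e > 0"
  obtains f where "f \<in> Dstar q l" "f l = 1" "der l f l = k" "qform f < m + e"
proof -
  have "((\<lambda>t. Re (minf (of_real t))) \<longlongrightarrow> Re (of_real m)) (at_left 0)"
    by (intro tendsto_intros m_limit)
  then have "\<forall>\<^sub>F t in at_left 0. Re (minf (of_real t)) < m + e"
    using assms by (intro order_tendstoD(2)) auto
  then have "\<forall>\<^sub>F t in at_left 0. Re (minf (of_real t)) < m + e \<and> t < 0"
    by (intro eventually_conj) (auto simp: eventually_at_filter)
  then obtain t :: real where t: "Re (minf (of_real t)) < m + e" "t < 0"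
    using eventually_happens'[OF trivial_limit_at_left_real] by blast
  note p = \<psi>[OF neg_notin[OF t(2)]] and c = qform_cmult[OF \<psi>(1)[OF neg_notin[OF t(2)]], of "-1"]
  have "qform (\<psi> t) < m + e"
    using t(1) mult_nonpos_nonneg[OF less_imp_le[OF t(2)] L2_sq_nonneg[of l "\<psi> t"]]
    unfolding qform_\<psi>_negative[OF t(2)] by linarith
  then have q: "qform (\<lambda>x. - 1 * \<psi> t x) < m + e" unfolding c(2) by simp
  obtain g :: "nat \<Rightarrow> real \<Rightarrow> complex" where g: "\<And>n. g n \<in> Dstar q l" "\<And>n. g n l = - 1 * \<psi> t l" "\<And>n. der l (g n) l = k"
    "(\<lambda>n. qform (g n)) \<longlonglongrightarrow> qform (\<lambda>x. - 1 * \<psi> t x)"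
    using perturb_derivative[OF c(1)] by blast
  obtain n where "qform (g n) < m + e"
    using order_tendstoD(2)[OF g(4) q] by (auto simp: eventually_sequentially)
  then show thesis using that[of "g n"] g p(3) by simp
qed

text \<open>Testing with cutoffs of a solution \<open>f\<close> for \<open>0\<close> determines moments of \<open>w cnj f\<close>, which must therefore vanish. Two
  solutions with nonzero Wronskian have no common zero, so \<open>w\<close> vanishes. The evaluation at \<open>l\<close> contributes a
  multiple of \<open>(b - l)\<^sup>3\<close>, which the moment lemma allows for.\<close>

lemma orthogonal_imp_zero:
  assumes w: "w \<in> L2 l" and orth: "\<And>v. v \<in> Dstar q l \<Longrightarrow> L2_inner l w v = c * cnj (v l)"
  shows "AE x in lebesgue_on {l..}. w x = 0"
proof -
  have main: "AE x in lebesgue_on {l..}. w x * cnj (f x) = 0"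
    if f: "AC_with_derivative l f" "AE x in lebesgue_on {l..}. sl_expr q l f x = 0" for f
  proof (rule moments_zero[where n = 2 and K = "c * cnj (f l)"])
    have cf: "continuous_on {l..} f" by (rule primitive_continuous_on[OF primitive_der[OF f(1)]])
    fix b assume b: "l \<le> b"
    show "integrable (lebesgue_on {l..b}) (\<lambda>x. w x * cnj (f x))"
    proof (rule integrable_mult_of_square_integrable)
      have c: "continuous_on {l..b} (\<lambda>x. cnj (f x))"
        by (intro continuous_intros continuous_on_subset[OF cf]) auto
      show "(\<lambda>x. cnj (f x)) \<in> borel_measurable (lebesgue_on {l..b})"
        by (rule continuous_imp_measurable_on_sets_lebesgue[OF c]) simp
      show "integrable (lebesgue_on {l..b}) (\<lambda>x. (cmod (cnj (f x)))\<^sup>2)"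
        by (intro continuous_imp_integrable_real continuous_intros c)
    qed (use L2_sq_integrable_on[OF w, of "{l..b}"] in auto)
    have "(LINT x|lebesgue_on {l..b}. of_real (b - x) ^ Suc 2 * (w x * cnj (f x))) =
        (LINT x|lebesgue. indicator {l..b} x *\<^sub>R (of_real (b - x) ^ Suc 2 * (w x * cnj (f x))))"
      by (simp add: integral_restrict_space)
    also have "\<dots> = (LINT x|lebesgue. indicator {l..} x *\<^sub>R (w x * cnj (bump l b f x)))"
    proof (rule Bochner_Integration.integral_cong)
      fix x
      consider "x < l" | "l \<le> x" "x \<le> b" | "l \<le> x" "b < x" by linarith
      then show "indicator {l..b} x *\<^sub>R (of_real (b - x) ^ Suc 2 * (w x * cnj (f x))) = indicator {l..} x *\<^sub>R (w x * cnj (bump l b f x))"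
      proof cases
        case 2
        then show ?thesis by (simp add: bump(2)[OF f 2(1)] cutoff_def numeral_3_eq_3)
      next
        case 3
        then show ?thesis by (simp add: bump(2)[OF f 3(1)] cutoff_zero)
      qed simp
    qed simp
    also have "\<dots> = L2_inner l w (bump l b f)"
      by (simp add: L2_inner_def integral_restrict_space)
    also have "\<dots> = c * cnj (cutoff b 3 l * f l)"
      using orth[OF bump(1)[OF f]] bump(2)[OF f order_refl] by simp
    also have "\<dots> = c * cnj (f l) * of_real (b - l) ^ Suc 2"
      using b by (simp add: cutoff_def numeral_3_eq_3)
    finally show "(LINT x|lebesgue_on {l..b}. of_real (b - x) ^ Suc 2 * (w x * cnj (f x))) = c * cnj (f l) * of_real (b - l) ^ Suc 2" .
  qed
  have s1: "AE x in lebesgue_on {l..}. sl_expr q l (\<phi>1 0) x = 0" and s2: "AE x in lebesgue_on {l..}. sl_expr q l (\<phi>2 0) x = 0"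
    using solution_\<phi>(2)[of 0] solution_\<phi>(6)[of 0] by simp_all
  have "AE x in lebesgue_on {l..}. x \<in> {l..}" by (rule AE_I2) simp
  with main[OF solution_\<phi>(1) s1] main[OF solution_\<phi>(5) s2] show ?thesis
  proof eventually_elim
    case (elim x)
    have "wronskian l (\<phi>1 0) (\<phi>2 0) x = wronskian l (\<phi>1 0) (\<phi>2 0) l"
      using elim by (intro wronskian_constant[OF solution_\<phi>(1,5,2,6)]) simp
    also have "\<dots> = 1" by (simp add: wronskian_def solution_\<phi>)
    finally have "\<phi>1 0 x \<noteq> 0 \<or> \<phi>2 0 x \<noteq> 0" by (auto simp: wronskian_def)
    then show ?case using elim by auto
  qed
qed

end

context weyl_problem
begin

section \<open>The Weyl function at the imaginary unit\<close>

lemma divide_eq_mult_cnj: "N / z = N * cnj z / of_real ((cmod z)\<^sup>2)" for N z :: complex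
  by (simp add: complex_div_cnj[of N z])

text \<open>The Weyl solution for \<open>-\<i>\<close> and the conjugate of the one for \<open>\<i>\<close> solve the same equation. Their Wronskian is
  constant and vanishes at infinity; at \<open>l\<close> it is the difference of the two sides.\<close>

lemma minf_minus_i: "minf (- \<i>) = cnj (minf \<i>)"
proof -
  let ?f = "\<psi> (- \<i>)" and ?g = "\<lambda>x. cnj (\<psi> \<i> x)"
  note p = \<psi>[of "- \<i>", simplified] and r = \<psi>[of \<i>, simplified]
  have g: "?g \<in> Dstar q l" by (rule Dstar_cnj[OF r(1)])
  have ae: "AE x in lebesgue_on {l..}. sl_expr q l ?g x = - \<i> * ?g x"
    using AC_with_derivative_cnj(3)[OF DstarD(1)[OF r(1)], of q] r(2) by eventually_elim simp
  have "AE x in lebesgue_on {l..}. sl_expr q l ?f x = - \<i> * ?f x" using p(2) by simp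
  note w = wronskian_constant[OF DstarD(1)[OF p(1)] DstarD(1)[OF g] this ae]
  have "\<forall>\<^sub>F x in at_top. wronskian l ?f ?g x = wronskian l ?f ?g l"
    using eventually_ge_at_top[of l] by eventually_elim (rule w)
  then have "(wronskian l ?f ?g \<longlongrightarrow> wronskian l ?f ?g l) at_top" by (rule tendsto_eventually)
  from tendsto_unique[OF _ this lp.wronskian_tendsto_0[OF p(1) g]]
  have "wronskian l ?f ?g l = 0" by simp
  then show ?thesis
    using AC_with_derivative_cnj(2)[OF DstarD(1)[OF r(1)] order_refl] by (simp add: wronskian_def p r)
qed

lemma L2_inner_sl_\<psi>:
  assumes "z \<notin> \<real>\<^sub>\<ge>\<^sub>0" "g \<in> Dstar q l"
  shows "L2_inner l (sl_expr q l (\<psi> z)) g = z * L2_inner l (\<psi> z) g"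
  using form_\<psi>[OF assms] \<psi>[OF assms(1)] by (simp add: form_def)

lemma Im_minf:
  assumes "z = \<i> \<or> z = - \<i>"
  shows "L2_sq l (\<psi> z) = - Im (minf \<i>)"
proof -
  have z: "z \<notin> \<real>\<^sub>\<ge>\<^sub>0" using assms by auto
  note p = \<psi>[OF z]
  have "L2_inner l (sl_expr q l (\<psi> z)) (\<psi> z) - cnj (L2_inner l (sl_expr q l (\<psi> z)) (\<psi> z)) = - minf z + cnj (minf z)"
    using lp.green_formula[OF p(1) p(1)] L2_inner_commute[of l "\<psi> z" "sl_expr q l (\<psi> z)"] by (simp add: p)
  then have "(z - cnj z) * of_real (L2_sq l (\<psi> z)) = - minf z + cnj (minf z)"
    by (simp add: L2_inner_sl_\<psi>[OF z p(1)] L2_inner_self[OF DstarD(2)[OF p(1)]] algebra_simps)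
  note eq = this
  from assms show ?thesis
  proof
    assume "z = \<i>"
    then show ?thesis using eq by (simp add: complex_eq_iff[of "_ * _"])
  next
    assume "z = - \<i>"
    then show ?thesis using eq by (simp add: complex_eq_iff[of "- _"] minf_minus_i)
  qed
qed

lemma Im_minf_neg: "Im (minf \<i>) < 0"
proof (rule ccontr)
  assume "\<not> Im (minf \<i>) < 0"
  then have "L2_sq l (\<psi> \<i>) = 0" using Im_minf[of \<i>] L2_sq_nonneg[of l "\<psi> \<i>"] by simp
  then have "AE x in lebesgue_on {l..}. \<psi> \<i> x = 0" by (rule L2_sq_eq_0_AE[OF DstarD(2)[OF \<psi>(1)[of \<i>, simplified]]])
  from continuous_AE_zero[OF Dstar_continuous_on[OF \<psi>(1)[of \<i>, simplified]] this order_refl]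
  show False using \<psi>(3)[of \<i>] by simp
qed

text \<open>The Cauchy-Schwarz argument for the nonnegative form \<open>f \<mapsto> qform f - m |f(l)|\<^sup>2\<close>: a null vector is orthogonal to
  everything.\<close>

lemma qform_null_vector:
  fixes f g :: "real \<Rightarrow> complex"
  assumes f: "f \<in> Dstar q l" and null: "qform f = m * (cmod (f l))\<^sup>2" and g: "g \<in> Dstar q l"
  shows "form f g = m * f l * cnj (g l)"
proof -
  define d where "d = form f g - m * f l * cnj (g l)"
  define K where "K = qform g - m * (cmod (g l))\<^sup>2"
  have le: "2 * t * (cmod d)\<^sup>2 \<le> t\<^sup>2 * (cmod d)\<^sup>2 * K" for t :: real
  proof -
    \<comment> \<open>A step of length \<open>t\<close> against the direction \<open>d\<close>: the linear term is \<open>- 2 t |d|\<^sup>2\<close>, and nonnegativity for small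
      \<open>t\<close> forces \<open>d = 0\<close>.\<close>
    define c where "c = - of_real t * d"
    have "m * (cmod (f l + c * g l))\<^sup>2 \<le> qform f + 2 * Re (cnj c * form f g) + (cmod c)\<^sup>2 * qform g"
      using qform_lower_bound[OF Dstar_add_cmult[OF f g, of c]] qform_add_cmult[OF f g, of c] by simp
    moreover have "(cmod (f l + c * g l))\<^sup>2 = (cmod (f l))\<^sup>2 + 2 * Re (cnj c * (f l * cnj (g l))) + (cmod c)\<^sup>2 * (cmod (g l))\<^sup>2"
      unfolding cmod_power2 by (simp add: power2_eq_square algebra_simps)
    ultimately have "0 \<le> 2 * Re (cnj c * form f g) - m * (2 * Re (cnj c * (f l * cnj (g l)))) + (cmod c)\<^sup>2 * K"
      by (simp add: null K_def algebra_simps)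
    also have "2 * Re (cnj c * form f g) - m * (2 * Re (cnj c * (f l * cnj (g l)))) = 2 * Re (cnj c * d)"
      by (simp add: d_def algebra_simps)
    also have "Re (cnj c * d) = - t * (cmod d)\<^sup>2"
      unfolding cmod_power2 by (simp add: c_def power2_eq_square algebra_simps)
    also have "(cmod c)\<^sup>2 = t\<^sup>2 * (cmod d)\<^sup>2" by (simp add: c_def norm_mult power_mult_distrib)
    finally show ?thesis by simp
  qed
  have "d = 0"
  proof (rule ccontr)
    assume "d \<noteq> 0"
    then have d: "(cmod d)\<^sup>2 > 0" by simp
    have bd: "2 * t \<le> t\<^sup>2 * K" for t
    proof -
      have "(2 * t) * (cmod d)\<^sup>2 \<le> (t\<^sup>2 * K) * (cmod d)\<^sup>2" using le[of t] by (simp add: mult_ac)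
      then show ?thesis using d mult_right_le_imp_le by blast
    qed
    have "K > 0" using bd[of 1] by simp
    then show False using bd[of "1 / K"] by (simp add: power2_eq_square divide_right_mono field_simps)
  qed
  then show ?thesis by (simp add: d_def)
qed

text \<open>The form at the Weyl solution for \<open>\<i>\<close> equals the real part of the Weyl function. If this were \<open>m\<close>, the solution
  would be a null vector. Its inner product with the Weyl solution for \<open>-\<i>\<close> would then have real part equal to
  both squared norms, so the two solutions would coincide, against the sign of the imaginary part.\<close>

theorem m_less_Re_minf: "m < Re (minf \<i>)"
proof -
  note p = \<psi>[of \<i>, simplified] and p' = \<psi>[of "- \<i>", simplified]
  have "form (\<psi> \<i>) (\<psi> \<i>) = \<i> * of_real (L2_sq l (\<psi> \<i>)) + minf \<i>"
    using form_\<psi>[of \<i>, OF _ p(1)] L2_inner_self[OF DstarD(2)[OF p(1)]] by (simp add: p)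
  then have q: "qform (\<psi> \<i>) = Re (minf \<i>)" by (simp add: qform_def)
  then have "m \<le> Re (minf \<i>)" using qform_lower_bound[OF p(1)] by (simp add: p)
  moreover have "m \<noteq> Re (minf \<i>)"
  proof
    assume m: "m = Re (minf \<i>)"
    have "form (\<psi> \<i>) (\<psi> (- \<i>)) = m"
      using qform_null_vector[OF p(1) _ p'(1)] q m by (simp add: p p')
    moreover have "form (\<psi> \<i>) (\<psi> (- \<i>)) = \<i> * L2_inner l (\<psi> \<i>) (\<psi> (- \<i>)) + minf \<i>"
      using form_\<psi>[of \<i>, OF _ p'(1)] by (simp add: p')
    ultimately have "Re (L2_inner l (\<psi> \<i>) (\<psi> (- \<i>))) = - Im (minf \<i>)"
      by (simp add: complex_eq_iff)
    then have "L2_sq l (\<lambda>x. \<psi> \<i> x - \<psi> (- \<i>) x) = 0"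
      using L2_sq_diff[OF DstarD(2)[OF p(1)] DstarD(2)[OF p'(1)]] Im_minf[of \<i>] Im_minf[of "- \<i>"] by simp
    from L2_sq_eq_0_AE[OF L2_diff[OF DstarD(2)[OF p(1)] DstarD(2)[OF p'(1)]] this]
    have "AE x in lebesgue_on {l..}. \<psi> \<i> x = \<psi> (- \<i>) x" by simp
    note eq = continuous_AE_eq[OF Dstar_continuous_on[OF p(1)] Dstar_continuous_on[OF p'(1)] this]
    have "\<psi> \<i> x = \<psi> (- \<i>) x" for x
      using eq[of x] DstarD(4)[OF p(1), of x] DstarD(4)[OF p'(1), of x] by (cases "x < l") auto
    then have "\<psi> \<i> = \<psi> (- \<i>)" by auto
    then have "minf \<i> = minf (- \<i>)" using p(4) p'(4) by simp
    then show False using minf_minus_i Im_minf_neg by (simp add: complex_eq_iff)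
  qed
  ultimately show ?thesis by simp
qed

section \<open>State space operators and the transfer function\<close>

lemma state_op_diff:
  assumes f: "f \<in> Dstar q l" and g: "g \<in> Dstar q l" and v: "v \<in> Dstar q l"
  shows "state_op q l \<mu> h (\<lambda>x. f x - g x) v = state_op q l \<mu> h f v - state_op q l \<mu> h g v"
proof -
  have d: "der l (\<lambda>x. f x - g x) l = der l f l - der l g l"
    using der_add_cmult[OF f g, of "-1"] by simp
  have "form (\<lambda>x. f x - g x) v = form f v - form g v"
    using form_lincomb_left[OF f g v, of 1 "-1"] by simp
  then have L: "L2_inner l (sl_expr q l (\<lambda>x. f x - g x)) v = L2_inner l (sl_expr q l f) v - L2_inner l (sl_expr q l g) v"
    by (simp add: form_def d algebra_simps)
  have "\<exists>K E. \<forall>f. state_op q l \<mu> h f v = L2_inner l (sl_expr q l f) v - K * (der l f l - h * f l) * E"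
  proof (cases \<mu>)
    case (Finite r)
    then show ?thesis
      by (intro exI[of _ "1 / (of_real r - h)"] exI[of _ "of_real r * delta l v + delta' l v"]) simp
  next
    case Infinite
    then show ?thesis by (intro exI[of _ 1] exI[of _ "delta l v"]) simp
  qed
  then obtain K E where st: "state_op q l \<mu> h f v = L2_inner l (sl_expr q l f) v - K * (der l f l - h * f l) * E" for f
    by blast
  show ?thesis unfolding st L d by (simp add: algebra_simps)
qed

lemma L2_inner_sl_self:
  assumes "f \<in> Dstar q l"
  shows "L2_inner l (sl_expr q l f) f = of_real (qform f) + der l f l * cnj (f l)"
  using form_self[OF assms] by (simp add: form_def algebra_simps)

lemma state_op_Finite_self:
  assumes f: "f \<in> Dstar q l" and h: "Im h > 0"
  shows "state_op q l (Finite \<mu>) h f f = of_real (qform f) +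
    (of_real ((cmod (der l f l))\<^sup>2) - 2 * h * of_real (Re (der l f l * cnj (f l))) + h * of_real (\<mu> * (cmod (f l))\<^sup>2)) / (of_real \<mu> - h)"
proof -
  let ?d = "of_real \<mu> - h"
  have nz: "?d \<noteq> 0" using h by (auto simp: complex_eq_iff)
  define a b where "a = der l f l" and "b = f l"
  have 1: "of_real ((cmod a)\<^sup>2) = a * cnj a" "of_real ((cmod b)\<^sup>2) = b * cnj b"
    by (simp_all add: complex_norm_square del: of_real_power)
  have 2: "2 * of_real (Re (a * cnj b)) = a * cnj b + b * cnj a"
    by (simp add: complex_eq_iff)
  have "a * cnj b - 1 / ?d * (a - h * b) * (of_real \<mu> * cnj b + - cnj a)
     = (a * cnj b * ?d - (a - h * b) * (of_real \<mu> * cnj b + - cnj a)) / ?d"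
    using nz by (simp add: field_simps)
  also have "a * cnj b * ?d - (a - h * b) * (of_real \<mu> * cnj b + - cnj a)
     = a * cnj a - h * (a * cnj b + b * cnj a) + h * (of_real \<mu> * (b * cnj b))"
    by (simp add: algebra_simps)
  also have "\<dots> = of_real ((cmod a)\<^sup>2) - 2 * h * of_real (Re (a * cnj b)) + h * of_real (\<mu> * (cmod b)\<^sup>2)"
    unfolding 1[symmetric] 2[symmetric] by simp
  finally show ?thesis
    using L2_inner_sl_self[OF f] by (simp add: delta_def delta'_def a_def b_def add_diff_eq[symmetric])
qed

lemma state_op_Infinite_self:
  assumes f: "f \<in> Dstar q l"
  shows "state_op q l Infinite h f f = of_real (qform f) + h * of_real ((cmod (f l))\<^sup>2)"
  using L2_inner_sl_self[OF f] complex_norm_square[of "f l"]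
  by (simp add: delta_def algebra_simps del: of_real_power)

text \<open>The imaginary part of the state space operator is \<open>K K\<^sup>*\<close>.\<close>

lemma state_op_Im_nonneg:
  assumes f: "f \<in> Dstar q l" and h: "Im h > 0"
  shows "0 \<le> Im (state_op q l \<mu> h f f)"
proof (cases \<mu>)
  case (Finite r)
  define a b where "a = der l f l" and "b = f l"
  define N where "N = of_real ((cmod a)\<^sup>2) - 2 * h * of_real (Re (a * cnj b)) + h * of_real (r * (cmod b)\<^sup>2)"
  have "Im (N / (of_real r - h)) = Im (N * cnj (of_real r - h)) / (cmod (of_real r - h))\<^sup>2"
    by (simp only: divide_eq_mult_cnj[of N] Im_divide_of_real)
  also have "Im (N * cnj (of_real r - h)) = Im h * (cmod (a - of_real r * b))\<^sup>2"
    unfolding N_def cmod_power2 by (simp add: power2_eq_square algebra_simps)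
  finally show ?thesis
    unfolding Finite state_op_Finite_self[OF f h] using h by (simp add: N_def a_def b_def)
next
  case Infinite
  then show ?thesis using state_op_Infinite_self[OF f, of h] h by simp
qed

text \<open>Uniqueness for the resolvent equation: the difference \<open>e\<close> of two solutions makes the sum of a nonnegative
  imaginary part and \<open>\<parallel>e\<parallel>\<^sup>2\<close> vanish.\<close>

lemma state_resolvent_eq:
  assumes h: "Im h > 0" and f: "f \<in> Dstar q l"
    and eq: "\<And>v. v \<in> Dstar q l \<Longrightarrow> state_op q l \<mu> h f v - (- \<i>) * L2_inner l f v = F v"
  shows "state_resolvent q l \<mu> h (- \<i>) F = f"
  unfolding state_resolvent_def
proof (rule the_equality)
  show "f \<in> Dstar q l \<and> (\<forall>v\<in>Dstar q l. state_op q l \<mu> h f v - - \<i> * L2_inner l f v = F v)"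
    using f eq by blast
  fix g assume g: "g \<in> Dstar q l \<and> (\<forall>v\<in>Dstar q l. state_op q l \<mu> h g v - - \<i> * L2_inner l g v = F v)"
  define e where "e = (\<lambda>x. g x - f x)"
  have gD: "g \<in> Dstar q l" using g by blast
  have e: "e \<in> Dstar q l" using Dstar_add_cmult[OF gD f, of "-1"] by (simp add: e_def)
  have S: "state_op q l \<mu> h e e = state_op q l \<mu> h g e - state_op q l \<mu> h f e"
    unfolding e_def using g f e[unfolded e_def] by (intro state_op_diff) auto
  have N: "L2_inner l e e = L2_inner l g e - L2_inner l f e"
    using L2_inner_lincomb_left[OF DstarD(2)[OF gD] DstarD(2)[OF f] DstarD(2)[OF e], of 1 "-1"]
    by (simp add: e_def)
  have "state_op q l \<mu> h e e + \<i> * L2_inner l e e =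
      (state_op q l \<mu> h g e - (- \<i>) * L2_inner l g e) - (state_op q l \<mu> h f e - (- \<i>) * L2_inner l f e)"
    unfolding S N by (simp add: algebra_simps)
  also have "\<dots> = F e - F e" using g e eq[OF e] by simp
  finally have "state_op q l \<mu> h e e + \<i> * L2_inner l e e = 0" by simp
  then have "Im (state_op q l \<mu> h e e) + L2_sq l e = 0"
    using L2_inner_self[OF DstarD(2)[OF e]] by (simp add: complex_eq_iff)
  then have "L2_sq l e = 0"
    using state_op_Im_nonneg[OF e h, of \<mu>] L2_sq_nonneg[of l e] by simp
  then have "AE x in lebesgue_on {l..}. e x = 0" by (rule L2_sq_eq_0_AE[OF DstarD(2)[OF e]])
  note z = continuous_AE_zero[OF Dstar_continuous_on[OF e] this]
  have "e x = 0" for x using z[of x] DstarD(4)[OF e, of x] by (cases "x < l") auto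
  then show "g = f" by (auto simp: e_def)
qed

lemma \<psi>_multiple:
  fixes c :: complex
  defines "f \<equiv> \<lambda>x. c * \<psi> (- \<i>) x"
  shows "f \<in> Dstar q l" "f l = - c" "der l f l = c * minf (- \<i>)"
    "\<And>v. v \<in> Dstar q l \<Longrightarrow> L2_inner l (sl_expr q l f) v = - \<i> * L2_inner l f v"
proof -
  note p = \<psi>[of "- \<i>", simplified]
  show D: "f \<in> Dstar q l" unfolding f_def by (rule qform_cmult(1)[OF p(1)])
  show l: "f l = - c" by (simp add: f_def p)
  show d: "der l f l = c * minf (- \<i>)" unfolding f_def qform_cmult(3)[OF p(1)] by (simp add: p)
  fix v assume v: "v \<in> Dstar q l"
  have "form f v = c * form (\<psi> (- \<i>)) v"
    unfolding f_def using form_lincomb_left[OF p(1) p(1) v, of c 0] by simp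
  moreover have "L2_inner l f v = c * L2_inner l (\<psi> (- \<i>)) v"
    unfolding f_def using L2_inner_lincomb_left[OF DstarD(2)[OF p(1)] DstarD(2)[OF p(1)] DstarD(2)[OF v], of c 0] by simp
  moreover have "L2_inner l (sl_expr q l f) v = form f v + c * minf (- \<i>) * cnj (v l)"
    by (simp add: form_def d)
  ultimately show "L2_inner l (sl_expr q l f) v = - \<i> * L2_inner l f v"
    using form_\<psi>[of "- \<i>", OF _ v] by (simp add: algebra_simps)
qed

text \<open>The resolvent equation for the channel vector is solved by a multiple of the Weyl solution for \<open>-\<i>\<close>: only boundary
  terms at \<open>l\<close> remain, and they fix the factor. The parameter \<open>\<mu>\<close> contributes a factor of modulus one.\<close>

theorem norm_transfer_function:
  assumes h: "Im h > 0"
  shows "cmod (transfer_function q l \<mu> h (- \<i>)) = cmod (minf (- \<i>) + cnj h) / cmod (minf (- \<i>) + h)"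
proof -
  define M where "M = minf (- \<i>)"
  have "Im M > 0" using Im_minf_neg by (simp add: M_def minf_minus_i)
  then have nz: "M + h \<noteq> 0" using h by (auto simp: complex_eq_iff)
  have hh: "2 * \<i> * of_real (Im h) = h - cnj h" by (simp add: complex_eq_iff)
  show ?thesis
  proof (cases \<mu>)
    case (Finite r)
    let ?d = "of_real r - h"
    have dz: "?d \<noteq> 0" "cnj ?d \<noteq> 0" using h by (auto simp: complex_eq_iff)
    define a where "a = complex_of_real (sqrt (Im h) / cmod ?d)"
    have a2: "a * a = of_real (Im h) / (?d * cnj ?d)"
    proof -
      have "a * a = of_real (Im h / (cmod ?d)\<^sup>2)"
        unfolding a_def of_real_mult[symmetric] using h by (simp add: power2_eq_square)
      then show ?thesis unfolding complex_norm_square[symmetric] by simp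
    qed
    define c where "c = - a * ?d / (M + h)"
    define f where "f = (\<lambda>x. c * \<psi> (- \<i>) x)"
    note p = \<psi>_multiple[where c = c, folded f_def M_def]
    have fl: "f l = - c" using p(2) by (simp add: f_def)
    have ca: "- (1 / ?d) * (c * M + h * c) = a"
    proof -
      have "c * M + h * c = c * (M + h)" by (simp add: algebra_simps)
      also have "\<dots> = - (a * ?d)" using nz by (simp add: c_def)
      finally have "c * M + h * c = - (a * ?d)" .
      then show ?thesis using dz by simp
    qed
    have "state_resolvent q l \<mu> h (- \<i>) (channel_op l \<mu> h 1) = f"
    proof (rule state_resolvent_eq[OF h p(1)])
      fix v assume v: "v \<in> Dstar q l"
      have "state_op q l \<mu> h f v - (- \<i>) * L2_inner l f v
          = (- (1 / ?d) * (c * M + h * c)) * (of_real r * cnj (v l) - cnj (der l v l))"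
        using p(4)[OF v] by (simp add: Finite fl p(3) delta_def delta'_def)
      then show "state_op q l \<mu> h f v - (- \<i>) * L2_inner l f v = channel_op l \<mu> h 1 v"
        unfolding ca by (simp add: Finite channel_op_def delta_def delta'_def a_def)
    qed
    then have "transfer_function q l \<mu> h (- \<i>) = 1 - 2 * \<i> * (a * (of_real r * f l - der l f l))"
      by (simp add: transfer_function_def channel_adj_def Finite channel_op_def delta_def delta'_def a_def)
    also have "of_real r * f l - der l f l = a * ?d * (of_real r + M) / (M + h)"
    proof -
      have "of_real r * f l - der l f l = (- c) * (of_real r + M)"
        unfolding fl p(3) by (simp add: algebra_simps)
      also have "- c = a * ?d / (M + h)" by (simp add: c_def)
      finally show ?thesis by simp
    qed
    also have "1 - 2 * \<i> * (a * (a * ?d * (of_real r + M) / (M + h)))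
        = (cnj ?d * (M + h) - (2 * \<i> * of_real (Im h)) * (of_real r + M)) / (cnj ?d * (M + h))"
    proof -
      have "1 - 2 * \<i> * (a * (a * D * X / Y)) = (E * Y - (2 * \<i> * y) * X) / (E * Y)"
        if "D \<noteq> 0" "E \<noteq> 0" "Y \<noteq> 0" "a * a = y / (D * E)" for D E X Y y
      proof -
        have "a * (a * D * X / Y) = (a * a) * (D * X / Y)" by simp
        also have "\<dots> = y * X / (E * Y)" unfolding that(4) using that(1-3) by simp
        finally show ?thesis using that(1-3) by (simp add: diff_divide_distrib)
      qed
      from this[OF dz nz a2] show ?thesis .
    qed
    also have "2 * \<i> * of_real (Im h) = h - cnj h" by (rule hh)
    also have "cnj ?d * (M + h) - (h - cnj h) * (of_real r + M) = ?d * (M + cnj h)"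
      by (simp add: algebra_simps)
    finally have "cmod (transfer_function q l \<mu> h (- \<i>)) = (cmod ?d * cmod (M + cnj h)) / (cmod (cnj ?d) * cmod (M + h))"
      by (simp only: norm_mult norm_divide)
    then show ?thesis using dz unfolding complex_mod_cnj by (simp add: M_def)
  next
    case Infinite
    define a where "a = complex_of_real (sqrt (Im h))"
    have a2: "a * a = of_real (Im h)"
      unfolding a_def of_real_mult[symmetric] using h by simp
    define c where "c = - a / (M + h)"
    define f where "f = (\<lambda>x. c * \<psi> (- \<i>) x)"
    note p = \<psi>_multiple[where c = c, folded f_def M_def]
    have fl: "f l = - c" using p(2) by (simp add: f_def)
    have ca: "- (c * M + h * c) = a"
    proof -
      have "c * M + h * c = c * (M + h)" by (simp add: algebra_simps)
      also have "\<dots> = - a" using nz by (simp add: c_def)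
      finally show ?thesis by simp
    qed
    have "state_resolvent q l \<mu> h (- \<i>) (channel_op l \<mu> h 1) = f"
    proof (rule state_resolvent_eq[OF h p(1)])
      fix v assume v: "v \<in> Dstar q l"
      have "state_op q l \<mu> h f v - (- \<i>) * L2_inner l f v = (- (c * M + h * c)) * cnj (v l)"
        using p(4)[OF v] by (simp add: Infinite fl p(3) delta_def algebra_simps)
      then show "state_op q l \<mu> h f v - (- \<i>) * L2_inner l f v = channel_op l \<mu> h 1 v"
        unfolding ca by (simp add: Infinite channel_op_def delta_def a_def)
    qed
    then have "transfer_function q l \<mu> h (- \<i>) = 1 - 2 * \<i> * (a * f l)"
      by (simp add: transfer_function_def channel_adj_def Infinite channel_op_def delta_def a_def)
    also have "\<dots> = 1 - 2 * \<i> * (a * a) / (M + h)"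
      unfolding fl c_def by simp
    also have "\<dots> = (M + h - (h - cnj h)) / (M + h)"
    proof -
      have "1 - X / Y = (Y - X) / Y" if "Y \<noteq> 0" for X Y :: complex
        using that by (simp add: diff_divide_distrib)
      then show ?thesis unfolding a2 hh using nz by blast
    qed
    finally show ?thesis by (simp add: M_def norm_divide)
  qed
qed

section \<open>Accretivity and the quasi-kernel\<close>

lemma T_op_inner:
  assumes "(f, u) \<in> T_op q l h"
  shows "f \<in> Dstar q l" and "L2_inner l u f = of_real (qform f) + h * of_real ((cmod (f l))\<^sup>2)"
proof -
  show f: "f \<in> Dstar q l" using assms by (simp add: T_op_def sl_op_def)
  have "AE x in lebesgue_on {l..}. sl_expr q l f x = u x"
    using assms by (auto simp: T_op_def sl_op_def eq_commute)
  from L2_inner_cong_AE[OF DstarD(3)[OF f] DstarD(2)[OF f] this] L2_inner_sl_self[OF f]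
  have "L2_inner l u f = of_real (qform f) + der l f l * cnj (f l)" by simp
  also have "der l f l * cnj (f l) = h * of_real ((cmod (f l))\<^sup>2)"
    using assms complex_norm_square[of "f l"] by (simp add: T_op_def sl_op_def del: of_real_power)
  finally show "L2_inner l u f = of_real (qform f) + h * of_real ((cmod (f l))\<^sup>2)" .
qed

lemma T_op_sharp:
  assumes "e > 0"
  obtains f u where "(f, u) \<in> T_op q l h" "Re (L2_inner l u f) < m + e + Re h" "Im (L2_inner l u f) = Im h"
proof -
  obtain f where f: "f \<in> Dstar q l" "f l = 1" "der l f l = h" "qform f < m + e"
    using qform_lower_bound_sharp[OF assms] by blast
  then have "(f, sl_expr q l f) \<in> T_op q l h"
    using DstarD(3)[OF f(1)] by (simp add: T_op_def sl_op_def)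
  with T_op_inner(2)[OF this] f that show thesis by simp
qed

theorem accretive_T_op_iff: "accretive_op l (T_op q l h) \<longleftrightarrow> - m \<le> Re h"
proof
  assume acc: "accretive_op l (T_op q l h)"
  show "- m \<le> Re h"
  proof (rule field_le_epsilon)
    fix e :: real assume "e > 0"
    then obtain f u where f: "(f, u) \<in> T_op q l h" "Re (L2_inner l u f) < m + e + Re h"
      using T_op_sharp by blast
    have "0 \<le> Re (L2_inner l u f)" using acc f(1) unfolding accretive_op_def by blast
    then show "- m \<le> Re h + e" using f(2) by simp
  qed
next
  assume h: "- m \<le> Re h"
  have "0 \<le> Re (L2_inner l u f)" if "(f, u) \<in> T_op q l h" for f u
  proof -
    have "- Re h * (cmod (f l))\<^sup>2 \<le> m * (cmod (f l))\<^sup>2" using h by (intro mult_right_mono) auto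
    then show ?thesis using qform_lower_bound[OF T_op_inner(1)[OF that]] T_op_inner(2)[OF that] by simp
  qed
  then show "accretive_op l (T_op q l h)" unfolding accretive_op_def by blast
qed

lemma extremal_T_op:
  assumes h: "Im h > 0" "Re h = - m"
  shows "extremal_accretive_op l (T_op q l h)"
  unfolding extremal_accretive_op_def
proof (intro conjI ballI notI)
  show "accretive_op l (T_op q l h)" using h by (simp add: accretive_T_op_iff)
  fix \<alpha> :: real assume \<alpha>: "\<alpha> \<in> {0<..<pi/2}" and sect: "sectorial_op l \<alpha> (T_op q l h)"
  have "cot \<alpha> > 0" using \<alpha> by (auto simp: cot_def sin_gt_zero cos_gt_zero)
  then have "cot \<alpha> * Im h > 0" using h by simp
  then obtain f u where f: "(f, u) \<in> T_op q l h" "Re (L2_inner l u f) < m + cot \<alpha> * Im h + Re h" "Im (L2_inner l u f) = Im h"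
    using T_op_sharp by blast
  have "cot \<alpha> * \<bar>Im (L2_inner l u f)\<bar> \<le> Re (L2_inner l u f)"
    using sect f(1) unfolding sectorial_op_def by blast
  then show False using f(2,3) h by simp
qed

lemma accretive_state_op_Infinite:
  assumes "- m \<le> Re h"
  shows "accretive_state_op q l Infinite h"
  unfolding accretive_state_op_def
proof
  fix f assume f: "f \<in> Dstar q l"
  have "- Re h * (cmod (f l))\<^sup>2 \<le> m * (cmod (f l))\<^sup>2" using assms by (intro mult_right_mono) auto
  then show "0 \<le> Re (state_op q l Infinite h f f)"
    unfolding state_op_Infinite_self[OF f] using qform_lower_bound[OF f] by simp
qed

text \<open>The lower bound of the form stays sharp when the value at \<open>l\<close> is \<open>1\<close> and the derivative there is any real \<open>k\<close>. So
  accretivity makes a quadratic polynomial in \<open>k\<close> nonnegative. With \<open>k = j - m\<close>, \<open>d = r + m\<close> and \<open>y = Im h\<close> it is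
  \<open>d j\<^sup>2 + 2 j y\<^sup>2 - d y\<^sup>2\<close>, which is negative at \<open>j = 0\<close> for \<open>d > 0\<close> and at \<open>j = - (y + 1)\<close> for \<open>d \<le> 0\<close>.\<close>

lemma not_accretive_state_op_Finite:
  assumes h: "Im h > 0" "Re h = - m"
  shows "\<not> accretive_state_op q l (Finite r) h"
proof
  assume acc: "accretive_state_op q l (Finite r) h"
  define y d where "y = Im h" and "d = r + m"
  have hy: "h = of_real (- m) + \<i> * of_real y" using h by (simp add: complex_eq_iff y_def)
  have D: "(cmod (of_real r - h))\<^sup>2 = d\<^sup>2 + y\<^sup>2"
    unfolding cmod_power2 by (simp add: hy d_def)
  have Dpos: "d\<^sup>2 + y\<^sup>2 > 0" using h by (simp add: y_def sum_power2_gt_zero_iff)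
  have ge: "0 \<le> - d * y\<^sup>2 + d * j\<^sup>2 + 2 * j * y\<^sup>2" for j
  proof -
    define k where "k = j - m"
    define N where "N = of_real (k\<^sup>2) - 2 * h * of_real k + h * of_real r"
    have "0 \<le> m + Re (N / (of_real r - h))"
    proof (rule field_le_epsilon)
      fix e :: real assume "e > 0"
      then obtain f where f: "f \<in> Dstar q l" "f l = 1" "der l f l = of_real k" "qform f < m + e"
        using qform_lower_bound_sharp by blast
      have "state_op q l (Finite r) h f f = of_real (qform f) + N / (of_real r - h)"
        unfolding state_op_Finite_self[OF f(1) h(1)] f(2,3) N_def by (simp del: of_real_power)
      then have "0 \<le> qform f + Re (N / (of_real r - h))"
        using acc f(1) unfolding accretive_state_op_def by fastforce
      then show "0 \<le> m + Re (N / (of_real r - h)) + e" using f(4) by simp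
    qed
    also have "Re (N / (of_real r - h)) = Re (N * cnj (of_real r - h)) / (d\<^sup>2 + y\<^sup>2)"
      unfolding D[symmetric] by (simp only: divide_eq_mult_cnj[of N] Re_divide_of_real)
    finally have "0 \<le> (m + Re (N * cnj (of_real r - h)) / (d\<^sup>2 + y\<^sup>2)) * (d\<^sup>2 + y\<^sup>2)"
      using Dpos by (intro mult_nonneg_nonneg) auto
    also have "\<dots> = m * (d\<^sup>2 + y\<^sup>2) + Re (N * cnj (of_real r - h))"
    proof -
      have "(m + R / E) * E = m * E + R" if "0 < E" for R E :: real
        using that by (simp add: field_simps)
      then show ?thesis using Dpos by blast
    qed
    also have "\<dots> = - d * y\<^sup>2 + d * j\<^sup>2 + 2 * j * y\<^sup>2"
    proof -
      have "r = d - m" by (simp add: d_def)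
      then show ?thesis
        unfolding N_def hy k_def by (simp only:) (simp add: power2_eq_square algebra_simps)
    qed
    finally show ?thesis .
  qed
  have y: "y > 0" using h by (simp add: y_def)
  have "d * y\<^sup>2 \<le> 0" using ge[of 0] by simp
  then have d: "d \<le> 0" using y by (simp add: mult_le_0_iff not_less)
  have "0 \<le> d * (2 * y + 1) - 2 * (y + 1) * y\<^sup>2"
    using ge[of "- (y + 1)"] by (simp add: power2_eq_square algebra_simps)
  moreover have "d * (2 * y + 1) \<le> 0" using d y by (simp add: mult_nonpos_nonneg)
  moreover have "2 * (y + 1) * y\<^sup>2 > 0" using y by simp
  ultimately show False by linarith
qed

text \<open>The functional of an element of the quasi-kernel differs from \<open>l(f)\<close> by a multiple of the evaluation at \<open>l\<close>. Such a
  multiple is not given by a nonzero element of the Hilbert space, so both the difference and the multiple vanish.\<close>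

theorem quasi_kernel_Infinite:
  assumes h: "Re h = - m"
  shows "quasi_kernel q l Infinite h = krein_von_neumann_op q l m"
proof -
  have Re_eq: "state_op_Re q l Infinite h f v = L2_inner l (sl_expr q l f) v - (der l f l + m * f l) * cnj (v l)"
    if "f \<in> Dstar q l" "v \<in> Dstar q l" for f v :: "real \<Rightarrow> complex"
  proof -
    have 1: "state_op q l Infinite h f v = form f v + h * f l * cnj (v l)"
      by (simp add: form_def delta_def algebra_simps)
    have "state_op q l Infinite h v f = form v f + h * v l * cnj (f l)"
      by (simp add: form_def delta_def algebra_simps)
    then have 2: "state_op_adj q l Infinite h f v = form f v + cnj h * f l * cnj (v l)"
      unfolding state_op_adj_def by (simp add: form_commute[OF that] mult_ac)
    have "h + cnj h = - 2 * m" using h by (simp add: complex_add_cnj)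
    have "form f v + h * f l * cnj (v l) + (form f v + cnj h * f l * cnj (v l))
        = 2 * form f v + (h + cnj h) * (f l * cnj (v l))"
      by (simp add: algebra_simps)
    then have "(form f v + h * f l * cnj (v l) + (form f v + cnj h * f l * cnj (v l))) / 2 = form f v - m * f l * cnj (v l)"
      unfolding \<open>h + cnj h = - 2 * m\<close> by (simp add: add_divide_distrib diff_divide_distrib)
    then show ?thesis unfolding state_op_Re_def 1 2 by (simp add: form_def algebra_simps)
  qed
  have "(f, u) \<in> quasi_kernel q l Infinite h \<longleftrightarrow> (f, u) \<in> krein_von_neumann_op q l m" for f u :: "real \<Rightarrow> complex"
  proof
    assume "(f, u) \<in> quasi_kernel q l Infinite h"
    then have f: "f \<in> Dstar q l" and u: "u \<in> L2 l"
      and eq: "\<And>v. v \<in> Dstar q l \<Longrightarrow> state_op_Re q l Infinite h f v = L2_inner l u v"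
      by (auto simp: quasi_kernel_def)
    define w where "w = (\<lambda>x. sl_expr q l f x - u x)"
    have w: "w \<in> L2 l" unfolding w_def by (rule L2_diff[OF DstarD(3)[OF f] u])
    have wv: "L2_inner l w v = (der l f l + m * f l) * cnj (v l)" if v: "v \<in> Dstar q l" for v
      using eq[OF v] Re_eq[OF f v] L2_inner_lincomb_left[OF DstarD(3)[OF f] u DstarD(2)[OF v], of 1 "-1"]
      by (simp add: w_def algebra_simps)
    have w0: "AE x in lebesgue_on {l..}. w x = 0" by (rule orthogonal_imp_zero[OF w wv])
    then have "AE x in lebesgue_on {l..}. w x = 0 * w x" by eventually_elim simp
    from L2_inner_cong_AE[OF w DstarD(2)[OF \<psi>(1)[of \<i>, simplified]] this]
    have "L2_inner l w (\<psi> \<i>) = 0" by (simp add: L2_inner_def)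
    then have "der l f l + m * f l = 0"
      using wv[OF \<psi>(1)[of \<i>, simplified]] \<psi>(3)[of \<i>] by (simp add: neg_eq_iff_add_eq_0)
    moreover have "AE x in lebesgue_on {l..}. u x = sl_expr q l f x"
      using w0 by eventually_elim (simp add: w_def)
    ultimately show "(f, u) \<in> krein_von_neumann_op q l m"
      using f u by (simp add: krein_von_neumann_op_def sl_op_def)
  next
    assume "(f, u) \<in> krein_von_neumann_op q l m"
    then have f: "f \<in> Dstar q l" and u: "u \<in> L2 l" and b: "der l f l + m * f l = 0"
      and ae: "AE x in lebesgue_on {l..}. u x = sl_expr q l f x"
      by (auto simp: krein_von_neumann_op_def sl_op_def)
    have "state_op_Re q l Infinite h f v = L2_inner l u v" if v: "v \<in> Dstar q l" for v
      using L2_inner_cong_AE[OF u DstarD(2)[OF v] ae] Re_eq[OF f v] b by simp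
    then show "(f, u) \<in> quasi_kernel q l Infinite h" using f u by (simp add: quasi_kernel_def)
  qed
  then show ?thesis by auto
qed

end

section \<open>Maximal entropy\<close>

text \<open>Cross-multiplication turns the difference of the two fractions into
  \<open>2 B ((a\<^sup>2 - a0\<^sup>2) + (y - s)\<^sup>2)\<close> over a positive denominator.\<close>

lemma entropy_quotient_bound:
  fixes a a0 y B :: real
  assumes a0: "0 < a0" "a0 \<le> a" and y: "0 < y" and B: "0 < B"
  defines "s \<equiv> sqrt (a0\<^sup>2 + B\<^sup>2)"
  shows "0 < (s - B) / (s + B)"
    and "(s - B) / (s + B) \<le> (a\<^sup>2 + (B - y)\<^sup>2) / (a\<^sup>2 + (B + y)\<^sup>2)"
    and "(s - B) / (s + B) = (a\<^sup>2 + (B - y)\<^sup>2) / (a\<^sup>2 + (B + y)\<^sup>2) \<longleftrightarrow> a = a0 \<and> y = s"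
proof -
  have s2: "s\<^sup>2 = a0\<^sup>2 + B\<^sup>2" by (simp add: s_def)
  have "B\<^sup>2 < s\<^sup>2" using a0 by (simp add: s2)
  moreover have "0 \<le> s" by (simp add: s_def)
  ultimately have sB: "B < s" by (rule power2_less_imp_less)
  then show "0 < (s - B) / (s + B)" using B by simp
  let ?N = "a\<^sup>2 + (B - y)\<^sup>2" and ?D = "a\<^sup>2 + (B + y)\<^sup>2"
  have D: "0 < ?D" using a0 by (simp add: add_pos_nonneg)
  have "?N * (s + B) - (s - B) * ?D = 2 * B * ((a\<^sup>2 - a0\<^sup>2) + (y - s)\<^sup>2) + 2 * B * (a0\<^sup>2 + B\<^sup>2 - s\<^sup>2)"
    by (simp add: power2_eq_square algebra_simps)
  then have id: "?N * (s + B) - (s - B) * ?D = 2 * B * ((a\<^sup>2 - a0\<^sup>2) + (y - s)\<^sup>2)" by (simp add: s2)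
  have a2: "a0\<^sup>2 \<le> a\<^sup>2" using a0 by (intro power_mono) auto
  then have "0 \<le> ?N * (s + B) - (s - B) * ?D" unfolding id using B by simp
  then show "(s - B) / (s + B) \<le> ?N / ?D"
    using D sB B by (simp add: divide_le_eq le_divide_eq frac_le_eq divide_simps)
  have "(s - B) / (s + B) = ?N / ?D \<longleftrightarrow> ?N * (s + B) - (s - B) * ?D = 0"
  proof -
    have nz: "s + B \<noteq> 0" "?D \<noteq> 0" using D sB B by linarith+
    show ?thesis unfolding frac_eq_eq[OF nz] by auto
  qed
  also have "\<dots> \<longleftrightarrow> (a\<^sup>2 - a0\<^sup>2) + (y - s)\<^sup>2 = 0" unfolding id using B by simp
  also have "\<dots> \<longleftrightarrow> a\<^sup>2 - a0\<^sup>2 = 0 \<and> (y - s)\<^sup>2 = 0"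
    using a2 by (intro add_nonneg_eq_0_iff) auto
  also have "\<dots> \<longleftrightarrow> a = a0 \<and> y = s" using a0 by (auto simp: power2_eq_iff)
  finally show "(s - B) / (s + B) = ?N / ?D \<longleftrightarrow> a = a0 \<and> y = s" .
qed

theorem theorem34:
  fixes l :: real and q :: "real \<Rightarrow> real"
    and \<phi>1 \<phi>2 :: "complex \<Rightarrow> real \<Rightarrow> complex"
    and minf :: "complex \<Rightarrow> complex"
    and A B m s Smax :: real and h0 :: complex
  assumes "locally_summable l q"
    and "deficiency_index q l \<i> = 1" and "deficiency_index q l (-\<i>) = 1"
    and "nonnegative_op l (minimal_op q l)"
    and "fundamental_solutions q l \<phi>1 \<phi>2"
    and "weyl_function l \<phi>1 \<phi>2 minf"
    and "((\<lambda>t::real. minf (complex_of_real t)) \<longlongrightarrow> complex_of_real m) (at_left 0)"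
    and "A = Re (minf \<i>)" and "B = - Im (minf \<i>)"
    and "s = sqrt (A\<^sup>2 + B\<^sup>2 - 2 * m * A + m\<^sup>2)"
    and "Smax = - (1 / 2) * ln ((s - B) / (s + B))"
    and "h0 = complex_of_real (- m) + \<i> * complex_of_real (sqrt ((A - m)\<^sup>2 + B\<^sup>2))"
  shows "(s - B) / (s + B) > 0
    \<and> (\<forall>\<mu> h. accretive_L_system q l \<mu> h \<longrightarrow> c_entropy q l \<mu> h \<le> ereal Smax)
    \<and> (accretive_L_system q l Infinite h0 \<and> c_entropy q l Infinite h0 = ereal Smax)
    \<and> (\<forall>\<mu> h. accretive_L_system q l \<mu> h \<and> c_entropy q l \<mu> h = ereal Smax \<longrightarrow>
          extremal_accretive_op l (T_op q l h) \<and> h = h0 \<and> \<mu> = Infinite \<and>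
          quasi_kernel q l \<mu> h = krein_von_neumann_op q l m)"
proof -
  interpret weyl_problem q l \<phi>1 \<phi>2 minf m
    using assms(2,4-7) by unfold_locales
  have B: "0 < B" and a0: "0 < A - m"
    using Im_minf_neg m_less_Re_minf by (simp_all add: assms(8,9))
  have s: "s = sqrt ((A - m)\<^sup>2 + B\<^sup>2)"
    unfolding assms(10) by (rule arg_cong[where f = sqrt]) (simp add: power2_eq_square algebra_simps)
  define r where "r = (s - B) / (s + B)"
  define \<rho> where "\<rho> h = ((A + Re h)\<^sup>2 + (B - Im h)\<^sup>2) / ((A + Re h)\<^sup>2 + (B + Im h)\<^sup>2)" for h
  have rpos: "0 < r" unfolding r_def s by (rule entropy_quotient_bound(1)[OF a0 order_refl B B])
  have sys: "Im h > 0 \<and> - m \<le> Re h" if "accretive_L_system q l \<mu> h" for \<mu> h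
    using that by (simp add: accretive_L_system_def accretive_T_op_iff)
  have le: "r \<le> \<rho> h" and eq: "r = \<rho> h \<longleftrightarrow> h = h0" if "Im h > 0" "- m \<le> Re h" for h
  proof -
    have a: "A - m \<le> A + Re h" using that by simp
    show "r \<le> \<rho> h" unfolding r_def \<rho>_def s by (rule entropy_quotient_bound(2)[OF a0 a that(1) B])
    have "r = \<rho> h \<longleftrightarrow> A + Re h = A - m \<and> Im h = s"
      unfolding r_def \<rho>_def s by (rule entropy_quotient_bound(3)[OF a0 a that(1) B])
    also have "\<dots> \<longleftrightarrow> h = h0" by (auto simp: assms(12) s complex_eq_iff)
    finally show "r = \<rho> h \<longleftrightarrow> h = h0" .
  qed
  have ent: "c_entropy q l \<mu> h = ereal (- (1 / 2) * ln (\<rho> h))" if h: "Im h > 0" "- m \<le> Re h" for \<mu> h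
  proof -
    let ?W = "transfer_function q l \<mu> h (- \<i>)"
    have M: "minf (- \<i>) = Complex A B"
      by (simp add: minf_minus_i assms(8,9) complex_eq_iff)
    have "(cmod ?W)\<^sup>2 = \<rho> h"
      unfolding norm_transfer_function[OF h(1)] power_divide M cmod_power2 by (simp add: \<rho>_def)
    moreover have "0 < \<rho> h" using le[OF h] rpos by simp
    ultimately have W: "cmod ?W = sqrt (\<rho> h)" "?W \<noteq> 0"
      by (metis norm_ge_zero real_sqrt_unique) (use \<open>(cmod ?W)\<^sup>2 = \<rho> h\<close> \<open>0 < \<rho> h\<close> in auto)
    then show ?thesis using \<open>0 < \<rho> h\<close> by (simp add: c_entropy_def ln_sqrt)
  qed
  have Smax: "Smax = - (1 / 2) * ln r" by (simp add: assms(11) r_def)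
  have max: "c_entropy q l \<mu> h \<le> ereal Smax" if "accretive_L_system q l \<mu> h" for \<mu> h
    using ent[of h] le[of h] sys[OF that] rpos unfolding Smax by simp
  have h0: "Im h0 > 0" "Re h0 = - m" using a0 by (simp_all add: assms(12) sum_power2_gt_zero_iff)
  have sys0: "accretive_L_system q l Infinite h0"
    using h0 accretive_state_op_Infinite[of h0] by (simp add: accretive_L_system_def accretive_T_op_iff)
  have ent0: "c_entropy q l Infinite h0 = ereal Smax"
    using ent[of h0 Infinite] eq[of h0] h0 unfolding Smax by simp
  have "extremal_accretive_op l (T_op q l h) \<and> h = h0 \<and> \<mu> = Infinite \<and> quasi_kernel q l \<mu> h = krein_von_neumann_op q l m"
    if acc: "accretive_L_system q l \<mu> h" and S: "c_entropy q l \<mu> h = ereal Smax" for \<mu> h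
  proof -
    have h: "Im h > 0" "- m \<le> Re h" using sys[OF acc] by auto
    have "ln (\<rho> h) = ln r" using S unfolding ent[OF h] Smax by simp
    then have "r = \<rho> h" using le[OF h] rpos by simp
    then have "h = h0" using eq[OF h] by simp
    moreover have "\<mu> = Infinite"
    proof (cases \<mu>)
      case (Finite x)
      then show ?thesis
        using acc not_accretive_state_op_Finite[of h x] h0 \<open>h = h0\<close> by (simp add: accretive_L_system_def)
    qed
    ultimately show ?thesis
      using extremal_T_op[OF h0] quasi_kernel_Infinite[OF h0(2)] by simp
  qed
  then show ?thesis using rpos max sys0 ent0 unfolding r_def by blast
qed

end
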